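(* Let $k, n \in \mathbb{N}$ and let $Q(X_1, \ldots, X_n) \in \mathbb{Q}[X_1, \ldots, X_n]$ be a quadratic form. If $n \ge 2k+1$, then there exists an imaginary quadratic field extension $K$ of $\mathbb{Q}$ such that $Q$ vanishes identically on some $K$-linear subspace of $K^n$ of dimension at least $k$. *)

theory Defs
  imports
    "HOL-Library.Poly_Mapping"
    "HOL-Algebra.Embedded_Algebras"
    "Jordan_Normal_Form.VS_Connect"
begin

text \<open>
  A polynomial in \<open>X\<^sub>0, X\<^sub>1, \<dots>\<close> is a finitely supported map from monomials to coefficients,
  where a monomial is itself a finitely supported map from variable indices to exponents.
  The variables of a form in \<open>n\<close> variables are \<open>X\<^sub>0, \<dots>, X\<^sub>n\<^sub>-\<^sub>1\<close>. The zero form is allowed.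
\<close>

definition quadratic_form :: "nat \<Rightarrow> ((nat \<Rightarrow>\<^sub>0 nat) \<Rightarrow>\<^sub>0 'a::zero) \<Rightarrow> bool" where
  "quadratic_form n Q \<longleftrightarrow>
     (\<forall>m \<in> Poly_Mapping.keys Q.
        Poly_Mapping.keys m \<subseteq> {..<n} \<and> (\<Sum>i\<in>Poly_Mapping.keys m. Poly_Mapping.lookup m i) = 2)"

definition eval_poly :: "((nat \<Rightarrow>\<^sub>0 nat) \<Rightarrow>\<^sub>0 rat) \<Rightarrow> 'a::field_char_0 vec \<Rightarrow> 'a" where
  "eval_poly Q x =
     (\<Sum>m\<in>Poly_Mapping.keys Q.
        of_rat (Poly_Mapping.lookup Q m) * (\<Prod>i\<in>Poly_Mapping.keys m. x $ i ^ Poly_Mapping.lookup m i))"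

text \<open>
  Number fields are realised inside the complex numbers, which loses no generality up to
  isomorphism. A quadratic field is imaginary iff it has no real embedding; as it is Galois over
  \<open>\<rat>\<close>, this holds iff a given copy of it in \<open>\<complex>\<close> is not contained in \<open>\<real>\<close>.
\<close>

definition imaginary_quadratic_field :: "complex set \<Rightarrow> bool" where
  "imaginary_quadratic_field K \<longleftrightarrow>
     subfield K class_ring \<and> ring.dimension class_ring 2 \<rat> K \<and> \<not> K \<subseteq> \<real>"

definition field_of :: "'a::field set \<Rightarrow> 'a ring" where
  "field_of K = class_ring\<lparr>carrier := K\<rparr>"

definition vec_space_over :: "'a::field set \<Rightarrow> nat \<Rightarrow> ('a, 'a vec) module" where
  "vec_space_over K n =
     (module_vec TYPE('a) n)\<lparr>carrier := {v \<in> carrier_vec n. \<forall>i<n. v $ i \<in> K}\<rparr>"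

lemma vec_space_over_vectorspace:
  assumes "subfield K (class_ring :: 'a::field ring)"
  shows "vectorspace (field_of K) (vec_space_over K n)"
proof -
  let ?K = "field_of K" and ?V = "vec_space_over K n"
  note K = subringE[OF subfieldE(1)[OF assms]]
  have K0: "0 \<in> K" and K1: "1 \<in> K"
    and add: "\<And>a b. a \<in> K \<Longrightarrow> b \<in> K \<Longrightarrow> a + b \<in> K"
    and mult: "\<And>a b. a \<in> K \<Longrightarrow> b \<in> K \<Longrightarrow> a * b \<in> K"
    and neg: "\<And>a. a \<in> K \<Longrightarrow> - a \<in> K"
    using K by (auto simp: class_ring_simps)
  have F: "field ?K"
    unfolding field_of_def using ring.subfield_iff(2)[OF field.is_ring[OF class_field] assms] by simp
  have sel: "carrier ?K = K" "one ?K = 1" "mult ?K = (*)" "add ?K = (+)"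
    "carrier ?V = {v \<in> carrier_vec n. \<forall>i<n. v $ i \<in> K}" "add ?V = (+)" "zero ?V = 0\<^sub>v n"
    "smult ?V = (\<cdot>\<^sub>v)"
    by (simp_all add: field_of_def vec_space_over_def module_vec_def)
  have A: "abelian_group ?V"
  proof (rule abelian_groupI)
    fix x assume x: "x \<in> carrier ?V"
    show "\<exists>y\<in>carrier ?V. y \<oplus>\<^bsub>?V\<^esub> x = \<zero>\<^bsub>?V\<^esub>"
      using x by (intro bexI[of _ "- x"]) (auto simp: sel neg)
  qed (auto simp: sel add K0 comm_add_vec assoc_add_vec)
  have M: "Module.module ?K ?V"
    by (rule Module.module.intro[OF _ A])
       (use F in \<open>auto simp: field_def domain_def module_axioms_def sel mult
          add_smult_distrib_vec smult_add_distrib_vec\<close>)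
  show ?thesis
    unfolding vectorspace_def using M F by simp
qed

end

theory Submission
  imports Defs "HOL-Number_Theory.Number_Theory"
begin

text \<open>
  Diagonalise the form over \<open>\<rat>\<close> with integer coefficients, and let \<open>P\<close> be the set of primes dividing
  them. If \<open>K\<close> is imaginary quadratic and no prime of \<open>P \<union> {2}\<close> splits in it, then every quaternion algebra
  \<open>(a, b)\<close> with \<open>a\<close>, \<open>b\<close> composed of primes in \<open>P\<close> is split by \<open>K\<close>; hence every ternary diagonal form with such
  coefficients is isotropic over \<open>K\<close>. Splitting off a hyperbolic plane leaves one coefficient
  composed of the same primes, so a form in \<open>2k + 1\<close> variables yields \<open>k\<close> orthogonal isotropic
  vectors.

  As \<open>K\<close> one takes \<open>\<rat>(\<surd>-l)\<close> with \<open>l\<close> a prime such that \<open>l \<equiv> 3 (mod 8)\<close> and \<open>-l\<close> is a nonresidue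
  modulo the odd primes of \<open>P\<close>; it exists by the argument of Dirichlet's theorem applied to real characters.
  By bilinearity in \<open>a\<close> and \<open>b\<close>, splitting only has to be shown for \<open>-1\<close> and the primes of \<open>P\<close>, where it
  follows from quadratic reciprocity and Legendre's theorem on \<open>a x\<^sup>2 + b y\<^sup>2 = c z\<^sup>2\<close>, used with \<open>-l\<close>,
  a square in \<open>K\<close>, among the coefficients.
\<close>

section \<open>Prime numbers with prescribed quadratic characters\<close>

text \<open>Over the rationals a quaternion algebra \<open>(a, b)\<close> can ramify only at
  infinity and at primes dividing 2ab, and a quadratic field splits it as soon as it has a single
  complex or nonsplit place above each ramified one. This is where the condition on
  \<open>P \<union> {2}\<close> comes from; quadratic symbols take the place of the local theory.
  The obstacle is that the field must be fixed before any vector is split off, although the later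
  coefficients are unknown at that moment. Only their signs and prime divisors matter, and these
  stay in a finite set, so finitely many symbols of \<open>l\<close> suffice. A single prime
  \<open>l\<close> lets reciprocity turn all the conditions into one: every element of
  \<open>P\<close>, also 2, is a nonresidue modulo \<open>l\<close>. Prescribing values of symbols,
  instead of a residue class, involves only real characters, for which the nonvanishing of L(1,
  \<chi>) has an elementary proof.\<close>

lemma abs_sum_mult_antimono_le:
  fixes a g :: "nat \<Rightarrow> real"
  assumes B: "\<And>N. \<bar>\<Sum>n\<in>{m<..N}. a n\<bar> \<le> B"
    and dec: "\<And>n. n > m \<Longrightarrow> g (Suc n) \<le> g n"
    and nonneg: "\<And>n. n > m \<Longrightarrow> 0 \<le> g n"
  shows "\<bar>\<Sum>n\<in>{m<..N}. a n * g n\<bar> \<le> B * g (Suc m)"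
proof (cases "m \<le> N")
  case True
  define S where "S n = (\<Sum>k\<in>{m<..n}. a k)" for n
  have ins: "{m<..Suc n} = insert (Suc n) {m<..n}" if "m \<le> n" for n
    using that by auto
  \<comment> \<open>Abel summation with partial sums that start at \<open>m\<close>. Their common
    bound \<open>B\<close> then meets a telescoping sum, and the total is \<open>B\<close> times the
    first value of \<open>g\<close>.\<close>
  have id: "(\<Sum>n\<in>{m<..N}. a n * g n) = S N * g (Suc N) + (\<Sum>n\<in>{m<..N}. S n * (g n - g (Suc n)))"
    using True
  proof (induction N rule: dec_induct)
    case base
    then show ?case by (simp add: S_def)
  next
    case (step n)
    have "S (Suc n) = a (Suc n) + S n" using step.hyps by (simp add: S_def ins)
    then show ?case using step by (simp add: ins algebra_simps)
  qed
  have tel: "(\<Sum>n\<in>{m<..N}. g n - g (Suc n)) = g (Suc m) - g (Suc N)"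
    using True
  proof (induction N rule: dec_induct)
    case (step n)
    then show ?case by (simp add: ins)
  qed simp
  have "\<bar>\<Sum>n\<in>{m<..N}. a n * g n\<bar> \<le> \<bar>S N * g (Suc N)\<bar> + \<bar>\<Sum>n\<in>{m<..N}. S n * (g n - g (Suc n))\<bar>"
    unfolding id by (rule abs_triangle_ineq)
  also have "\<bar>S N * g (Suc N)\<bar> \<le> B * g (Suc N)"
    using True B[of N] nonneg[of "Suc N"] by (auto simp: abs_mult S_def intro!: mult_right_mono)
  also have "\<bar>\<Sum>n\<in>{m<..N}. S n * (g n - g (Suc n))\<bar> \<le> (\<Sum>n\<in>{m<..N}. \<bar>S n * (g n - g (Suc n))\<bar>)"
    by (rule sum_abs)
  also have "\<dots> \<le> (\<Sum>n\<in>{m<..N}. B * (g n - g (Suc n)))"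
    using B dec by (intro sum_mono) (auto simp: abs_mult S_def intro!: mult_right_mono)
  also have "\<dots> = B * (g (Suc m) - g (Suc N))" by (simp add: sum_distrib_left[symmetric] tel)
  finally show ?thesis by (simp add: algebra_simps)
next
  case False
  have "0 \<le> B" using B[of m] by simp
  then show ?thesis using False nonneg[of "Suc m"] by simp
qed

section \<open>Real characters and their L-series at 1\<close>

text \<open>Nontriviality enters as the vanishing of the sum over a period. The modulus
  \<open>M\<close> is only a period, not a conductor, so that products over different sets of
  symbols can share one \<open>M\<close>.\<close>

locale real_character =
  fixes \<chi> :: "nat \<Rightarrow> real" and M :: nat
  assumes M_pos: "M > 0"
    and mult: "\<chi> (a * b) = \<chi> a * \<chi> b"
    and one: "\<chi> 1 = 1"
    and vals: "\<chi> a \<in> {-1, 0, 1}"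
    and periodic: "\<chi> (a + M) = \<chi> a"
    and sum_period: "(\<Sum>a<M. \<chi> a) = 0"
begin

lemma abs_le_1: "\<bar>\<chi> a\<bar> \<le> 1"
  using vals[of a] by auto

lemma abs_sum_lessThan_le: "\<bar>\<Sum>a<N. \<chi> a\<bar> \<le> M"
proof (induction N rule: less_induct)
  case (less N)
  show ?case
  proof (cases "N < M")
    case True
    have "\<bar>\<Sum>a<N. \<chi> a\<bar> \<le> (\<Sum>a<N. \<bar>\<chi> a\<bar>)" by (rule sum_abs)
    also have "\<dots> \<le> (\<Sum>a<N. 1)" by (intro sum_mono abs_le_1)
    finally show ?thesis using True by simp
  next
    case False
    then obtain K where K: "N = K + M" by (metis add.commute le_iff_add not_less)
    have "(\<Sum>a<N. \<chi> a) = (\<Sum>a<M. \<chi> a) + (\<Sum>a\<in>{M..<M+K}. \<chi> a)"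
      unfolding K lessThan_atLeast0 by (simp add: add.commute sum.atLeastLessThan_concat)
    also have "(\<Sum>a\<in>{M..<M+K}. \<chi> a) = (\<Sum>a<K. \<chi> (a + M))"
      by (rule sum.reindex_bij_witness[of _ "\<lambda>a. a + M" "\<lambda>a. a - M"]) auto
    finally show ?thesis using less.IH[of K] M_pos by (simp add: periodic sum_period K)
  qed
qed

lemma abs_sum_greaterThanAtMost_le: "\<bar>\<Sum>a\<in>{m<..N}. \<chi> a\<bar> \<le> 2 * M"
proof (cases "m \<le> N")
  case True
  have "(\<Sum>a<Suc N. \<chi> a) = (\<Sum>a<Suc m. \<chi> a) + (\<Sum>a\<in>{m<..N}. \<chi> a)"
  proof -
    have "{..<Suc N} = {..<Suc m} \<union> {m<..N}" using True by auto
    then show ?thesis by (metis (no_types, lifting) finite_lessThan finite_greaterThanAtMost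
          sum.union_disjoint disjoint_iff greaterThanAtMost_iff lessThan_iff less_Suc_eq_le not_less)
  qed
  then show ?thesis using abs_sum_lessThan_le[of "Suc N"] abs_sum_lessThan_le[of "Suc m"] by simp
qed simp

lemmas abs_sum_mult_le = abs_sum_mult_antimono_le[where a = \<chi>, OF abs_sum_greaterThanAtMost_le]

definition L :: "nat \<Rightarrow> real" where "L N = (\<Sum>n\<in>{0<..N}. \<chi> n / n)"

lemma abs_L_diff_le:
  assumes "m \<le> N"
  shows "\<bar>L N - L m\<bar> \<le> 2 * M / Suc m"
proof -
  have "{0<..N} = {0<..m} \<union> {m<..N}" using assms by auto
  then have "L N - L m = (\<Sum>n\<in>{m<..N}. \<chi> n * (1 / n))"
    unfolding L_def by (simp add: sum.union_disjoint)
  also have "\<bar>\<dots>\<bar> \<le> 2 * M * (1 / Suc m)"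
    by (rule order_trans[OF abs_sum_mult_le]) (auto simp: field_simps)
  finally show ?thesis by simp
qed

lemma tendsto_lim_L: "L \<longlonglongrightarrow> lim L"
proof -
  have "Cauchy L"
  proof (rule CauchyI)
    fix e :: real assume e: "e > 0"
    obtain K :: nat where K: "4 * M / e < K" using reals_Archimedean2 by blast
    show "\<exists>K. \<forall>m\<ge>K. \<forall>n\<ge>K. norm (L m - L n) < e"
    proof (intro exI allI impI)
      fix m n assume "m \<ge> K" "n \<ge> K"
      then have "\<bar>L m - L K\<bar> \<le> 2 * M / Suc K" "\<bar>L n - L K\<bar> \<le> 2 * M / Suc K"
        using abs_L_diff_le by blast+
      then have "\<bar>L m - L n\<bar> \<le> 2 * (2 * M / Suc K)" by linarith
      also have "\<dots> < e" using K e by (simp add: field_simps)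
      finally show "norm (L m - L n) < e" by simp
    qed
  qed
  then show ?thesis by (simp add: Cauchy_convergent_iff convergent_LIMSEQ_iff)
qed

lemma abs_L_diff_lim_le: "\<bar>L m - lim L\<bar> \<le> 2 * M / Suc m"
proof (rule LIMSEQ_le_const2)
  show "(\<lambda>N. \<bar>L m - L N\<bar>) \<longlonglongrightarrow> \<bar>L m - lim L\<bar>" by (intro tendsto_intros tendsto_lim_L)
  show "\<exists>K. \<forall>N\<ge>K. \<bar>L m - L N\<bar> \<le> 2 * M / Suc m"
    using abs_L_diff_le by (metis abs_minus_commute)
qed

end

section \<open>Divisor sums and Monsky's inequality\<close>

text \<open>Pairs of \<open>k\<close> and a divisor \<open>d\<close> correspond to pairs
  \<open>n = d\<close>, \<open>m = k div d\<close> with product at most \<open>N\<close>. This one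
  reordering serves the Lambert series, ln N!, and the convolution ln = 1 * \<Lambda> twisted by a
  character.\<close>

lemma sum_divisors_swap:
  fixes F :: "nat \<Rightarrow> nat \<Rightarrow> 'a::comm_monoid_add"
  shows "(\<Sum>k\<in>{0<..N}. \<Sum>d | d dvd k. F d (k div d)) = (\<Sum>n\<in>{0<..N}. \<Sum>m\<in>{0<..N div n}. F n m)"
proof -
  have "(\<Sum>k\<in>{0<..N}. \<Sum>d | d dvd k. F d (k div d))
    = (\<Sum>(k, d)\<in>(SIGMA k:{0<..N}. {d. d dvd k}). F d (k div d))"
    by (rule sum.Sigma) auto
  also have "\<dots> = (\<Sum>(n, m)\<in>(SIGMA n:{0<..N}. {0<..N div n}). F n m)"
    by (rule sum.reindex_bij_witness[of _ "\<lambda>(n, m). (n * m, n)" "\<lambda>(k, d). (d, k div d)"];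
      (auto simp: less_eq_div_iff_mult_less_eq mult.commute dvd_imp_le div_le_mono
        intro: Nat.gr0I dest: dvd_imp_le elim!: dvdE)?)
      (metis dvd_triv_left dvd_imp_le order.trans nat_0_less_mult_iff)
  also have "\<dots> = (\<Sum>n\<in>{0<..N}. \<Sum>m\<in>{0<..N div n}. F n m)"
    by (rule sum.Sigma[symmetric]) auto
  finally show ?thesis .
qed

lemma sum_divisors_coprime_mult:
  fixes f :: "nat \<Rightarrow> real"
  assumes f: "\<And>a b. f (a * b) = f a * f b" and ab: "coprime a b" "a > 0" "b > 0"
  shows "(\<Sum>d | d dvd a * b. f d) = (\<Sum>d | d dvd a. f d) * (\<Sum>d | d dvd b. f d)"
proof -
  have "(\<Sum>d | d dvd a. f d) * (\<Sum>d | d dvd b. f d)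
      = (\<Sum>(x, y)\<in>{d. d dvd a} \<times> {d. d dvd b}. f (x * y))"
    by (simp add: sum_product sum.cartesian_product f)
  also have "\<dots> = (\<Sum>d\<in>(\<lambda>(x, y). x * y) ` ({d. d dvd a} \<times> {d. d dvd b}). f d)"
  proof (subst sum.reindex)
    show "inj_on (\<lambda>(x, y). x * y) ({d. d dvd a} \<times> {d. d dvd b})"
    proof (rule inj_onI, clarsimp)
      fix x y x' y' assume h: "x dvd a" "y dvd b" "x' dvd a" "y' dvd b" "x * y = x' * y'"
      have cop: "coprime x y'" "coprime x' y" using coprime_divisors[OF h(1,4) ab(1)] coprime_divisors[OF h(3,2) ab(1)] .
      have "x dvd x' * y'" "x' dvd x * y" "y dvd x' * y'" "y' dvd x * y"
        using dvd_triv_left[of x y] dvd_triv_left[of x' y'] dvd_triv_right[of y x] dvd_triv_right[of y' x']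
        by (simp_all only: h(5))
      then have "x dvd x'" "x' dvd x" "y dvd y'" "y' dvd y"
        using cop by (simp_all add: coprime_dvd_mult_left_iff coprime_dvd_mult_right_iff)
          (metis coprime_commute coprime_dvd_mult_right_iff)+
      then show "x = x' \<and> y = y'" by (simp add: dvd_antisym)
    qed
  qed (simp add: case_prod_unfold)
  also have "(\<lambda>(x, y). x * y) ` ({d. d dvd a} \<times> {d. d dvd b}) = {d. d dvd a * b}"
  proof (intro subset_antisym subsetI)
    fix d assume "d \<in> {d. d dvd a * b}"
    then obtain x y where "d = x * y" "x dvd a" "y dvd b" using division_decomp[of d a b] by blast
    then show "d \<in> (\<lambda>(x, y). x * y) ` ({d. d dvd a} \<times> {d. d dvd b})" by force
  qed (auto intro: mult_dvd_mono)
  finally show ?thesis ..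
qed

text \<open>The mean inequality for 1, r^2, ..., r^(2n-2), whose geometric mean is r^(n-1); the
  extra factor \<open>r\<close> avoids the exponent n - 1. The induction goes in steps of two by
  pairing the first term with the last.\<close>

lemma geometric_sum_amgm:
  fixes r :: real
  assumes "0 \<le> r"
  shows "n * r ^ n \<le> r * (\<Sum>i<n. r ^ (2 * i))"
proof (induction n rule: induct_nat_012)
  case (ge2 n)
  have "(\<Sum>i<Suc (Suc n). r ^ (2 * i)) = 1 + (\<Sum>i<Suc n. r ^ (2 * Suc i))"
    by (subst sum.lessThan_Suc_shift) simp
  also have "\<dots> = 1 + r\<^sup>2 * (\<Sum>i<n. r ^ (2 * i)) + (r ^ Suc n)\<^sup>2"
    by (simp add: sum_distrib_left power2_eq_square power_mult power_mult_distrib mult_ac)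
  finally have "r * (\<Sum>i<Suc (Suc n). r ^ (2 * i))
      = r * (1 + (r ^ Suc n)\<^sup>2) + r\<^sup>2 * (r * (\<Sum>i<n. r ^ (2 * i)))"
    by (simp add: algebra_simps)
  also have "\<dots> \<ge> r * (2 * r ^ Suc n) + r\<^sup>2 * (n * r ^ n)"
  proof (intro add_mono mult_left_mono ge2)
    have "0 \<le> (1 - r ^ Suc n)\<^sup>2" by simp
    then show "2 * r ^ Suc n \<le> 1 + (r ^ Suc n)\<^sup>2" by (simp add: power2_eq_square algebra_simps)
  qed (use assms in auto)
  finally show ?case by (simp add: algebra_simps power2_eq_square)
qed (use assms in auto)

text \<open>With t = r^2, two instances of the mean inequality multiply to the exponent 2n + 1 of
  \<open>r\<close>, while 2n + 2 is wanted; as r < 1 the inequality goes the right way.\<close>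

lemma geometric_sums_mult_ge:
  fixes t :: real
  assumes "0 < t" "t < 1"
  shows "real n * Suc n * t ^ n \<le> (\<Sum>i<n. t ^ i) * (\<Sum>i<Suc n. t ^ i)"
proof -
  define r where "r = sqrt t"
  have r: "0 < r" "r < 1" "r\<^sup>2 = t" using assms by (auto simp: r_def)
  define S where "S n = (\<Sum>i<n. t ^ i)" for n
  have S: "(\<Sum>i<n. r ^ (2 * i)) = S n" for n
    using r by (simp add: power_mult S_def)
  have "t * (real n * Suc n * t ^ n) = real n * Suc n * r ^ (2 * n + 2)"
    unfolding power_add power_mult r(3) by (simp add: mult_ac)
  also have "\<dots> \<le> real n * Suc n * r ^ (n + Suc n)"
    using r by (intro mult_left_mono power_decreasing) auto
  also have "\<dots> = (n * r ^ n) * (Suc n * r ^ Suc n)" by (simp only: power_add mult_ac)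
  also have "\<dots> \<le> (r * S n) * (r * S (Suc n))"
    using r unfolding S[symmetric]
    by (intro mult_mono[OF geometric_sum_amgm geometric_sum_amgm] mult_nonneg_nonneg sum_nonneg) auto
  also have "\<dots> = t * (S n * S (Suc n))"
    unfolding r(3)[symmetric] by (simp add: power2_eq_square mult_ac)
  finally have "t * (real n * Suc n * t ^ n) \<le> t * ((\<Sum>i<n. t ^ i) * (\<Sum>i<Suc n. t ^ i))"
    unfolding S_def .
  then show ?thesis using assms by (simp only: mult_le_cancel_left_pos)
qed

text \<open>With \<open>s n\<close> = 1 + ... + t^(n-1), the coefficient (1 - t) b(n) is 1/n - t^n /
  s(n). Its second part drops by t^n / (s(n) s(n+1)), which the product inequality bounds by
  1/(n(n+1)), the drop of 1/n.\<close>

lemma monsky_antimono: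
  fixes t :: real
  assumes t: "0 < t" "t < 1" and n: "n > 0"
  defines "b \<equiv> \<lambda>n::nat. 1 / (n * (1 - t)) - t ^ n / (1 - t ^ n)"
  shows "b (Suc n) \<le> b n" "0 \<le> b n"
proof -
  define s where "s n = (\<Sum>i<n. t ^ i)" for n
  have s: "1 - t ^ n = (1 - t) * s n" for n
    by (simp add: s_def one_diff_power_eq)
  have s_pos: "s n > 0" if "n > 0" for n
    unfolding s_def using that t by (intro sum_pos) auto
  have b: "b n = (1 / n - t ^ n / s n) / (1 - t)" if "n > 0" for n
    unfolding b_def s by (simp add: diff_divide_distrib mult.commute)
  have s_Suc: "s (Suc n) = 1 + t * s n"
    unfolding s_def by (subst sum.lessThan_Suc_shift) (simp add: sum_distrib_left)
  have "t ^ n / s n - t ^ Suc n / s (Suc n) = t ^ n * (s (Suc n) - t * s n) / (s n * s (Suc n))"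
    using s_pos[of n] s_pos[of "Suc n"] n by (simp add: field_simps)
  also have "\<dots> = t ^ n / (s n * s (Suc n))" by (simp add: s_Suc)
  also have "\<dots> \<le> t ^ n / (real n * Suc n * t ^ n)"
    using geometric_sums_mult_ge[OF t, of n] t n unfolding s_def[symmetric]
    by (intro divide_left_mono) (auto intro!: mult_pos_pos s_pos)
  also have "\<dots> = 1 / (real n * Suc n)" using t by simp
  also have "\<dots> = 1 / n - 1 / Suc n" using n by (simp add: field_simps)
  finally have "1 / Suc n - t ^ Suc n / s (Suc n) \<le> 1 / n - t ^ n / s n" by simp
  then show "b (Suc n) \<le> b n"
    using t n by (simp add: b divide_right_mono del: of_nat_Suc power_Suc)
  have "n * t ^ n = (\<Sum>i<n. t ^ n)" by simp
  also have "\<dots> \<le> s n" unfolding s_def using t by (intro sum_mono power_decreasing) auto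
  finally have "t ^ n / s n \<le> 1 / n" using n s_pos[OF n] by (simp add: field_simps)
  then show "0 \<le> b n" using t n by (simp add: b)
qed

context real_character
begin

lemma power: "\<chi> (a ^ n) = \<chi> a ^ n"
  by (induction n) (use one in \<open>auto simp: mult\<close>)

lemma sum_divisors_prime_power:
  assumes "prime p"
  shows "(\<Sum>d | d dvd p ^ e. \<chi> d) = (\<Sum>i\<le>e. \<chi> p ^ i)"
proof -
  have "{d. d dvd p ^ e} = (\<lambda>i. p ^ i) ` {..e}"
    using assms by (auto simp: divides_primepow_nat)
  moreover have "inj_on (\<lambda>i. p ^ i) {..e}"
    using prime_gt_1_nat[OF assms] by (auto simp: inj_on_def)
  ultimately show ?thesis by (simp add: sum.reindex power)
qed

text \<open>The sum is e + 1, 1, or an alternating sum that is 0 or 1. Even exponents avoid the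
  value 0, which is why squares get divisor sums at least 1.\<close>

lemma sum_powers_nonneg: "0 \<le> (\<Sum>i\<le>e. \<chi> p ^ i)"
  and sum_powers_even_ge_1: "1 \<le> (\<Sum>i\<le>2 * e. \<chi> p ^ i)"
proof -
  consider "\<chi> p = 1" | "\<chi> p = 0" | "\<chi> p = -1" using vals[of p] by auto
  then have "0 \<le> (\<Sum>i\<le>e. \<chi> p ^ i) \<and> 1 \<le> (\<Sum>i\<le>2 * e. \<chi> p ^ i)"
  proof cases
    case 3
    have "(\<Sum>i\<le>e. (-1::real) ^ i) = (if even e then 1 else 0)" for e by (induction e) auto
    with 3 show ?thesis by simp
  qed (auto simp: power_0_left)
  then show "0 \<le> (\<Sum>i\<le>e. \<chi> p ^ i)" "1 \<le> (\<Sum>i\<le>2 * e. \<chi> p ^ i)" by auto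
qed

lemma sum_divisors_nonneg: "n > 0 \<Longrightarrow> 0 \<le> (\<Sum>d | d dvd n. \<chi> d)"
proof (induction n rule: less_induct)
  case (less n)
  show ?case
  proof (cases "n = 1")
    case False
    then obtain p where p: "prime p" "p dvd n" using prime_factor_nat by blast
    obtain m where m: "n = p ^ multiplicity p n * m" "\<not> p dvd m"
      using multiplicity_decompose'[of n p] less.prems p(1) by (metis not_prime_unit less_numeral_extra(3))
    have "m > 0" "coprime (p ^ multiplicity p n) m" 
      using m less.prems p by (auto intro: Nat.gr0I prime_imp_coprime)
    moreover have "m < n"
      using m \<open>m > 0\<close> p less.prems by (metis dvd_triv_right dvd_imp_le le_neq_implies_less)
    moreover have "p ^ multiplicity p n > 0" using p by (simp add: prime_gt_0_nat)
    ultimately show ?thesis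
      using less.IH[of m] sum_powers_nonneg
      by (subst m(1), subst sum_divisors_coprime_mult[OF mult]) (auto simp: sum_divisors_prime_power[OF p(1)])
  qed (use one in simp)
qed

lemma sum_divisors_square_ge_1: "n > 0 \<Longrightarrow> 1 \<le> (\<Sum>d | d dvd n\<^sup>2. \<chi> d)"
proof (induction n rule: less_induct)
  case (less n)
  show ?case
  proof (cases "n = 1")
    case False
    then obtain p where p: "prime p" "p dvd n" using prime_factor_nat by blast
    define e where "e = multiplicity p n"
    obtain m where m: "n = p ^ e * m" "\<not> p dvd m"
      using multiplicity_decompose'[of n p] less.prems p(1) unfolding e_def
      by (metis not_prime_unit less_numeral_extra(3))
    have "m > 0" using m less.prems by (auto intro: Nat.gr0I)
    moreover have cop: "coprime (p ^ (2 * e)) (m\<^sup>2)"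
      using m p by (auto intro: prime_imp_coprime)
    moreover have "m < n"
      using m \<open>m > 0\<close> p less.prems by (metis dvd_triv_right dvd_imp_le le_neq_implies_less)
    moreover have "n\<^sup>2 = p ^ (2 * e) * m\<^sup>2" by (simp add: m(1) power_mult_distrib power_mult[symmetric] mult.commute)
    moreover have "p ^ (2 * e) > 0" using p by (simp add: prime_gt_0_nat)
    ultimately have "(\<Sum>d | d dvd n\<^sup>2. \<chi> d) = (\<Sum>i\<le>2 * e. \<chi> p ^ i) * (\<Sum>d | d dvd m\<^sup>2. \<chi> d)"
      by (simp add: sum_divisors_coprime_mult[OF mult cop] sum_divisors_prime_power[OF p(1)])
    moreover have "1 \<le> (\<Sum>d | d dvd m\<^sup>2. \<chi> d)" using less.IH \<open>m < n\<close> \<open>m > 0\<close> by blast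
    ultimately show ?thesis
      using mult_mono[OF sum_powers_even_ge_1[of p e], of 1] sum_powers_nonneg by fastforce
  qed (use one in simp)
qed

text \<open>
  This is Monsky's proof of \<open>L(1, \<chi>) \<noteq> 0\<close>. The Lambert series
  \<open>\<Sum>\<chi>(n) t\<^sup>n / (1 - t\<^sup>n)\<close> is the power series whose coefficients are the divisor sums of \<open>\<chi>\<close>, so it
  is unbounded as \<open>t\<close> tends to 1; comparing it with \<open>L(1, \<chi>) / (1 - t)\<close> leaves the coefficients
  \<open>b\<close>, which decrease. All sums are truncated at \<open>N\<close>, at the cost of the last term.
\<close>

lemma lambert_sum_le:
  fixes t :: real
  assumes t: "0 < t" "t < 1"
  shows "(\<Sum>k\<in>{0<..N}. (\<Sum>d | d dvd k. \<chi> d) * t ^ k) \<le> \<bar>L N\<bar> / (1 - t) + 2 * M + N * t ^ N / (1 - t)"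
proof -
  define b where "b = (\<lambda>n::nat. 1 / (n * (1 - t)) - t ^ n / (1 - t ^ n))"
  have "(\<Sum>k\<in>{0<..N}. (\<Sum>d | d dvd k. \<chi> d) * t ^ k)
      = (\<Sum>k\<in>{0<..N}. \<Sum>d | d dvd k. \<chi> d * (t ^ d) ^ (k div d))"
    by (auto simp: sum_distrib_right power_mult[symmetric] intro!: sum.cong)
  also have "\<dots> = (\<Sum>n\<in>{0<..N}. \<Sum>m\<in>{0<..N div n}. \<chi> n * (t ^ n) ^ m)"
    by (rule sum_divisors_swap)
  also have "\<dots> \<le> (\<Sum>n\<in>{0<..N}. \<chi> n * (t ^ n / (1 - t ^ n)) + t ^ N / (1 - t))"
  proof (intro sum_mono)
    fix n assume "n \<in> {0<..N}"
    then have n: "n > 0" "n \<le> N" by auto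
    define y where "y = t ^ n"
    have "t ^ n \<le> t ^ 1" using t n by (intro power_decreasing) auto
    then have y: "0 < y" "y < 1" "y \<le> t" using t by (auto simp: y_def)
    have geo: "(1 - y) * (\<Sum>m\<in>{0<..q}. y ^ m) = y - y ^ Suc q" for q
    proof (induction q)
      case (Suc q)
      have "{0<..Suc q} = insert (Suc q) {0<..q}" by auto
      then have "(1 - y) * (\<Sum>m\<in>{0<..Suc q}. y ^ m) = (1 - y) * y ^ Suc q + (1 - y) * (\<Sum>m\<in>{0<..q}. y ^ m)"
        by (simp add: distrib_left)
      then show ?case unfolding Suc by (simp add: algebra_simps)
    qed simp
    \<comment> \<open>The inner sum is a geometric series cut off at q = N div n. Since n (q + 1) >=
      N, the missing tail is at most t^N / (1 - t) for every \<open>n\<close>; \<open>N\<close> such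
      errors give the last term of the bound.\<close>
    have "(\<Sum>m\<in>{0<..q}. y ^ m) = y / (1 - y) - y ^ Suc q / (1 - y)" for q
      using geo[of q] y by (simp only: diff_divide_distrib[symmetric]) (simp add: eq_divide_eq mult.commute)
    then have "(\<Sum>m\<in>{0<..N div n}. \<chi> n * y ^ m) = \<chi> n * (y / (1 - y)) + - (\<chi> n * (y ^ Suc (N div n) / (1 - y)))"
      by (simp add: sum_distrib_left[symmetric] right_diff_distrib)
    also have "- (\<chi> n * (y ^ Suc (N div n) / (1 - y))) \<le> \<bar>\<chi> n\<bar> * (y ^ Suc (N div n) / (1 - y))"
      using y by (smt (verit, ccfv_SIG) mult_minus_left divide_nonneg_pos mult_right_mono zero_le_power)
    also have "\<dots> \<le> 1 * (y ^ Suc (N div n) / (1 - y))"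
      using y by (intro mult_right_mono abs_le_1) auto
    also have "y ^ Suc (N div n) \<le> t ^ N"
    proof -
      have "N \<le> n * Suc (N div n)" using n(1) by (metis dividend_less_times_div less_imp_le mult_Suc_right add.commute)
      then show ?thesis using t unfolding y_def power_mult[symmetric] by (intro power_decreasing) auto
    qed
    finally show "(\<Sum>m\<in>{0<..N div n}. \<chi> n * (t ^ n) ^ m) \<le> \<chi> n * (t ^ n / (1 - t ^ n)) + t ^ N / (1 - t)"
      using y t unfolding y_def[symmetric]
      by (smt (verit, best) divide_right_mono frac_le zero_less_power mult_1)
  qed
  also have "\<dots> = (\<Sum>n\<in>{0<..N}. \<chi> n * (t ^ n / (1 - t ^ n))) + N * t ^ N / (1 - t)"
    by (simp add: sum.distrib)
  also have "(\<Sum>n\<in>{0<..N}. \<chi> n * (t ^ n / (1 - t ^ n))) = L N / (1 - t) + - (\<Sum>n\<in>{0<..N}. \<chi> n * b n)"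
    unfolding b_def L_def by (simp add: sum_divide_distrib sum_subtractf[symmetric] algebra_simps)
  also have "L N / (1 - t) \<le> \<bar>L N\<bar> / (1 - t)" using t by (intro divide_right_mono) auto
  also have "- (\<Sum>n\<in>{0<..N}. \<chi> n * b n) \<le> 2 * M"
  proof -
    have "\<bar>\<Sum>n\<in>{0<..N}. \<chi> n * b n\<bar> \<le> 2 * M * b (Suc 0)"
      by (rule order_trans[OF abs_sum_mult_le]) (use monsky_antimono[OF t] in \<open>auto simp: b_def\<close>)
    \<comment> \<open>1/(1 - t) - t/(1 - t) = 1: the Abel bound does not depend on \<open>t\<close>,
      which is what makes letting \<open>t\<close> approach 1 profitable.\<close>
    also have "b (Suc 0) = 1" using t by (simp add: b_def field_simps)
    finally show ?thesis by simp
  qed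
  finally show ?thesis by simp
qed

lemma lim_L_nonzero: "lim L \<noteq> 0"
proof
  assume L0: "lim L = 0"
  \<comment> \<open>Chosen so that Bernoulli's inequality gives t^(J^2) >= 1/2. The first
    \<open>J\<close> squares then contribute at least J/2 = 2M + 1/2, more than the bound 2M that
    remains when L(1, \<chi>) = 0.\<close>
  define J where "J = 4 * M + 1"
  define t where "t = 1 - 1 / (2 * real (J\<^sup>2))"
  have "J\<^sup>2 \<ge> 1" by (simp add: J_def)
  then have J2: "real (J\<^sup>2) \<ge> 1" by linarith
  have "0 < 1 / (2 * x)" "1 / (2 * x) < 1" if "x \<ge> 1" for x :: real using that by (simp_all add: field_simps)
  from this[OF J2] have "0 < 1 / (2 * real (J\<^sup>2))" "1 / (2 * real (J\<^sup>2)) < 1" .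
  then have t: "0 < t" "t < 1" by (simp_all add: t_def)
  have "J * t ^ (J\<^sup>2) \<le> 2 * M"
  \<comment> \<open>\<open>N\<close> tends to infinity with \<open>t\<close> fixed. The assumption
    turns the bound on \<open>L N\<close> into one of order 1/N, so of the three terms only 2M
    survives.\<close>
  proof (rule LIMSEQ_le_const)
    have "(\<lambda>N. 2 * M / Suc N / (1 - t) + 2 * M + N * t ^ N / (1 - t)) \<longlonglongrightarrow> 0 / (1 - t) + 2 * M + 0 / (1 - t)"
      using t by (intro tendsto_intros lim_const_over_n[THEN LIMSEQ_Suc] powser_times_n_limit_0) auto
    then show "(\<lambda>N. 2 * M / Suc N / (1 - t) + 2 * M + N * t ^ N / (1 - t)) \<longlonglongrightarrow> 2 * M" by simp
    show "\<exists>N0. \<forall>N\<ge>N0. J * t ^ (J\<^sup>2) \<le> 2 * M / Suc N / (1 - t) + 2 * M + N * t ^ N / (1 - t)"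
    proof (intro exI allI impI)
      fix N assume N: "N \<ge> J\<^sup>2"
      have "J * t ^ (J\<^sup>2) = (\<Sum>j\<in>{0<..J}. t ^ (J\<^sup>2))" by simp
      also have "\<dots> \<le> (\<Sum>j\<in>{0<..J}. (\<Sum>d | d dvd j\<^sup>2. \<chi> d) * t ^ (j\<^sup>2))"
      proof (intro sum_mono)
        fix j assume "j \<in> {0<..J}"
        then have j: "j > 0" "j\<^sup>2 \<le> J\<^sup>2" by (auto intro: power_mono)
        have "t ^ (J\<^sup>2) \<le> 1 * t ^ (j\<^sup>2)" using t j by (simp add: power_decreasing)
        also have "\<dots> \<le> (\<Sum>d | d dvd j\<^sup>2. \<chi> d) * t ^ (j\<^sup>2)"
          using t by (intro mult_right_mono sum_divisors_square_ge_1 j) auto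
        finally show "t ^ (J\<^sup>2) \<le> (\<Sum>d | d dvd j\<^sup>2. \<chi> d) * t ^ (j\<^sup>2)" .
      qed
      also have "\<dots> = (\<Sum>k\<in>(\<lambda>j. j\<^sup>2) ` {0<..J}. (\<Sum>d | d dvd k. \<chi> d) * t ^ k)"
        by (subst sum.reindex) (auto simp: inj_on_def)
      also have "\<dots> \<le> (\<Sum>k\<in>{0<..N}. (\<Sum>d | d dvd k. \<chi> d) * t ^ k)"
      proof (rule sum_mono2)
        show "(\<lambda>j. j\<^sup>2) ` {0<..J} \<subseteq> {0<..N}"
          using N by (auto intro: order_trans[OF power_mono])
        show "0 \<le> (\<Sum>d | d dvd k. \<chi> d) * t ^ k" if "k \<in> {0<..N} - (\<lambda>j. j\<^sup>2) ` {0<..J}" for k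
          using that t by (intro mult_nonneg_nonneg sum_divisors_nonneg) auto
      qed simp
      also have "\<dots> \<le> \<bar>L N\<bar> / (1 - t) + 2 * M + N * t ^ N / (1 - t)" by (rule lambert_sum_le[OF t])
      also have "\<bar>L N\<bar> / (1 - t) \<le> 2 * M / Suc N / (1 - t)"
        using abs_L_diff_lim_le[of N] t unfolding L0 by (intro divide_right_mono) auto
      finally show "J * t ^ (J\<^sup>2) \<le> 2 * M / Suc N / (1 - t) + 2 * M + N * t ^ N / (1 - t)" by simp
    qed
  qed
  moreover have "1 / 2 \<le> t ^ (J\<^sup>2)"
  proof -
    have "1 + real (J\<^sup>2) * (- (1 / (2 * real (J\<^sup>2)))) \<le> (1 + (- (1 / (2 * real (J\<^sup>2))))) ^ (J\<^sup>2)"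
      using \<open>1 / (2 * real (J\<^sup>2)) < 1\<close> by (intro Bernoulli_inequality) linarith
    then show ?thesis using J2 by (simp add: t_def J_def)
  qed
  ultimately have "real J * (1 / 2) \<le> 2 * M" by (meson mult_left_mono of_nat_0_le_iff order_trans)
  then show False by (simp add: J_def)
qed

end

section \<open>Chebyshev and Mertens estimates for the von Mangoldt function\<close>

lemma ln_fact_conv_mangoldt:
  "ln (fact N) = (\<Sum>n\<in>{0<..N}. mangoldt n * real (N div n))"
proof -
  have "ln (fact N) = (\<Sum>k\<in>{0<..N}. ln (real k))"
  proof (induction N)
    case (Suc N)
    have "{0<..Suc N} = insert (Suc N) {0<..N}" by auto
    then show ?case using Suc by (simp add: ln_mult del: of_nat_Suc)
  qed simp
  also have "\<dots> = (\<Sum>k\<in>{0<..N}. \<Sum>d | d dvd k. mangoldt d)"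
    by (intro sum.cong) (auto simp: mangoldt_sum)
  also have "\<dots> = (\<Sum>n\<in>{0<..N}. \<Sum>m\<in>{0<..N div n}. mangoldt n)"
    by (rule sum_divisors_swap)
  finally show ?thesis by (simp add: mult.commute)
qed

lemma ln_fact_ge: "N * ln N - N \<le> ln (fact N)"
proof (induction N)
  case (Suc N)
  show ?case
  proof (cases "N = 0")
    case False
    have "ln (Suc N) = ln (N * (1 + 1 / N))" using False by (simp add: distrib_left add.commute)
    also have "\<dots> = ln N + ln (1 + 1 / N)" using False by (intro ln_mult_pos) (auto simp: add_pos_nonneg)
    also have "ln (1 + 1 / N) \<le> 1 / N" by (rule ln_add_one_self_le_self) simp
    finally have "N * ln (Suc N) \<le> N * ln N + 1" using False by (simp add: field_simps)
    moreover have "ln (fact (Suc N)) = ln (Suc N) + ln (fact N)"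
      by (simp add: ln_mult del: of_nat_Suc)
    ultimately show ?thesis using Suc by (simp add: algebra_simps)
  qed simp
qed simp

text \<open>Chebyshev's argument: in ln of the binomial coefficient (2m choose m), the value
  \<Lambda>(n) occurs with a nonnegative factor that is at least 1 for m < n <= 2m, and the
  coefficient is at most 4^m. Halving \<open>N\<close> then costs 3m, plus 2m for a possible odd
  last term, and 5m + 3m + 2m = 5 (2m) explains the constant.\<close>

lemma sum_mangoldt_le: "(\<Sum>n\<in>{0<..N}. mangoldt n) \<le> 5 * real N"
proof (induction N rule: less_induct)
  case (less N)
  show ?case
  proof (cases "N \<le> 1")
    case True
    then have "(\<Sum>n\<in>{0<..N}. mangoldt n) \<le> (\<Sum>n\<in>{1::nat}. mangoldt n :: real)"
      by (intro sum_mono2) auto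
    then show ?thesis by simp
  next
    case False
    define m where "m = N div 2"
    have m: "m < N" "2 * m \<le> N" "N \<le> Suc (2 * m)" "m > 0" using False by (auto simp: m_def)
    have "(\<Sum>n\<in>{m<..2*m}. mangoldt n) \<le> (\<Sum>n\<in>{0<..2*m}. mangoldt n * (real (2 * m div n) - 2 * real (m div n)))"
    proof -
      have "real (2 * m div n) - 2 * real (m div n) \<ge> (if n > m then 1 else 0)"
        if "n \<in> {0<..2*m}" for n
      proof (cases "n > m")
        case True
        then have "1 * n \<le> 2 * m" "0 < n" using that by auto
        then have "1 \<le> 2 * m div n" by (simp add: less_eq_div_iff_mult_less_eq)
        then show ?thesis using True by simp
      next
        case False
        have "2 * (m div n) * n \<le> 2 * m" by simp
        then have "2 * (m div n) \<le> 2 * m div n" using that by (simp add: less_eq_div_iff_mult_less_eq)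
        then have "real (2 * (m div n)) \<le> real (2 * m div n)" by (simp only: of_nat_le_iff)
        then show ?thesis using False by simp
      qed
      then have "(\<Sum>n\<in>{0<..2*m}. mangoldt n * (if n > m then 1 else 0)) \<le> (\<Sum>n\<in>{0<..2*m}. mangoldt n * (real (2 * m div n) - 2 * real (m div n)))"
        by (intro sum_mono mult_left_mono mangoldt_nonneg) auto
      moreover have "(\<Sum>n\<in>{m<..2*m}. mangoldt n) = (\<Sum>n\<in>{0<..2*m}. mangoldt n * (if n > m then 1 else (0::real)))"
        by (rule sum.mono_neutral_cong_left) auto
      ultimately show ?thesis by simp
    qed
    also have "\<dots> = ln (fact (2 * m)) - 2 * ln (fact m)"
    proof -
      have "(\<Sum>n\<in>{0<..m}. mangoldt n * real (m div n)) = (\<Sum>n\<in>{0<..2*m}. mangoldt n * real (m div n))"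
        by (rule sum.mono_neutral_left) auto
      then show ?thesis
        unfolding ln_fact_conv_mangoldt by (simp add: sum_subtractf sum_distrib_left algebra_simps)
    qed
    also have "\<dots> = ln (fact (2 * m) / (fact m * fact m))"
      by (simp add: ln_div ln_mult)
    also have "\<dots> = ln (real ((2 * m) choose m))"
      by (subst binomial_fact) auto
    also have "\<dots> \<le> ln (real (2 ^ (2 * m)))"
      by (subst ln_le_cancel_iff) (auto simp del: of_nat_power intro!: binomial_le_pow2)
    also have "\<dots> = m * ln 4"
      by (simp add: ln_realpow power_mult)
    also have "\<dots> \<le> real m * 3"
      using ln_le_minus_one[of 4] by (intro mult_left_mono) auto
    finally have 1: "(\<Sum>n\<in>{m<..2*m}. mangoldt n) \<le> 3 * real m" by simp
    have "{0<..2*m} = {0<..m} \<union> {m<..2*m}" by auto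
    then have 2: "(\<Sum>n\<in>{0<..2*m}. mangoldt n :: real) = (\<Sum>n\<in>{0<..m}. mangoldt n) + (\<Sum>n\<in>{m<..2*m}. mangoldt n)"
      by (simp add: sum.union_disjoint)
    have "(\<Sum>n\<in>{0<..N}. mangoldt n :: real) \<le> (\<Sum>n\<in>{0<..Suc (2*m)}. mangoldt n)"
      using m by (intro sum_mono2) (auto simp: mangoldt_nonneg)
    also have "{0<..Suc (2*m)} = insert (Suc (2*m)) {0<..2*m}" by auto
    also have "(\<Sum>n\<in>insert (Suc (2*m)) {0<..2*m}. mangoldt n :: real) = mangoldt (Suc (2*m)) + (\<Sum>n\<in>{0<..2*m}. mangoldt n)"
      by simp
    also have "mangoldt (Suc (2*m)) \<le> real (2 * m)"
    proof -
      have "mangoldt (Suc (2*m)) \<le> ln (real (Suc (2*m)))" by (rule mangoldt_le) simp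
      also have "\<dots> \<le> real (Suc (2*m)) - 1" by (rule ln_le_minus_one) simp
      finally show ?thesis by simp
    qed
    finally show ?thesis using 1 2 less.IH[OF m(1)] m(2) by linarith
  qed
qed

text \<open>Rounding N / n down only lowers the sum that represents ln N!, so its lower bound can be
  divided by \<open>N\<close>. The divergence of this sum is what produces primes.\<close>

lemma sum_mangoldt_over_ge: 
  assumes "N > 0"
  shows "ln N - 1 \<le> (\<Sum>n\<in>{0<..N}. mangoldt n / n)"
proof -
  have "N * (ln N - 1) \<le> (\<Sum>n\<in>{0<..N}. mangoldt n * real (N div n))"
    using ln_fact_ge[of N] by (simp add: ln_fact_conv_mangoldt algebra_simps)
  also have "\<dots> \<le> (\<Sum>n\<in>{0<..N}. mangoldt n * (N / n))"
    by (intro sum_mono mult_left_mono mangoldt_nonneg) (simp add: of_nat_div_le_of_nat)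
  also have "\<dots> = N * (\<Sum>n\<in>{0<..N}. mangoldt n / n)"
    by (simp add: sum_distrib_left mult.commute)
  finally show ?thesis using assms by simp
qed

text \<open>Prime powers sharing a factor with \<open>M\<close> escape the argument with symbols.
  They are powers of primes dividing \<open>M\<close>, and for each such \<open>p\<close> the terms
  ln p / p^j are dominated by ln p / 2^j, with sum at most ln p.\<close>

lemma sum_mangoldt_over_noncoprime_le:
  fixes M :: nat
  assumes "M > 0"
  shows "(\<Sum>n | n \<in> {0<..N} \<and> \<not> coprime n M. mangoldt n / n) \<le> (\<Sum>p\<in>prime_factors M. ln p)"
proof -
  let ?f = "\<lambda>(p, j). p ^ j :: nat" and ?I = "prime_factors M \<times> {0<..N}"
  have "(\<Sum>n | n \<in> {0<..N} \<and> \<not> coprime n M. mangoldt n / n)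
      = (\<Sum>n | n \<in> {0<..N} \<and> \<not> coprime n M \<and> primepow n. mangoldt n / n)"
    by (intro sum.mono_neutral_right) (auto simp: mangoldt_def)
  also have "\<dots> \<le> (\<Sum>n\<in>?f ` ?I. mangoldt n / n)"
  proof (intro sum_mono2 subsetI)
    fix n assume "n \<in> {n. n \<in> {0<..N} \<and> \<not> coprime n M \<and> primepow n}"
    then have n: "n \<le> N" "\<not> coprime n M" "primepow n" by auto
    then obtain p j where pj: "prime p" "j > 0" "n = p ^ j" by (auto simp: primepow_def)
    have "p dvd M" using n(2) pj by (metis coprime_power_left_iff prime_imp_coprime)
    \<comment> \<open>j < 2^j <= p^j = n <= N.\<close>
    moreover have "j \<le> N" using n(1) pj by (metis less_exp order.strict_trans2 less_imp_le prime_ge_2_nat power_mono order.trans zero_le_numeral)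
    ultimately show "n \<in> ?f ` ?I" using pj assms by (force simp: prime_factors_dvd)
  qed (auto simp: mangoldt_nonneg)
  also have "\<dots> \<le> (\<Sum>(p, j)\<in>?I. mangoldt (p ^ j) / real (p ^ j))"
    using sum_image_le[of ?I "\<lambda>n. mangoldt n / real n" ?f] by (simp add: mangoldt_nonneg case_prod_unfold o_def)
  also have "\<dots> = (\<Sum>p\<in>prime_factors M. \<Sum>j\<in>{0<..N}. mangoldt (p ^ j) / real (p ^ j))"
    by (rule sum.cartesian_product[symmetric])
  also have "\<dots> \<le> (\<Sum>p\<in>prime_factors M. ln p)"
  proof (intro sum_mono)
    fix p assume "p \<in> prime_factors M"
    then have p: "prime p" by auto
    have ln: "ln (real p) \<ge> 0" using prime_ge_1_nat[OF p] by simp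
    have "(\<Sum>j\<in>{0<..N}. mangoldt (p ^ j) / real (p ^ j)) \<le> (\<Sum>j\<in>{0<..N}. ln p * (1 / 2) ^ j)"
    proof (intro sum_mono)
      fix j assume "j \<in> {0<..N}"
      have "(2::real) ^ j \<le> real p ^ j" using prime_ge_2_nat[OF p] by (intro power_mono) auto
      then have "ln p / real p ^ j \<le> ln p / 2 ^ j" using ln prime_gt_0_nat[OF p] by (intro divide_left_mono mult_pos_pos zero_less_power) auto
      then show "mangoldt (p ^ j) / real (p ^ j) \<le> ln p * (1 / 2) ^ j"
        using \<open>j \<in> {0<..N}\<close> p by (simp add: power_one_over)
    qed
    also have "\<dots> = ln p * (\<Sum>j\<in>{0<..N}. (1 / 2) ^ j)" by (simp add: sum_distrib_left)
    also have "(\<Sum>j\<in>{0<..N}. (1 / 2) ^ j) = 1 - (1 / 2 :: real) ^ N"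
    proof (induction N)
      case (Suc N)
      have "{0<..Suc N} = insert (Suc N) {0<..N}" by auto
      then show ?case using Suc by simp
    qed simp
    also have "ln p * (1 - (1 / 2) ^ N) \<le> ln p * 1" using ln by (intro mult_left_mono) auto
    finally show "(\<Sum>j\<in>{0<..N}. mangoldt (p ^ j) / real (p ^ j)) \<le> ln p" by simp
  qed
  finally show ?thesis .
qed

context real_character
begin

text \<open>Abel summation applies where ln n / n decreases, which is from n = 3 on, beyond e. The
  terms with n at most 2 are bounded by hand.\<close>

lemma sum_ln_over_bounded: "\<bar>\<Sum>n\<in>{0<..N}. \<chi> n * (ln n / n)\<bar> \<le> 1 + 4 * M"
proof -
  have "{0<..N} = {0<..min 2 N} \<union> {2<..N}" by auto
  then have "(\<Sum>n\<in>{0<..N}. \<chi> n * (ln n / n)) = (\<Sum>n\<in>{0<..min 2 N}. \<chi> n * (ln n / n)) + (\<Sum>n\<in>{2<..N}. \<chi> n * (ln n / n))"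
    by (metis (no_types, lifting) sum.union_disjoint disjoint_iff finite_greaterThanAtMost
        greaterThanAtMost_iff linorder_not_le min.cobounded1 order_trans)
  moreover have "\<bar>\<Sum>n\<in>{0<..min 2 N}. \<chi> n * (ln n / n)\<bar> \<le> 1"
  proof -
    have "\<bar>\<Sum>n\<in>{0<..min 2 N}. \<chi> n * (ln n / n)\<bar> \<le> (\<Sum>n\<in>{0<..min 2 N}. \<bar>\<chi> n * (ln n / n)\<bar>)" by (rule sum_abs)
    also have "\<dots> \<le> (\<Sum>n\<in>{0<..2}. \<bar>\<chi> n * (ln n / n)\<bar>)" by (intro sum_mono2) auto
    also have "{0<..2} = {1, 2::nat}" by auto
    also have "(\<Sum>n\<in>{1, 2::nat}. \<bar>\<chi> n * (ln n / n)\<bar>) = \<bar>\<chi> 2\<bar> * (ln 2 / 2)" by (simp add: abs_mult)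
    also have "\<dots> \<le> 1 * (ln 2 / 2)" by (intro mult_right_mono abs_le_1) auto
    also have "\<dots> \<le> 1" using ln_le_minus_one[of 2] by simp
    finally show ?thesis .
  qed
  moreover have "\<bar>\<Sum>n\<in>{2<..N}. \<chi> n * (ln n / n)\<bar> \<le> 2 * M * (ln (Suc 2) / Suc 2)"
  proof (rule order_trans[OF abs_sum_mult_le])
    fix n :: nat assume n: "n > 2"
    have "ln (Suc n) = ln (n * (1 + 1 / n))" using n by (simp add: distrib_left add.commute)
    also have "\<dots> = ln n + ln (1 + 1 / n)" using n by (intro ln_mult_pos) (auto simp: add_pos_nonneg)
    also have "ln (1 + 1 / n) \<le> 1 / n" by (rule ln_add_one_self_le_self) simp
    finally have "n * ln (Suc n) \<le> n * ln n + 1" using n by (simp add: field_simps)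
    also have "1 \<le> ln n"
    proof -
      have "exp 1 \<le> real n" using exp_le n by linarith
      then show ?thesis using n by (simp add: ln_ge_iff)
    qed
    finally show "ln (Suc n) / Suc n \<le> ln n / n" using n by (simp add: field_simps)
  qed auto
  moreover have "2 * M * (ln (Suc 2) / Suc 2) \<le> real (2 * M) * 2"
    using ln_le_minus_one[of 3] by (intro mult_left_mono) auto
  ultimately show ?thesis by linarith
qed

text \<open>As \<open>ln = 1 * \<Lambda>\<close>, the sum of \<open>\<chi>(n) ln n / n\<close> is \<open>L(1, \<chi>)\<close> times the sum in question, up to an
  error that Chebyshev's bound controls.\<close>

lemma sum_mangoldt_over_bounded: "\<exists>C. \<forall>N. \<bar>\<Sum>n\<in>{0<..N}. \<chi> n * (mangoldt n / n)\<bar> \<le> C"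
proof (intro exI allI)
  fix N
  define T where "T = (\<Sum>n\<in>{0<..N}. \<chi> n * (mangoldt n / n))"
  define E where "E = (\<Sum>n\<in>{0<..N}. \<chi> n * (mangoldt n / n) * (L (N div n) - lim L))"
  have "(\<Sum>k\<in>{0<..N}. \<chi> k * (ln k / k)) = (\<Sum>k\<in>{0<..N}. \<Sum>d | d dvd k. \<chi> d * (mangoldt d / d) * (\<chi> (k div d) / real (k div d)))"
  proof (intro sum.cong refl)
    fix k assume "k \<in> {0<..N}"
    then have "\<chi> k * (ln k / k) = \<chi> k * ((\<Sum>d | d dvd k. mangoldt d) / k)" by (subst mangoldt_sum) auto
    also have "\<dots> = (\<Sum>d | d dvd k. \<chi> k * (mangoldt d / k))" by (simp add: sum_divide_distrib sum_distrib_left)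
    also have "\<dots> = (\<Sum>d | d dvd k. \<chi> d * (mangoldt d / d) * (\<chi> (k div d) / real (k div d)))"
      using \<open>k \<in> _\<close> by (intro sum.cong) (auto elim!: dvdE simp: mult)
    finally show "\<chi> k * (ln k / k) = (\<Sum>d | d dvd k. \<chi> d * (mangoldt d / d) * (\<chi> (k div d) / real (k div d)))" .
  qed
  also have "\<dots> = (\<Sum>n\<in>{0<..N}. \<Sum>m\<in>{0<..N div n}. \<chi> n * (mangoldt n / n) * (\<chi> m / m))"
    by (rule sum_divisors_swap)
  also have "\<dots> = (\<Sum>n\<in>{0<..N}. \<chi> n * (mangoldt n / n) * L (N div n))"
    by (simp add: L_def sum_distrib_left)
  also have "\<dots> = lim L * T + E"
    unfolding T_def E_def by (simp add: sum_distrib_left sum.distrib[symmetric] algebra_simps)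
  finally have main: "\<bar>lim L * T + E\<bar> \<le> 1 + 4 * M" using sum_ln_over_bounded[of N] by simp
  \<comment> \<open>The tail bound 2M / (N div n + 1) is at most 2M n / N. The factor n cancels the
    denominator of \<Lambda>(n) / n, and Chebyshev's constant 5 leaves 10M.\<close>
  have "\<bar>E\<bar> \<le> 10 * M"
  proof (cases "N = 0")
    case False
    have "\<bar>E\<bar> \<le> (\<Sum>n\<in>{0<..N}. \<bar>\<chi> n * (mangoldt n / n) * (L (N div n) - lim L)\<bar>)"
      unfolding E_def by (rule sum_abs)
    also have "\<dots> \<le> (\<Sum>n\<in>{0<..N}. 2 * M / N * mangoldt n)"
    proof (intro sum_mono)
      fix n assume "n \<in> {0<..N}"
      then have n: "n > 0" by simp
      have "N \<le> n * Suc (N div n)" using n by (metis dividend_less_times_div less_imp_le mult_Suc_right add.commute)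
      then have "real N \<le> real n * real (Suc (N div n))" by (metis of_nat_le_iff of_nat_mult)
      then have le: "1 / Suc (N div n) \<le> n / N" using False by (simp add: field_simps)
      have "\<bar>\<chi> n * (mangoldt n / n) * (L (N div n) - lim L)\<bar> = \<bar>\<chi> n\<bar> * (mangoldt n / n) * \<bar>L (N div n) - lim L\<bar>"
        by (simp add: abs_mult)
      also have "\<dots> \<le> 1 * (mangoldt n / n) * (2 * M * (1 / Suc (N div n)))"
        using abs_L_diff_lim_le[of "N div n"]
        by (intro mult_mono abs_le_1 mult_nonneg_nonneg divide_nonneg_nonneg mangoldt_nonneg) (auto simp: mangoldt_nonneg)
      also have "\<dots> \<le> 1 * (mangoldt n / n) * (2 * M * (n / N))"
        by (intro mult_left_mono le mult_nonneg_nonneg divide_nonneg_nonneg mangoldt_nonneg) (auto simp: mangoldt_nonneg)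
      also have "\<dots> = 2 * M / N * mangoldt n" using n by simp
      finally show "\<bar>\<chi> n * (mangoldt n / n) * (L (N div n) - lim L)\<bar> \<le> 2 * M / N * mangoldt n" .
    qed
    also have "\<dots> = 2 * M / N * (\<Sum>n\<in>{0<..N}. mangoldt n)" by (simp add: sum_distrib_left)
    also have "\<dots> \<le> 2 * M / N * (5 * real N)" by (intro mult_left_mono sum_mangoldt_le) auto
    also have "\<dots> = 10 * M" using False by simp
    finally show ?thesis .
  qed (simp add: E_def)
  then have "\<bar>lim L * T\<bar> \<le> 1 + 14 * M" using main by linarith
  then show "\<bar>T\<bar> \<le> (1 + 14 * M) / \<bar>lim L\<bar>"
    using lim_L_nonzero by (simp add: abs_mult pos_le_divide_eq mult.commute)
qed

end

section \<open>Legendre symbols and the characters modulo 4 and 8\<close>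

lemma Legendre_in: "Legendre a p \<in> {-1, 0, 1}"
  by (auto simp: Legendre_def)

lemma Legendre_cong: "[a = b] (mod p) \<Longrightarrow> Legendre a p = Legendre b p"
  by (simp add: Legendre_def QuadRes_def cong_def)

lemma Legendre_eq_0_iff: "Legendre a p = 0 \<longleftrightarrow> p dvd a"
  by (auto simp: Legendre_def cong_0_iff)

text \<open>Euler's criterion gives the equation modulo \<open>p\<close>; both sides lie in {-1, 0,
  1}, so they differ by at most 2 < p.\<close>

lemma Legendre_mult:
  fixes p :: nat
  assumes p: "prime p" "2 < p"
  shows "Legendre (a * b) p = Legendre a p * Legendre b p"
proof -
  let ?k = "(p - 1) div 2"
  have "[Legendre a p * Legendre b p = a ^ ?k * b ^ ?k] (mod p)"
    by (intro cong_mult euler_criterion p)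
  then have "[Legendre (a * b) p = Legendre a p * Legendre b p] (mod p)"
    using euler_criterion[OF p, of "a * b"] by (metis cong_sym cong_trans power_mult_distrib)
  then have "int p dvd Legendre (a * b) p - Legendre a p * Legendre b p" by (simp add: cong_iff_dvd_diff)
  moreover have "Legendre (a * b) p \<in> {-1, 0, 1}" "Legendre a p \<in> {-1, 0, 1}" "Legendre b p \<in> {-1, 0, 1}"
    using Legendre_in by blast+
  then have "\<bar>Legendre (a * b) p - Legendre a p * Legendre b p\<bar> \<le> 2" by auto
  ultimately show ?thesis
    using p(2) dvd_imp_le_int[of "Legendre (a * b) p - Legendre a p * Legendre b p" "int p"] by fastforce
qed

lemma Legendre_1: "p > 1 \<Longrightarrow> Legendre 1 p = 1"
  unfolding Legendre_def QuadRes_def cong_def by (auto intro: exI[of _ 1])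

text \<open>Otherwise squaring would be surjective on the residues modulo \<open>p\<close>, hence
  injective, although 1 and p - 1 have the same square.\<close>

lemma ex_Legendre_minus_1:
  fixes p :: nat
  assumes p: "prime p" "2 < p"
  shows "\<exists>a::nat. Legendre a p = -1"
proof (rule ccontr)
  assume no: "\<nexists>a::nat. Legendre a p = -1"
  define f where "f x = x\<^sup>2 mod p" for x
  have "{..<p} \<subseteq> f ` {..<p}"
  proof
    fix a assume "a \<in> {..<p}"
    then have a: "a < p" by simp
    have "Legendre a p \<noteq> -1" using no by simp
    then have "\<exists>y. [y\<^sup>2 = int a] (mod p)"
      unfolding Legendre_def QuadRes_def
      by (metis cong_sym zero_power2)
    then obtain y where y: "[y\<^sup>2 = int a] (mod p)" by blast
    define z where "z = nat (y mod p)"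
    have z: "int z = y mod p" "z < p" using p by (auto simp: z_def nat_less_iff)
    have "int (z\<^sup>2 mod p) = (y mod p)\<^sup>2 mod p" by (simp add: z zmod_int)
    also have "\<dots> = int (a mod p)" using y by (simp add: power_mod cong_def zmod_int)
    finally show "a \<in> f ` {..<p}" using z a by (auto simp: f_def)
  qed
  moreover have "f ` {..<p} \<subseteq> {..<p}" using p by (auto simp: f_def)
  ultimately have "f ` {..<p} = {..<p}" by (rule subset_antisym[rotated])
  then have "inj_on f {..<p}" by (intro eq_card_imp_inj_on) auto
  moreover have "f 1 = f (p - 1)"
  proof -
    have "int (f (p - 1)) = (int p - 1)\<^sup>2 mod p" using p by (simp add: f_def zmod_int of_nat_diff)
    also have "(int p - 1)\<^sup>2 = 1 + p * (int p - 2)" by (simp add: power2_eq_square algebra_simps)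
    also have "(1 + p * (int p - 2)) mod p = int (f 1)" using p by (simp add: f_def zmod_int)
    finally show ?thesis by simp
  qed
  ultimately have "1 = p - 1" by (rule inj_onD) (use p in auto)
  then show False using p by simp
qed

text \<open>At the indices 4 and 8, which are not odd primes, these are the nontrivial characters
  \<open>n \<mapsto> (-1 / n)\<close> and \<open>n \<mapsto> (2 / n)\<close> modulo 4 and 8.\<close>

definition residue_symbol :: "nat \<Rightarrow> nat \<Rightarrow> int" where
  "residue_symbol t n =
     (if t = 4 then if n mod 4 = 1 then 1 else if n mod 4 = 3 then -1 else 0
      else if t = 8 then if n mod 8 \<in> {1, 7} then 1 else if n mod 8 \<in> {3, 5} then -1 else 0
      else Legendre n t)"

definition symbol_index :: "nat \<Rightarrow> bool" where
  "symbol_index t \<longleftrightarrow> t = 4 \<or> t = 8 \<or> prime t \<and> 2 < t"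

lemma residue_symbol_in: "residue_symbol t n \<in> {-1, 0, 1}"
  using Legendre_in[of n t] by (auto simp: residue_symbol_def)

lemma residue_symbol_1: "symbol_index t \<Longrightarrow> residue_symbol t 1 = 1"
  using Legendre_1[of t] by (auto simp: residue_symbol_def symbol_index_def)

lemma residue_symbol_cong:
  assumes "[a = b] (mod t)"
  shows "residue_symbol t a = residue_symbol t b"
proof -
  have "[int a = int b] (mod t)" using assms by (simp add: cong_int_iff)
  then have "Legendre a t = Legendre b t" by (rule Legendre_cong)
  moreover have "a mod t = b mod t" using assms by (simp add: cong_def)
  ultimately show ?thesis unfolding residue_symbol_def by (cases "t = 4"; cases "t = 8") simp_all
qed

lemma residue_symbol_mult:
  assumes "symbol_index t"
  shows "residue_symbol t (a * b) = residue_symbol t a * residue_symbol t b"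
proof -
  have m4: "(a * b) mod 4 = ((a mod 4) * (b mod 4)) mod 4" by (simp add: mod_mult_eq)
  have m8: "(a * b) mod 8 = ((a mod 8) * (b mod 8)) mod 8" by (simp add: mod_mult_eq)
  have "a mod 4 < 4" "b mod 4 < 4" by simp_all
  then have c4: "a mod 4 \<in> {0, 1, 2, 3}" "b mod 4 \<in> {0, 1, 2, 3}" by auto
  have "a mod 8 < 8" "b mod 8 < 8" by simp_all
  then have c8: "a mod 8 \<in> {0, 1, 2, 3, 4, 5, 6, 7}" "b mod 8 \<in> {0, 1, 2, 3, 4, 5, 6, 7}" by auto
  consider "t = 4" | "t = 8" | "t \<noteq> 4" "t \<noteq> 8" "prime t" "2 < t" using assms by (auto simp: symbol_index_def)
  then show ?thesis
  proof cases
    case 1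
    then show ?thesis unfolding residue_symbol_def m4
      using c4 by (elim insertE emptyE) simp_all
  next
    case 2
    then show ?thesis unfolding residue_symbol_def m8
      using c8 by (elim insertE emptyE) simp_all
  next
    case 3
    then show ?thesis by (simp add: residue_symbol_def Legendre_mult)
  qed
qed

lemma residue_symbol_power: "symbol_index t \<Longrightarrow> residue_symbol t (a ^ n) = residue_symbol t a ^ n"
  using residue_symbol_1 by (induction n) (auto simp: residue_symbol_mult)

lemma odd_imp_coprime_8: "odd u \<Longrightarrow> coprime u (8::nat)"
  using coprime_power_right_iff[of u 2 3] by (simp add: coprime_right_2_iff_odd)

lemma residue_symbol_nonzero:
  assumes "symbol_index t" "coprime n t"
  shows "residue_symbol t n \<noteq> 0"
proof -
  consider "t = 4" | "t = 8" | "t \<noteq> 4" "t \<noteq> 8" "prime t" using assms by (auto simp: symbol_index_def)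
  then show ?thesis
  proof cases
    case 1
    then have "odd n" using assms(2) by auto
    then have "n mod 4 = 1 \<or> n mod 4 = 3" by presburger
    then show ?thesis using 1 by (auto simp: residue_symbol_def)
  next
    case 2
    then have "odd n" using assms(2) by auto
    then have "n mod 8 = 1 \<or> n mod 8 = 3 \<or> n mod 8 = 5 \<or> n mod 8 = 7" by presburger
    then show ?thesis using 2 by (auto simp: residue_symbol_def)
  next
    case 3
    then have "\<not> t dvd n" using assms(2) by (metis coprime_common_divisor dvd_refl not_prime_unit)
    then show ?thesis using 3 by (simp add: residue_symbol_def Legendre_eq_0_iff)
  qed
qed

section \<open>Primes with prescribed symbols\<close>

text \<open>The indices 4 and 8 share the single factor 8 of \<open>M\<close>. The factors 8 and the
  odd primes are pairwise coprime, as Chinese remaindering requires, and \<open>M\<close> is a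
  common period of all the symbols.\<close>

locale symbol_set =
  fixes T :: "nat set" and M :: nat
  assumes finite_T: "finite T" and index: "\<And>t. t \<in> T \<Longrightarrow> symbol_index t"
  defines "M \<equiv> 8 * \<Prod>(T - {4, 8})"
begin

lemma finite_odd: "finite (T - {4, 8})" using finite_T by simp

lemma odd_prime: "t \<in> T - {4, 8} \<Longrightarrow> prime t \<and> 2 < t"
  using index[of t] by (auto simp: symbol_index_def)

lemma M_pos: "M > 0"
  using finite_odd odd_prime by (auto simp: M_def intro!: prod_pos)

lemma dvd_M: "t \<in> T \<Longrightarrow> t dvd M"
  using dvd_prodI[of "T - {4, 8}" t "\<lambda>x. x"] finite_odd
  by (cases "t = 4 \<or> t = 8") (auto simp: M_def intro: dvd_mult2)

text \<open>Chinese remaindering makes one chosen symbol -1 and the others in \<open>S\<close> equal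
  to 1. So the product over any nonempty set of symbols is a nontrivial character.\<close>

lemma ex_symbol_product_minus_1:
  assumes S: "S \<subseteq> T" "S \<noteq> {}"
  shows "\<exists>b. coprime b M \<and> (\<Prod>t\<in>S. residue_symbol t b) = -1"
proof -
  have fin: "finite S" using S finite_T finite_subset by blast
  have *: "\<exists>b. coprime b M \<and> (\<Prod>t\<in>S. residue_symbol t b) = -1"
    if m: "M = m1 * m2" "coprime m1 m2" and u: "coprime u m1" and q: "q \<in> S" "residue_symbol q u = -1" 
      and m1: "\<And>t. t \<in> S \<Longrightarrow> t \<noteq> q \<Longrightarrow> t dvd m2 \<or> t dvd m1 \<and> residue_symbol t u = 1" "q dvd m1" for m1 m2 u q
  proof -
    obtain b where b: "[b = u] (mod m1)" "[b = 1] (mod m2)"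
      using binary_chinese_remainder_nat[OF m(2)] by blast
    have "coprime b M" using b u unfolding m(1)
      by (metis cong_imp_coprime cong_sym coprime_1_left coprime_mult_right_iff)
    moreover have "residue_symbol t b = (if t = q then -1 else 1)" if t: "t \<in> S" for t
    proof (cases "t = q")
      case True
      then show ?thesis using residue_symbol_cong[of b u q] b(1) m1(2) q cong_dvd_modulus_nat by auto
    next
      case False
      then consider "t dvd m2" | "t dvd m1" "residue_symbol t u = 1" using m1(1) t by blast
      then show ?thesis
      proof cases
        case 1
        then have "residue_symbol t b = residue_symbol t 1"
          using b(2) by (intro residue_symbol_cong) (rule cong_dvd_modulus_nat)
        then show ?thesis using False residue_symbol_1 index S(1) t by auto
      next
        case 2
        then have "residue_symbol t b = residue_symbol t u"
          using b(1) by (intro residue_symbol_cong) (rule cong_dvd_modulus_nat)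
        then show ?thesis using False 2 by auto
      qed
    qed
    then have "(\<Prod>t\<in>S. residue_symbol t b) = (\<Prod>t\<in>S. if t = q then -1 else 1)" by (intro prod.cong) auto
    then have "(\<Prod>t\<in>S. residue_symbol t b) = -1" using q(1) fin by (simp add: prod.delta)
    ultimately show ?thesis by blast
  qed
  have cop8: "coprime 8 (\<Prod>A)" if "A \<subseteq> T - {4, 8}" for A
  proof (rule prod_coprime_right)
    fix t assume "t \<in> A"
    then have "odd t" using odd_prime[of t] that prime_odd_nat by blast
    then show "coprime 8 t" using coprime_power_left_iff[of 2 3 t] by simp
  qed
  have dvd_prod: "t dvd \<Prod>A" if "t \<in> A" "A \<subseteq> T" for t A
    using that finite_T finite_subset dvd_prodI[of A t "\<lambda>x. x"] by auto
  show ?thesis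
  proof (cases "S \<subseteq> {4, 8}")
    case True
    show ?thesis
    proof (cases "8 \<in> S")
      case True': True
      \<comment> \<open>The number 5 has symbol -1 at 8 but 1 at 4, so the index 4, whether or not
        it lies in \<open>S\<close>, does not interfere.\<close>
      show ?thesis
      proof (rule *[of 8 "\<Prod>(T - {4, 8})" 5 8])
        show "t dvd \<Prod>(T - {4, 8}) \<or> t dvd 8 \<and> residue_symbol t 5 = 1" if "t \<in> S" "t \<noteq> 8" for t
          using that True by (auto simp: residue_symbol_def)
        show "coprime (5::nat) 8" by (intro odd_imp_coprime_8) simp
      qed (use True' cop8 in \<open>auto simp: M_def residue_symbol_def\<close>)
    next
      case False
      then have "S = {4}" using True S(2) by auto
      then show ?thesis
        using cop8[of "T - {4, 8}"]
        by (intro *[of 8 "\<Prod>(T - {4, 8})" 3 4]) (auto simp: M_def residue_symbol_def intro!: odd_imp_coprime_8)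
    qed
  next
    case False
    then obtain q where q: "q \<in> S" "q \<noteq> 4" "q \<noteq> 8" by auto
    then have q': "prime q" "2 < q" "q \<in> T - {4, 8}" using odd_prime[of q] S by auto
    obtain u where u: "Legendre (int u) q = -1" using ex_Legendre_minus_1[OF q'(1,2)] by blast
    then have "\<not> q dvd u" using Legendre_eq_0_iff[of u q] by auto
    show ?thesis
    proof (rule *[of q "8 * \<Prod>(T - {4, 8} - {q})" u q])
      show "M = q * (8 * \<Prod>(T - {4, 8} - {q}))"
        using finite_odd q'(3) by (simp add: M_def prod.remove[of _ q])
      have "coprime q t" if "t \<in> T - {4, 8} - {q}" for t
        using odd_prime[of t] that q'(1) by (auto intro: primes_coprime)
      then have "coprime q (\<Prod>(T - {4, 8} - {q}))" by (intro prod_coprime_right) auto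
      moreover have "coprime 8 q" using cop8[of "{q}"] q'(3) by simp
      ultimately show "coprime q (8 * \<Prod>(T - {4, 8} - {q}))" by (simp add: coprime_commute)
      show "coprime u q" using \<open>\<not> q dvd u\<close> q'(1) by (simp add: coprime_commute prime_imp_coprime)
      show "residue_symbol q u = -1" using u q by (simp add: residue_symbol_def)
      show "t dvd 8 * \<Prod>(T - {4, 8} - {q}) \<or> t dvd q \<and> residue_symbol t u = 1" if "t \<in> S" "t \<noteq> q" for t
      proof (cases "t = 4 \<or> t = 8")
        case True
        then show ?thesis by (auto intro: dvd_mult2)
      next
        case False
        then show ?thesis using dvd_prod[of t "T - {4, 8} - {q}"] that S(1) by (auto intro: dvd_mult)
      qed
    qed (use q in auto)
  qed
qed

text \<open>Multiplication by some \<open>b\<close> with product -1 permutes the residues modulo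
  \<open>M\<close> and changes the sign of every value, so the sum over a period is its own
  negative.\<close>

lemma real_character_symbol_product:
  assumes S: "S \<subseteq> T" "S \<noteq> {}"
  shows "real_character (\<lambda>n. \<Prod>t\<in>S. real_of_int (residue_symbol t n)) M"
proof -
  define F where "F n = (\<Prod>t\<in>S. real_of_int (residue_symbol t n))" for n
  have idx: "symbol_index t" if "t \<in> S" for t using that S index by blast
  have F_mult: "F (a * b) = F a * F b" for a b
    unfolding F_def using idx by (simp add: residue_symbol_mult prod.distrib)
  have F_cong: "F a = F b" if "[a = b] (mod M)" for a b
    unfolding F_def
  proof (intro prod.cong refl)
    fix t assume "t \<in> S"
    then have "[a = b] (mod t)" using dvd_M[of t] S(1) that cong_dvd_modulus_nat by blast
    then show "real_of_int (residue_symbol t a) = real_of_int (residue_symbol t b)"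
      using residue_symbol_cong by simp
  qed
  obtain b where b: "coprime b M" "(\<Prod>t\<in>S. residue_symbol t b) = -1"
    using ex_symbol_product_minus_1[OF S] by blast
  have Fb: "F b = -1"
    using arg_cong[OF b(2), of real_of_int] by (simp add: F_def)
  have inj: "inj_on (\<lambda>a. b * a mod M) {..<M}"
  proof (rule inj_onI)
    fix x y assume "x \<in> {..<M}" "y \<in> {..<M}" "b * x mod M = b * y mod M"
    then show "x = y" using b(1) cong_mult_lcancel_nat[of b M x y] by (auto simp: cong_def)
  qed
  then have "bij_betw (\<lambda>a. b * a mod M) {..<M} {..<M}"
    using M_pos by (intro bij_betw_imageI endo_inj_surj) auto
  then have "(\<Sum>a<M. F a) = (\<Sum>a<M. F (b * a mod M))"
    by (rule sum.reindex_bij_betw[symmetric])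
  also have "\<dots> = (\<Sum>a<M. F (b * a))" by (intro sum.cong F_cong) auto
  also have "\<dots> = - (\<Sum>a<M. F a)" by (simp add: F_mult Fb sum_negf)
  finally have "(\<Sum>a<M. F a) = 0" by simp
  moreover have "F a \<in> {-1, 0, 1}" for a
  proof -
    have "finite S" using S finite_T finite_subset by blast
    then show ?thesis unfolding F_def
    proof (induction S rule: finite_induct)
      case (insert t S)
      then show ?case using residue_symbol_in[of t a] by auto
    qed simp
  qed
  moreover have "F 1 = 1" unfolding F_def using idx residue_symbol_1 by (auto intro!: prod.neutral)
  moreover have "F (a + M) = F a" for a by (rule F_cong) (simp add: cong_def)
  ultimately show ?thesis
    using F_mult M_pos unfolding F_def[symmetric] by (intro real_character.intro)
qed

text \<open>
  The weight \<open>w\<close> below detects the prescribed symbols. Expanded into characters, only the trivial one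
  contributes an unbounded sum. Prime powers with even exponent have all symbols 1, so they are excluded by
  the assumption that some prescribed value is -1.
\<close>

theorem ex_prime_with_residue_symbols:
  fixes \<epsilon> :: "nat \<Rightarrow> int"
  assumes \<epsilon>: "\<And>t. t \<in> T \<Longrightarrow> \<epsilon> t \<in> {-1, 1}" and neg: "\<exists>t\<in>T. \<epsilon> t = -1"
  shows "\<exists>l. prime l \<and> coprime l M \<and> (\<forall>t\<in>T. residue_symbol t l = \<epsilon> t)"
proof (rule ccontr)
  assume no: "\<not> ?thesis"
  \<comment> \<open>A factor is 2 if the symbol is as prescribed and 0 if it is the opposite, so one
    wrong nonzero symbol makes \<open>w\<close> vanish.\<close>
  define w where "w n = (\<Prod>t\<in>T. 1 + real_of_int (\<epsilon> t) * real_of_int (residue_symbol t n))" for n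
  define F where "F S n = (\<Prod>t\<in>S. real_of_int (residue_symbol t n))" for S n
  have "\<exists>C. \<forall>N. \<bar>\<Sum>n\<in>{0<..N}. F S n * (mangoldt n / n)\<bar> \<le> C" if "S \<subseteq> T" "S \<noteq> {}" for S
  proof -
    interpret real_character "F S" M
      using real_character_symbol_product[OF that] unfolding F_def .
    show ?thesis by (rule sum_mangoldt_over_bounded)
  qed
  then obtain C where C: "\<And>S N. S \<subseteq> T \<Longrightarrow> S \<noteq> {} \<Longrightarrow> \<bar>\<Sum>n\<in>{0<..N}. F S n * (mangoldt n / n)\<bar> \<le> C S"
    by metis
  have w_eq: "w n = (\<Sum>S\<in>Pow T. (\<Prod>t\<in>S. real_of_int (\<epsilon> t)) * F S n)" for n
  proof -
    have "w n = (\<Prod>t\<in>T. real_of_int (\<epsilon> t) * real_of_int (residue_symbol t n) + 1)"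
      unfolding w_def by (simp add: add.commute)
    then show ?thesis by (simp add: prod_add[OF finite_T] F_def prod.distrib)
  qed
  have w_nonneg: "0 \<le> w n" and w_le: "w n \<le> 2 ^ card T" for n
  proof -
    have *: "0 \<le> 1 + real_of_int (\<epsilon> t) * real_of_int (residue_symbol t n)
        \<and> 1 + real_of_int (\<epsilon> t) * real_of_int (residue_symbol t n) \<le> 2" if "t \<in> T" for t
      using \<epsilon>[OF that] residue_symbol_in[of t n] by auto
    then show "0 \<le> w n" unfolding w_def by (intro prod_nonneg) auto
    have "w n \<le> (\<Prod>t\<in>T. 2)" unfolding w_def using * by (intro prod_mono) auto
    then show "w n \<le> 2 ^ card T" by simp
  qed
  \<comment> \<open>By \<open>no\<close> each prime coprime to \<open>M\<close> has a wrong symbol,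
    and its odd powers have the same symbols as the prime itself. What survives in the sum are prime
    powers that share a factor with \<open>M\<close>, a bounded contribution.\<close>
  have w_0: "w n = 0" if n: "coprime n M" "primepow n" for n
  proof -
    obtain p j where pj: "prime p" "j > 0" "n = p ^ j" using n(2) by (auto simp: primepow_def)
    then have "coprime p M" using n(1) by simp
    have sq: "residue_symbol t p \<in> {-1, 1}" if "t \<in> T" for t
    proof -
      have "coprime p t" using coprime_divisors[OF dvd_refl dvd_M[OF that] \<open>coprime p M\<close>] .
      then show ?thesis using residue_symbol_in[of t p] residue_symbol_nonzero[of t p] index that by auto
    qed
    have "\<exists>t\<in>T. residue_symbol t n = - \<epsilon> t"
    proof (cases "even j")
      case True
      obtain t where t: "t \<in> T" "\<epsilon> t = -1" using neg by blast
      have "residue_symbol t n = 1"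
        using sq[OF t(1)] True by (auto simp: pj residue_symbol_power index t(1))
      then show ?thesis using t by (intro bexI[of _ t]) auto
    next
      case False
      obtain t where t: "t \<in> T" "residue_symbol t p \<noteq> \<epsilon> t" using no pj(1) \<open>coprime p M\<close> by blast
      have "residue_symbol t n = residue_symbol t p"
        using sq[OF t(1)] False by (auto simp: pj residue_symbol_power index t(1))
      then show ?thesis using t sq[OF t(1)] \<epsilon>[OF t(1)] by (intro bexI[of _ t]) auto
    qed
    then obtain t where t: "t \<in> T" "residue_symbol t n = - \<epsilon> t" by blast
    then have "1 + real_of_int (\<epsilon> t) * real_of_int (residue_symbol t n) = 0"
      using \<epsilon>[OF t(1)] by auto
    then show ?thesis unfolding w_def using t(1) finite_T by (auto intro!: prod_zero)
  qed
  define A where "A = 2 ^ card T * (\<Sum>p\<in>prime_factors M. ln (real p))"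
  define B where "B = (\<Sum>S\<in>Pow T - {{}}. C S)"
  have upper: "(\<Sum>n\<in>{0<..N}. w n * (mangoldt n / n)) \<le> A" for N
  proof -
    have "(\<Sum>n\<in>{0<..N}. w n * (mangoldt n / n)) = (\<Sum>n | n \<in> {0<..N} \<and> \<not> coprime n M. w n * (mangoldt n / n))"
      by (intro sum.mono_neutral_right) (auto simp: mangoldt_def w_0)
    also have "\<dots> \<le> (\<Sum>n | n \<in> {0<..N} \<and> \<not> coprime n M. 2 ^ card T * (mangoldt n / n))"
      by (intro sum_mono mult_right_mono w_le divide_nonneg_nonneg mangoldt_nonneg) auto
    also have "\<dots> = 2 ^ card T * (\<Sum>n | n \<in> {0<..N} \<and> \<not> coprime n M. mangoldt n / n)"
      by (simp add: sum_distrib_left)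
    also have "\<dots> \<le> A" unfolding A_def
      by (intro mult_left_mono sum_mangoldt_over_noncoprime_le M_pos) auto
    finally show ?thesis .
  qed
  have lower: "ln N - 1 - B \<le> (\<Sum>n\<in>{0<..N}. w n * (mangoldt n / n))" if "N > 0" for N
  proof -
    define s where "s S = (\<Prod>t\<in>S. real_of_int (\<epsilon> t))" for S
    have s: "\<bar>s S\<bar> = 1" if "S \<subseteq> T" for S
    proof -
      have "\<bar>real_of_int (\<epsilon> t)\<bar> = 1" if "t \<in> S" for t
        using \<epsilon>[of t] that \<open>S \<subseteq> T\<close> by fastforce
      then show ?thesis by (simp add: s_def abs_prod)
    qed
    have "(\<Sum>n\<in>{0<..N}. w n * (mangoldt n / n)) = (\<Sum>n\<in>{0<..N}. \<Sum>S\<in>Pow T. s S * (F S n * (mangoldt n / n)))"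
      by (simp add: w_eq s_def sum_distrib_right sum_divide_distrib mult.assoc)
    also have "\<dots> = (\<Sum>S\<in>Pow T. s S * (\<Sum>n\<in>{0<..N}. F S n * (mangoldt n / n)))"
      by (subst sum.swap) (simp add: sum_distrib_left)
    also have "\<dots> = s {} * (\<Sum>n\<in>{0<..N}. F {} n * (mangoldt n / n))
        + (\<Sum>S\<in>Pow T - {{}}. s S * (\<Sum>n\<in>{0<..N}. F S n * (mangoldt n / n)))"
      using finite_T by (intro sum.remove) auto
    also have "s {} * (\<Sum>n\<in>{0<..N}. F {} n * (mangoldt n / n)) = (\<Sum>n\<in>{0<..N}. mangoldt n / n)"
      by (simp add: s_def F_def)
    finally have eq: "(\<Sum>n\<in>{0<..N}. w n * (mangoldt n / n)) = (\<Sum>n\<in>{0<..N}. mangoldt n / n)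
        + (\<Sum>S\<in>Pow T - {{}}. s S * (\<Sum>n\<in>{0<..N}. F S n * (mangoldt n / n)))" .
    have "\<bar>\<Sum>S\<in>Pow T - {{}}. s S * (\<Sum>n\<in>{0<..N}. F S n * (mangoldt n / n))\<bar> \<le> B"
      unfolding B_def
    proof (rule order_trans[OF sum_abs], intro sum_mono)
      fix S assume "S \<in> Pow T - {{}}"
      then show "\<bar>s S * (\<Sum>n\<in>{0<..N}. F S n * (mangoldt n / n))\<bar> \<le> C S"
        using C[of S N] s[of S] by (simp add: abs_mult)
    qed
    then show ?thesis using eq sum_mangoldt_over_ge[OF that] by linarith
  qed
  obtain N :: nat where N: "exp (A + B + 2) < N" using reals_Archimedean2 by blast
  then have "real N > 0" by (meson exp_gt_zero order_less_trans)
  then have "A + B + 2 < ln N" using N by (metis ln_exp ln_less_cancel_iff exp_gt_zero)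
  then show False using lower[of N] upper[of N] \<open>real N > 0\<close> by simp
qed

end

section \<open>Legendre's equation\<close>

text \<open>\<open>r\<close> is the square root of \<open>m\<close> rounded up: for positive
  \<open>m\<close> the side 0, ..., r - 1 has at least sqrt m points, yet all its squares stay
  strictly below \<open>m\<close>.\<close>

lemma squares_below:
  fixes m :: int
  shows "\<exists>r\<ge>0. m \<le> r\<^sup>2 \<and> (\<forall>x. 0 \<le> x \<longrightarrow> x < r \<longrightarrow> x\<^sup>2 < m)"
proof -
  define r where "r = (LEAST r::nat. m \<le> (int r)\<^sup>2)"
  have "m \<le> (int (nat \<bar>m\<bar>))\<^sup>2"
  proof -
    have "m \<le> \<bar>m\<bar>" by simp
    also have "\<dots> \<le> \<bar>m\<bar> * \<bar>m\<bar>" using mult_left_mono[of 1 "\<bar>m\<bar>" "\<bar>m\<bar>"] by (cases "m = 0") auto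
    finally show ?thesis by (simp add: power2_eq_square)
  qed
  then have 1: "m \<le> (int r)\<^sup>2" unfolding r_def by (rule LeastI)
  have 2: "x\<^sup>2 < m" if "0 \<le> x" "x < int r" for x
  proof -
    have "nat x < r" using that by simp
    then have "\<not> m \<le> (int (nat x))\<^sup>2" unfolding r_def by (rule not_less_Least)
    then show ?thesis using that by simp
  qed
  show ?thesis using 1 2 by (intro exI[of _ "int r"]) simp
qed

text \<open>
  The box below has more points than the three linear congruences have classes, so two of its points
  are congruent. Their difference makes \<open>a x\<^sup>2 + b y\<^sup>2 - c z\<^sup>2\<close> a multiple of \<open>a b c\<close> lying strictly
  between \<open>-a b c\<close> and \<open>2 a b c\<close>; the value \<open>a b c\<close> is turned into a zero by the last identity.
\<close>

theorem legendre_equation: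
  fixes a b c :: int
  assumes pos: "a > 0" "b > 0" "c > 0"
    and cop: "coprime a b" "coprime a c" "coprime b c"
    and A: "a dvd b * \<beta>\<^sup>2 - c" and B: "b dvd a * \<alpha>\<^sup>2 - c" and C: "c dvd a * \<gamma>\<^sup>2 + b"
    and nonsq: "\<And>s. s\<^sup>2 \<noteq> b * c"
  shows "\<exists>x y z. (x \<noteq> 0 \<or> y \<noteq> 0 \<or> z \<noteq> 0) \<and> a * x\<^sup>2 + b * y\<^sup>2 = c * z\<^sup>2"
proof -
  obtain r where r: "0 \<le> r" "b * c \<le> r\<^sup>2" "\<And>x. 0 \<le> x \<Longrightarrow> x < r \<Longrightarrow> x\<^sup>2 < b * c" using squares_below[of "b * c"] by blast
  obtain s where s: "0 \<le> s" "a * c \<le> s\<^sup>2" "\<And>x. 0 \<le> x \<Longrightarrow> x < s \<Longrightarrow> x\<^sup>2 < a * c" using squares_below[of "a * c"] by blast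
  obtain t where t: "0 \<le> t" "a * b \<le> t\<^sup>2" "\<And>x. 0 \<le> x \<Longrightarrow> x < t \<Longrightarrow> x\<^sup>2 < a * b" using squares_below[of "a * b"] by blast
  \<comment> \<open>The three bounds multiply to (abc)^2; the strict inequality that the pigeonhole
    argument wants comes from \<open>nonsq\<close>.\<close>
  have big: "a * b * c < r * s * t"
  proof -
    have "b * c < r\<^sup>2" using r(2) nonsq[of r] by linarith
    moreover have "a * c * (a * b) \<le> s\<^sup>2 * t\<^sup>2" using s t pos by (intro mult_mono) auto
    moreover have "0 < a * c * (a * b)" using pos by simp
    ultimately have "b * c * (a * c * (a * b)) < r\<^sup>2 * (s\<^sup>2 * t\<^sup>2)"
      using pos by (intro mult_less_le_imp_less) simp_all
    also have "b * c * (a * c * (a * b)) = (a * b * c)\<^sup>2" by (simp add: power2_eq_square mult_ac)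
    also have "r\<^sup>2 * (s\<^sup>2 * t\<^sup>2) = (r * s * t)\<^sup>2" by (simp add: power_mult_distrib mult.assoc)
    finally have "(a * b * c)\<^sup>2 < (r * s * t)\<^sup>2" .
    moreover have "0 \<le> r * s * t" using r(1) s(1) t(1) by simp
    ultimately show ?thesis by (rule power_less_imp_less_base)
  qed
  define D where "D = {0..<r} \<times> {0..<s} \<times> {0..<t}"
  define R where "R = {0..<a} \<times> {0..<b} \<times> {0..<c}"
  \<comment> \<open>Each congruence makes the form vanish for its modulus: y = \<beta> z (mod a)
    gives b y^2 = b \<beta>^2 z^2 = c z^2 (mod a), and similarly modulo \<open>b\<close> and
    \<open>c\<close>.\<close>
  define f where "f = (\<lambda>(x, y, z). ((y - \<beta> * z) mod a, (x - \<alpha> * z) mod b, (x - \<gamma> * y) mod c))"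
  have "int (card R) < int (card D)"
    using big r s t pos unfolding R_def D_def by (simp add: card_cartesian_product mult.assoc)
  moreover have "f ` D \<subseteq> R" using pos by (auto simp: f_def D_def R_def)
  moreover have "finite R" by (simp add: R_def)
  ultimately have "\<not> inj_on f D" using card_inj_on_le[of f D R] by auto
  then obtain u v where uv: "u \<in> D" "v \<in> D" "u \<noteq> v" "f u = f v"
    unfolding inj_on_def by blast
  obtain x1 y1 z1 x2 y2 z2 where "u = (x1, y1, z1)" "v = (x2, y2, z2)"
    by (metis prod_cases3)
  then have D: "(x1, y1, z1) \<in> D" "(x2, y2, z2) \<in> D" "(x1, y1, z1) \<noteq> (x2, y2, z2)" "f (x1, y1, z1) = f (x2, y2, z2)"
    using uv by simp_all
  define x y z where "x = x1 - x2" and "y = y1 - y2" and "z = z1 - z2"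
  have nz: "x \<noteq> 0 \<or> y \<noteq> 0 \<or> z \<noteq> 0" using D(3) by (auto simp: x_def y_def z_def)
  have "\<bar>x\<bar> < r" "\<bar>y\<bar> < s" "\<bar>z\<bar> < t" using D(1,2) by (auto simp: D_def x_def y_def z_def)
  then have sq: "x\<^sup>2 < b * c" "y\<^sup>2 < a * c" "z\<^sup>2 < a * b"
    using r(3)[of "\<bar>x\<bar>"] s(3)[of "\<bar>y\<bar>"] t(3)[of "\<bar>z\<bar>"] by auto
  have lin: "a dvd y - \<beta> * z" "b dvd x - \<alpha> * z" "c dvd x - \<gamma> * y"
    using D(4) by (auto simp: f_def mod_eq_dvd_iff x_def y_def z_def algebra_simps)
  define V where "V = a * x\<^sup>2 + b * y\<^sup>2 - c * z\<^sup>2"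
  have "V = a * x\<^sup>2 + b * ((y - \<beta> * z) * (y + \<beta> * z)) + (b * \<beta>\<^sup>2 - c) * z\<^sup>2"
    by (simp add: V_def power2_eq_square algebra_simps)
  then have Va: "a dvd V" using lin(1) A by simp
  have "V = b * y\<^sup>2 + a * ((x - \<alpha> * z) * (x + \<alpha> * z)) + (a * \<alpha>\<^sup>2 - c) * z\<^sup>2"
    by (simp add: V_def power2_eq_square algebra_simps)
  then have Vb: "b dvd V" using lin(2) B by simp
  have "V = a * ((x - \<gamma> * y) * (x + \<gamma> * y)) + (a * \<gamma>\<^sup>2 + b) * y\<^sup>2 - c * z\<^sup>2"
    by (simp add: V_def power2_eq_square algebra_simps)
  then have Vc: "c dvd V" using lin(3) C by simp
  have "a * b * c dvd V"
    using Va Vb Vc cop by (intro divides_mult) auto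
  then obtain k where k: "V = a * b * c * k" by (elim dvdE)
  have abc: "a * b * c > 0" using pos by simp
  have "a * x\<^sup>2 < a * (b * c)" "b * y\<^sup>2 < b * (a * c)" "c * z\<^sup>2 < c * (a * b)"
    using sq pos by simp_all
  moreover have "0 \<le> a * x\<^sup>2" "0 \<le> b * y\<^sup>2" "0 \<le> c * z\<^sup>2" using pos by simp_all
  ultimately have "a * b * c * (-1) < a * b * c * k" "a * b * c * k < a * b * c * 2"
    unfolding k[symmetric] V_def by (simp_all add: mult_ac)
  then have "k = 0 \<or> k = 1" using abc by (simp only: mult_less_cancel_left_pos) linarith
  then show ?thesis
  proof
    assume "k = 0"
    then show ?thesis using k nz by (auto simp: V_def)
  next
    assume "k = 1"
    then have val: "a * x\<^sup>2 + b * y\<^sup>2 = c * (z\<^sup>2 + a * b)" using k by (simp add: V_def algebra_simps)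
    \<comment> \<open>Multiplicativity of norms: with s^2 = -ab the two factors are N(ax + ys) / a
      and N(z - s), and (ax + ys)(z - s) = a(xz + by) + (yz - ax)s.\<close>
    have "a * (x * z + b * y)\<^sup>2 + b * (y * z - a * x)\<^sup>2 = (a * x\<^sup>2 + b * y\<^sup>2) * (z\<^sup>2 + a * b)"
      by (simp add: power2_eq_square algebra_simps)
    also have "\<dots> = c * (z\<^sup>2 + a * b)\<^sup>2" unfolding val by (simp add: power2_eq_square)
    finally have eq: "a * (x * z + b * y)\<^sup>2 + b * (y * z - a * x)\<^sup>2 = c * (z\<^sup>2 + a * b)\<^sup>2" .
    have "z\<^sup>2 + a * b \<noteq> 0" using pos by (smt (verit) mult_pos_pos zero_le_power2)
    then show ?thesis using eq by blast
  qed
qed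

text \<open>Gauss's lemma counts the x in 1, ..., (l - 1)/2 whose double exceeds (l - 1)/2. For l =
  8m + 3 these are 2m + 1, ..., 4m + 1, an odd number of them.\<close>

lemma Legendre_2_minus_1:
  fixes l :: nat
  assumes l: "prime l" "l mod 8 = 3"
  shows "Legendre 2 l = -1"
proof -
  define m where "m = l div 8"
  have lm: "l = 8 * m + 3" using l(2) unfolding m_def by presburger
  have "\<not> int l dvd 2" using lm by (auto dest!: zdvd_imp_le)
  then interpret GAUSS l 2
    using l lm by unfold_locales (auto simp: cong_0_iff)
  have half: "(int l - 1) div 2 = 4 * int m + 1" unfolding lm by simp
  have "E = (\<lambda>x. x * 2) ` {2 * int m + 1 .. 4 * int m + 1}"
  proof -
    have "C = (\<lambda>x. x * 2) ` {0<..4 * int m + 1}"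
      unfolding C_def B_def A_def half image_image
      by (intro image_cong refl mod_pos_pos_trivial) (auto simp: lm)
    then show ?thesis unfolding E_def half by auto
  qed
  then have "card E = card {2 * int m + 1 .. 4 * int m + 1}"
    by (simp add: card_image inj_on_def)
  then have "card E = 2 * m + 1" by simp
  then show ?thesis using gauss_lemma by simp
qed

section \<open>Quaternion algebras split by an imaginary quadratic field\<close>

locale complex_subfield =
  fixes K :: "complex set"
  assumes one_mem: "1 \<in> K"
    and add_mem: "x \<in> K \<Longrightarrow> y \<in> K \<Longrightarrow> x + y \<in> K"
    and uminus_mem: "x \<in> K \<Longrightarrow> - x \<in> K"
    and mult_mem: "x \<in> K \<Longrightarrow> y \<in> K \<Longrightarrow> x * y \<in> K"
    and inverse_mem: "x \<in> K \<Longrightarrow> inverse x \<in> K"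
begin

lemma zero_mem: "0 \<in> K"
  using add_mem[OF one_mem uminus_mem[OF one_mem]] by simp

lemma diff_mem: "x \<in> K \<Longrightarrow> y \<in> K \<Longrightarrow> x - y \<in> K"
  using add_mem[of x "- y"] uminus_mem by simp

lemma divide_mem: "x \<in> K \<Longrightarrow> y \<in> K \<Longrightarrow> x / y \<in> K"
  using mult_mem[of x "inverse y"] inverse_mem by (simp add: divide_inverse)

lemma power_mem: "x \<in> K \<Longrightarrow> x ^ n \<in> K"
  by (induction n) (auto intro: one_mem mult_mem)

lemma sum_mem: "(\<And>i. i \<in> I \<Longrightarrow> f i \<in> K) \<Longrightarrow> sum f I \<in> K"
  by (induction I rule: infinite_finite_induct) (auto intro: zero_mem add_mem)

lemma of_nat_mem: "of_nat n \<in> K"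
  by (induction n) (auto intro: zero_mem one_mem add_mem)

lemma of_int_mem: "of_int n \<in> K"
  by (cases n) (auto intro: of_nat_mem uminus_mem diff_mem one_mem)

lemma of_rat_mem: "of_rat r \<in> K"
  by (cases r) (auto simp: of_rat_rat intro: divide_mem of_int_mem)

lemma numeral_mem: "numeral n \<in> K"
  using of_nat_mem[of "numeral n"] by simp

lemmas mem = numeral_mem zero_mem one_mem add_mem uminus_mem diff_mem mult_mem inverse_mem divide_mem
  power_mem of_nat_mem of_int_mem of_rat_mem

text \<open>For nonzero \<open>a\<close> and \<open>b\<close> this says that the quaternion algebra \<open>(a, b)\<close> over \<open>K\<close> is split.\<close>

definition splits :: "complex \<Rightarrow> complex \<Rightarrow> bool" where
  "splits a b \<longleftrightarrow> (\<exists>x\<in>K. \<exists>y\<in>K. \<exists>z\<in>K. (x \<noteq> 0 \<or> y \<noteq> 0 \<or> z \<noteq> 0) \<and> a * x\<^sup>2 + b * y\<^sup>2 = z\<^sup>2)"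

lemma splitsI:
  "x \<in> K \<Longrightarrow> y \<in> K \<Longrightarrow> z \<in> K \<Longrightarrow> x \<noteq> 0 \<or> y \<noteq> 0 \<or> z \<noteq> 0 \<Longrightarrow> a * x\<^sup>2 + b * y\<^sup>2 = z\<^sup>2 \<Longrightarrow> splits a b"
  unfolding splits_def by blast

lemma splits_commute: "splits a b \<longleftrightarrow> splits b a"
  unfolding splits_def by (metis add.commute)

lemma splits_uminus: "splits a (- a)"
  by (rule splitsI[of 1 1 0]) (auto intro: mem)

lemma splits_1: "splits a 1"
  by (rule splitsI[of 0 1 1]) (auto intro: mem)

text \<open>A zero with nonzero \<open>y\<close> scales to y = 1 and presents \<open>b\<close> as a
  norm from K(sqrt a). A zero with y = 0 makes \<open>a\<close> a square in \<open>K\<close>, and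
  then the norm form is hyperbolic and takes every value.\<close>

lemma splits_iff_norm:
  assumes "a \<in> K" "b \<in> K" "a \<noteq> 0"
  shows "splits a b \<longleftrightarrow> (\<exists>u\<in>K. \<exists>v\<in>K. b = u\<^sup>2 - a * v\<^sup>2)"
proof
  assume "splits a b"
  then obtain x y z where xyz: "x \<in> K" "y \<in> K" "z \<in> K" "x \<noteq> 0 \<or> y \<noteq> 0 \<or> z \<noteq> 0" 
    "a * x\<^sup>2 + b * y\<^sup>2 = z\<^sup>2" unfolding splits_def by blast
  show "\<exists>u\<in>K. \<exists>v\<in>K. b = u\<^sup>2 - a * v\<^sup>2"
  proof (cases "y = 0")
    case False
    then have "b = (z / y)\<^sup>2 - a * (x / y)\<^sup>2" using xyz(5) by (simp add: field_simps)
    then show ?thesis using divide_mem[OF xyz(3,2)] divide_mem[OF xyz(1,2)] by blast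
  next
    case True
    define s where "s = z / x"
    have "x \<noteq> 0" using xyz True by auto
    then have s: "s \<in> K" "s\<^sup>2 = a" using xyz True by (auto simp: s_def field_simps intro: mem)
    then have "s \<noteq> 0" using assms by auto
    \<comment> \<open>The identity b = ((b + 1)/2)^2 - ((b - 1)/2)^2, with s^2 inserted in the
      second square.\<close>
    have "b = ((b + 1) / 2)\<^sup>2 - s\<^sup>2 * ((b - 1) / (2 * s))\<^sup>2"
      using \<open>s \<noteq> 0\<close> by (simp add: field_simps power2_eq_square)
    moreover have "(b + 1) / 2 \<in> K" "(b - 1) / (2 * s) \<in> K" using assms s by (auto intro!: mem)
    ultimately show ?thesis using s(2) by fastforce
  qed
next
  assume "\<exists>u\<in>K. \<exists>v\<in>K. b = u\<^sup>2 - a * v\<^sup>2"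
  then obtain u v where "u \<in> K" "v \<in> K" "b = u\<^sup>2 - a * v\<^sup>2" by blast
  then show "splits a b" by (intro splitsI[of v 1 u]) (auto intro: mem)
qed

text \<open>Norms from K(sqrt a) are multiplicative, by Brahmagupta's identity. This is the
  bilinearity on which the reduction to -1 and primes rests.\<close>

lemma splits_mult:
  assumes "a \<in> K" "b \<in> K" "c \<in> K" "a \<noteq> 0" "splits a b" "splits a c"
  shows "splits a (b * c)"
proof -
  obtain u v u' v' where h: "u \<in> K" "v \<in> K" "b = u\<^sup>2 - a * v\<^sup>2" "u' \<in> K" "v' \<in> K" "c = u'\<^sup>2 - a * v'\<^sup>2"
    using assms splits_iff_norm by metis
  have "b * c = (u * u' + a * v * v')\<^sup>2 - a * (u * v' + v * u')\<^sup>2"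
    unfolding h(3,6) by (simp add: power2_eq_square algebra_simps)
  moreover have "u * u' + a * v * v' \<in> K" "u * v' + v * u' \<in> K" using h assms by (auto intro: mem)
  ultimately show ?thesis
    using splits_iff_norm[OF assms(1) mult_mem[OF assms(2,3)] assms(4)] by blast
qed

text \<open>\<open>b * (b * c)\<close> is \<open>c\<close> times a square, which is absorbed into
  the variable \<open>y\<close>.\<close>

lemma splits_mult_cancel:
  assumes "a \<in> K" "b \<in> K" "c \<in> K" "a \<noteq> 0" "b \<noteq> 0" "splits a b" "splits a (b * c)"
  shows "splits a c"
proof -
  have "splits a (b * (b * c))"
    by (rule splits_mult[OF assms(1,2) mult_mem[OF assms(2,3)] assms(4,6,7)])
  then obtain x y z where h: "x \<in> K" "y \<in> K" "z \<in> K" "x \<noteq> 0 \<or> y \<noteq> 0 \<or> z \<noteq> 0" 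
    "a * x\<^sup>2 + b * (b * c) * y\<^sup>2 = z\<^sup>2" unfolding splits_def by blast
  have "a * x\<^sup>2 + c * (b * y)\<^sup>2 = z\<^sup>2" using h(5) by (simp add: power2_eq_square mult_ac)
  then show ?thesis using h assms by (intro splitsI[of x "b * y" z]) (auto intro: mem)
qed

end

section \<open>Residues as input for Legendre's equation\<close>

text \<open>If t^2 = ab and a' inverts a modulo \<open>n\<close>, then x = a' t works. This is the
  shape in which \<open>legendre_equation\<close> takes its residues.\<close>

lemma Legendre_eq_1_imp:
  fixes n :: nat
  assumes n: "prime n" and L: "Legendre (a * b) n = 1"
  shows "\<exists>x. int n dvd a * x\<^sup>2 - b"
proof -
  have "\<not> int n dvd a * b" using L Legendre_eq_0_iff[of "a * b" n] by auto
  then have "\<not> int n dvd a" by auto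
  then have "coprime a (int n)" using n prime_imp_coprime[of "int n" a] by (simp add: coprime_commute)
  then obtain a' where a': "[a * a' = 1] (mod n)" using cong_solve_coprime_int by blast
  obtain t where t: "[t\<^sup>2 = a * b] (mod n)"
    using L by (auto simp: Legendre_def QuadRes_def split: if_splits)
  have "a * (a' * t)\<^sup>2 = a * a'\<^sup>2 * t\<^sup>2" by (simp add: power_mult_distrib)
  also have "[a * a'\<^sup>2 * t\<^sup>2 = a * a'\<^sup>2 * (a * b)] (mod n)" using t by (intro cong_mult cong_refl)
  also have "a * a'\<^sup>2 * (a * b) = (a * a')\<^sup>2 * b" by (simp add: power2_eq_square mult_ac)
  also have "[(a * a')\<^sup>2 * b = 1\<^sup>2 * b] (mod n)" using a' by (intro cong_mult cong_pow cong_refl)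
  finally show ?thesis by (auto simp: cong_iff_dvd_diff)
qed

lemma Legendre_minus_1:
  fixes p :: nat
  assumes p: "prime p" "2 < p"
  shows "Legendre (-1) p = (-1) ^ ((p - 1) div 2)"
proof -
  have "int p dvd Legendre (-1) p - (-1) ^ ((p - 1) div 2)"
    using euler_criterion[OF p, of "-1"] by (simp add: cong_iff_dvd_diff)
  moreover have "\<bar>Legendre (-1) p - (-1) ^ ((p - 1) div 2)\<bar> \<le> 2"
    using Legendre_in[of "-1" p] by (cases "even ((p - 1) div 2)") auto
  ultimately show ?thesis
    using p(2) dvd_imp_le_int[of "Legendre (-1) p - (-1) ^ ((p - 1) div 2)" "int p"] by fastforce
qed

lemma Legendre_minus_1_mod_4:
  fixes p :: nat
  assumes p: "prime p" "2 < p"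
  shows "p mod 4 = 1 \<Longrightarrow> Legendre (-1) p = 1" "p mod 4 = 3 \<Longrightarrow> Legendre (-1) p = -1"
proof -
  assume "p mod 4 = 1"
  then have "even ((p - 1) div 2)" by presburger
  then show "Legendre (-1) p = 1" using Legendre_minus_1[OF p] by simp
next
  assume "p mod 4 = 3"
  then have "odd ((p - 1) div 2)" by presburger
  then show "Legendre (-1) p = -1" using Legendre_minus_1[OF p] by simp
qed

lemma Legendre_reciprocity_mod_4:
  fixes p q :: nat
  assumes pq: "prime p" "2 < p" "prime q" "2 < q" "p \<noteq> q"
  shows "p mod 4 = 1 \<Longrightarrow> Legendre p q = Legendre q p"
    "p mod 4 = 3 \<Longrightarrow> q mod 4 = 3 \<Longrightarrow> Legendre p q = - Legendre q p"
proof -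
  note R = Quadratic_Reciprocity[OF pq]
  have "\<not> int q dvd int p" using pq primes_dvd_imp_eq[of q p] by auto
  then have nz: "Legendre p q \<in> {-1, 1}" using Legendre_in[of p q] Legendre_eq_0_iff[of p q] by auto
  {
    assume "p mod 4 = 1"
    then have "even ((p - 1) div 2)" by presburger
    then have "Legendre p q * Legendre q p = 1" using R by simp
    then show "Legendre p q = Legendre q p" using nz by auto
  next
    assume "p mod 4 = 3" "q mod 4 = 3"
    then have "odd ((p - 1) div 2)" "odd ((q - 1) div 2)" by presburger+
    then have "Legendre p q * Legendre q p = -1" using R by simp
    then show "Legendre p q = - Legendre q p" using nz by auto
  }
qed

lemma prime_mult_not_square:
  fixes p q s :: int
  assumes "prime p" "\<not> p dvd q"
  shows "s\<^sup>2 \<noteq> p * q"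
proof
  assume eq: "s\<^sup>2 = p * q"
  then have "p dvd s" using assms(1) by (metis dvd_triv_left prime_dvd_power)
  then obtain t where "s = p * t" by (elim dvdE)
  then have "p * (p * t\<^sup>2) = p * q" using eq by (simp add: power2_eq_square mult_ac)
  then have "p * t\<^sup>2 = q" using assms(1) by auto
  then show False using assms(2) by auto
qed

text \<open>Lets the prime 2 pass through the lemmas about two residues: every odd number is
  congruent to the square 1 modulo 2.\<close>

lemma Legendre_modulus_2: "odd a \<Longrightarrow> Legendre a 2 = 1"
proof -
  assume "odd a"
  then have "\<not> [a = 0] (mod 2)" and "[1\<^sup>2 = a] (mod 2)"
    by (simp_all add: cong_0_iff cong_iff_dvd_diff)
  then show ?thesis unfolding Legendre_def QuadRes_def by metis
qed

section \<open>Splitting over a field in which the primes of \<open>P\<close> are inert\<close>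

text \<open>As (-1/p) is 1 or -1 for p = 1 or 3 (mod 4), both Legendre conditions say that -l is a
  nonresidue modulo \<open>p\<close>, so that \<open>p\<close> is inert in Q(sqrt(-l)). Likewise -l
  = 5 (mod 8) makes 2 inert. The tie between \<open>K\<close> and \<open>l\<close> is the square
  root \<open>w\<close>.\<close>

locale inert_primes = complex_subfield K for K +
  fixes P :: "nat set" and l :: nat and w :: complex
  assumes w_mem: "w \<in> K" and w_square: "w\<^sup>2 = - of_nat l"
    and prime_l: "prime l" and l_mod_8: "l mod 8 = 3"
    and prime_P: "p \<in> P \<Longrightarrow> prime p"
    and Legendre_l_1: "p \<in> P \<Longrightarrow> p mod 4 = 1 \<Longrightarrow> Legendre l p = -1"
    and Legendre_l_3: "p \<in> P \<Longrightarrow> p mod 4 = 3 \<Longrightarrow> Legendre l p = 1"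
begin

abbreviation int_splits :: "int \<Rightarrow> int \<Rightarrow> bool" where
  "int_splits a b \<equiv> splits (of_int a) (of_int b)"

lemma int_splits_mult: "a \<noteq> 0 \<Longrightarrow> int_splits a b \<Longrightarrow> int_splits a c \<Longrightarrow> int_splits a (b * c)"
  using splits_mult[OF of_int_mem of_int_mem of_int_mem, of a b c] by simp

lemma int_splits_mult_cancel:
  "a \<noteq> 0 \<Longrightarrow> b \<noteq> 0 \<Longrightarrow> int_splits a b \<Longrightarrow> int_splits a (b * c) \<Longrightarrow> int_splits a c"
  using splits_mult_cancel[OF of_int_mem of_int_mem of_int_mem, of a b c] by simp

lemma int_splits_commute: "int_splits a b \<longleftrightarrow> int_splits b a"
  by (rule splits_commute)

lemma int_splits_uminus: "int_splits a (- a)"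
  using splits_uminus[of "of_int a"] by simp

lemma int_splits_uminus_iff: 
  assumes "a \<noteq> 0" "int_splits (-1) a"
  shows "int_splits a (- b) \<longleftrightarrow> int_splits a b"
proof -
  have m: "int_splits a (-1)" using assms(2) int_splits_commute by blast
  show ?thesis using int_splits_mult[OF assms(1) m, of b] int_splits_mult[OF assms(1) m, of "- b"] by auto
qed

text \<open>(a, -a) is always split, so by bilinearity (a, a) is as good as (a, -1).\<close>

lemma int_splits_self: 
  assumes "a \<noteq> 0" "int_splits (-1) a"
  shows "int_splits a a"
  using int_splits_uminus_iff[OF assms] int_splits_uminus by blast

lemma int_splitsI:
  fixes a b x y z :: int
  assumes "a * x\<^sup>2 + b * y\<^sup>2 = z\<^sup>2" "x \<noteq> 0 \<or> y \<noteq> 0 \<or> z \<noteq> 0"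
  shows "int_splits a b"
proof (rule splitsI)
  show "of_int a * (of_int x)\<^sup>2 + of_int b * (of_int y)\<^sup>2 = (of_int z :: complex)\<^sup>2"
    unfolding assms(1)[THEN arg_cong, of of_int, simplified, symmetric] by simp
qed (use assms(2) in \<open>auto intro: mem\<close>)

text \<open>In \<open>K\<close> the term -l x^2 is the square of w x, so a rational zero involving
  \<open>l\<close> becomes a splitting of the two other coefficients.\<close>

lemma int_splits_sqrt1:
  fixes b c x y z :: int
  assumes "int l * x\<^sup>2 + b * y\<^sup>2 = c * z\<^sup>2" "x \<noteq> 0 \<or> y \<noteq> 0 \<or> z \<noteq> 0"
  shows "int_splits b (- c)"
proof (rule splitsI)
  have "of_int (int l * x\<^sup>2 + b * y\<^sup>2) = (of_int (c * z\<^sup>2) :: complex)" using assms(1) by simp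
  then show "of_int b * (of_int y)\<^sup>2 + of_int (- c) * (of_int z)\<^sup>2 = (w * of_int x)\<^sup>2"
    by (simp add: power_mult_distrib w_square algebra_simps)
  have "w \<noteq> 0" using w_square prime_l by (auto simp: prime_gt_0_nat)
  then show "of_int y \<noteq> (0::complex) \<or> of_int z \<noteq> (0::complex) \<or> w * of_int x \<noteq> 0" using assms(2) by auto
qed (auto intro: mem w_mem)

lemma l_mod_4: "l mod 4 = 3" using l_mod_8 by presburger

lemma l_gt_2: "2 < l"
proof -
  have "l \<noteq> 0" "l \<noteq> 1" "l \<noteq> 2" using l_mod_8 by auto
  then show ?thesis by simp
qed

lemma l_notin_P: "l \<notin> P"
proof
  assume "l \<in> P"
  then have "Legendre l l = 1" using Legendre_l_3 l_mod_4 by blast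
  then show False by (simp add: Legendre_def cong_def)
qed

lemma odd_P: "p \<in> P \<Longrightarrow> p \<noteq> 2 \<Longrightarrow> 2 < p \<and> (p mod 4 = 1 \<or> p mod 4 = 3)"
proof -
  assume p: "p \<in> P" "p \<noteq> 2"
  then have "2 < p" using prime_ge_2_nat[OF prime_P[OF p(1)]] by simp
  moreover have "odd p" using prime_P[OF p(1)] \<open>2 < p\<close> prime_odd_nat by blast
  then have "p mod 4 = 1 \<or> p mod 4 = 3" by presburger
  ultimately show ?thesis by blast
qed

text \<open>Reciprocity compensates the sign between the two conditions on \<open>l\<close>, and l =
  3 (mod 8) covers p = 2. As the value is the same for all of \<open>P\<close>, products of two
  elements of \<open>P\<close> are residues modulo \<open>l\<close>.\<close>

lemma Legendre_P_l: 
  assumes "p \<in> P"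
  shows "Legendre p l = -1"
proof (cases "p = 2")
  case True
  then show ?thesis using Legendre_2_minus_1[OF prime_l l_mod_8] by simp
next
  case False
  note p = odd_P[OF assms False] prime_P[OF assms]
  have ne: "p \<noteq> l" using assms l_notin_P by blast
  show ?thesis
  proof (cases "p mod 4 = 1")
    case True
    then show ?thesis
      using Legendre_reciprocity_mod_4(1)[of p l] p ne prime_l l_gt_2 Legendre_l_1[OF assms] by simp
  next
    case False
    then show ?thesis
      using Legendre_reciprocity_mod_4(2)[of p l] p ne prime_l l_gt_2 l_mod_4 Legendre_l_3[OF assms] by simp
  qed
qed

lemma coprime_P_l: "p \<in> P \<Longrightarrow> coprime (int p) (int l)"
  using prime_P[of p] prime_l l_notin_P by (auto intro!: primes_coprime)

text \<open>Over the rationals (-1, -1) ramifies at 2 and infinity. Since l = 3 (mod 8), -2 is a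
  residue modulo \<open>l\<close> and x^2 + 2 y^2 = l z^2 is solvable. This splits (-1, -2), and
  (-1, 2) is split by -1 + 2 = 1.\<close>

lemma int_splits_minus_1_minus_1: "int_splits (-1) (-1)"
proof -
  have "\<exists>x y z. (x \<noteq> 0 \<or> y \<noteq> 0 \<or> z \<noteq> 0) \<and> (1::int) * x\<^sup>2 + 2 * y\<^sup>2 = int l * z\<^sup>2"
  proof (rule legendre_equation[where \<beta> = 0 and \<alpha> = 1])
    have l: "odd (int l)" using l_gt_2 prime_l prime_odd_nat by auto
    then show "coprime 2 (int l)" by (simp add: coprime_left_2_iff_odd)
    show "2 dvd 1 * 1\<^sup>2 - int l" using l by simp
    have "Legendre (1 * (- 2)) l = 1"
      using Legendre_mult[OF prime_l l_gt_2, of "-1" 2] Legendre_2_minus_1[OF prime_l l_mod_8]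
        Legendre_minus_1_mod_4(2)[OF prime_l l_gt_2 l_mod_4] by simp
    then obtain g where "int l dvd 1 * g\<^sup>2 - (- 2)" using Legendre_eq_1_imp[OF prime_l] by blast
    \<comment> \<open>The \<open>\<gamma>\<close> of the rule is still schematic and cannot mention
      \<open>g\<close>, which was obtained later; the choice term stands in for it.\<close>
    then show "int l dvd 1 * (SOME g. int l dvd 1 * g\<^sup>2 + 2)\<^sup>2 + 2" 
      using someI[of "\<lambda>g. int l dvd 1 * g\<^sup>2 + 2" g] by simp
    show "s\<^sup>2 \<noteq> 2 * int l" for s using l by (intro prime_mult_not_square) auto
  qed (use l_gt_2 in auto)
  then obtain x y z where h: "x \<noteq> 0 \<or> y \<noteq> 0 \<or> z \<noteq> 0" "x\<^sup>2 + 2 * y\<^sup>2 = int l * z\<^sup>2" by auto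
  have "int_splits (-1) (-2)"
  proof (rule splitsI)
    have "of_int (x\<^sup>2 + 2 * y\<^sup>2) = (of_int (int l * z\<^sup>2) :: complex)" using h(2) by simp
    then show "of_int (-1) * (of_int x)\<^sup>2 + of_int (- 2) * (of_int y)\<^sup>2 = (w * of_int z)\<^sup>2"
      by (simp add: power_mult_distrib w_square algebra_simps)
    have "w \<noteq> 0" using w_square prime_l by (auto simp: prime_gt_0_nat)
    then show "of_int x \<noteq> (0::complex) \<or> of_int y \<noteq> (0::complex) \<or> w * of_int z \<noteq> 0" using h(1) by auto
  qed (auto intro: mem w_mem)
  moreover have "int_splits (-1) 2" by (rule int_splitsI[of _ 1 _ 1 1]) auto
  ultimately show ?thesis using int_splits_mult_cancel[of "-1" 2 "-1"] by simp
qed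

text \<open>For p = 1 (mod 4) a rational zero comes from two squares. For p = 3 (mod 4) the rational
  algebra ramifies at \<open>p\<close> and 2, and the square -l of \<open>K\<close> has to
  enter.\<close>

lemma int_splits_minus_1_P:
  assumes p: "p \<in> P"
  shows "int_splits (-1) p"
proof (cases "p = 2")
  case True
  have "int_splits (-1) 2" by (rule int_splitsI[of _ 1 _ 1 1]) auto
  then show ?thesis using True by simp
next
  case False
  note p' = odd_P[OF p False] prime_P[OF p]
  have odd: "odd (int p)" using p' prime_odd_nat by auto
  show ?thesis
  proof (cases "p mod 4 = 1")
    case True
    then have "Legendre (1 * (- 1)) p = 1" using Legendre_minus_1_mod_4(1)[of p] p' by simp
    then obtain g where g: "int p dvd 1 * g\<^sup>2 - (- 1)" using Legendre_eq_1_imp[OF p'(2)] by blast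
    have "\<exists>x y z. (x \<noteq> 0 \<or> y \<noteq> 0 \<or> z \<noteq> 0) \<and> (1::int) * x\<^sup>2 + 1 * y\<^sup>2 = int p * z\<^sup>2"
    proof (rule legendre_equation[where \<beta> = 0 and \<alpha> = 0 and \<gamma> = g])
      show "s\<^sup>2 \<noteq> 1 * int p" for s using prime_mult_not_square[of "int p" 1 s] p' by simp
    qed (use g p' in auto)
    then obtain x y z where h: "x \<noteq> 0 \<or> y \<noteq> 0 \<or> z \<noteq> 0" "x\<^sup>2 + y\<^sup>2 = int p * z\<^sup>2" by auto
    have "z \<noteq> 0"
    proof
      assume "z = 0"
      then show False using h sum_power2_eq_zero_iff[of x y] by auto
    qed
    then show ?thesis using h(2) by (intro int_splitsI[of _ y _ z x]) auto
  next
    case False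
    then have p3: "p mod 4 = 3" using p' by blast
    have "Legendre (int l * 1) p = 1" using Legendre_l_3[OF p p3] by simp
    then obtain a0 where a0: "int p dvd int l * a0\<^sup>2 - 1" using Legendre_eq_1_imp[OF p'(2)] by blast
    \<comment> \<open>The congruence is wanted modulo 2p, hence an odd root; adding the odd number
      \<open>p\<close> to an even root corrects the parity.\<close>
    obtain a where a: "int p dvd int l * a\<^sup>2 - 1" "odd a"
    proof (cases "odd a0")
      case False
      have "int l * (a0 + int p)\<^sup>2 - 1 = (int l * a0\<^sup>2 - 1) + int p * (int l * (2 * a0 + int p))"
        by (simp add: power2_eq_square algebra_simps)
      then have "int p dvd int l * (a0 + int p)\<^sup>2 - 1" using a0 by (metis dvd_add dvd_triv_left)
      then show ?thesis using that[of "a0 + int p"] False odd by simp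
    qed (use that a0 in auto)
    \<comment> \<open>\<open>p\<close> is a nonresidue modulo \<open>l\<close>, but so is 2: hence
      the coefficient 2p. The factor (-1, 2) is cancelled at the end.\<close>
    have "Legendre (2 * int p * 1) l = 1"
      using Legendre_mult[OF prime_l l_gt_2, of 2 p] Legendre_P_l[OF p] Legendre_2_minus_1[OF prime_l l_mod_8] by simp
    then obtain b where b: "int l dvd 2 * int p * b\<^sup>2 - 1" using Legendre_eq_1_imp[OF prime_l] by blast
    have l: "odd (int l)" using l_gt_2 prime_l prime_odd_nat by auto
    have "\<exists>x y z. (x \<noteq> 0 \<or> y \<noteq> 0 \<or> z \<noteq> 0) \<and> int l * x\<^sup>2 + 2 * int p * y\<^sup>2 = 1 * z\<^sup>2"
    proof (rule legendre_equation[where \<beta> = b and \<alpha> = a and \<gamma> = 0])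
      show "coprime (int l) (2 * int p)"
        using coprime_P_l[OF p] l by (simp add: coprime_commute coprime_left_2_iff_odd)
      have "2 dvd int l * a\<^sup>2 - 1" using l a(2) by simp
      then show "2 * int p dvd int l * a\<^sup>2 - 1"
        using a(1) odd by (intro divides_mult) (auto simp: coprime_left_2_iff_odd)
      show "s\<^sup>2 \<noteq> 2 * int p * 1" for s using prime_mult_not_square[of 2 "int p" s] odd by simp
    qed (use b p' l_gt_2 in auto)
    then obtain x y z where "x \<noteq> 0 \<or> y \<noteq> 0 \<or> z \<noteq> 0" "int l * x\<^sup>2 + 2 * int p * y\<^sup>2 = 1 * z\<^sup>2" by auto
    then have "int_splits (2 * int p) (-1)" by (intro int_splits_sqrt1) auto
    then have "int_splits (-1) (2 * int p)" using int_splits_commute by blast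
    moreover have "int_splits (-1) 2" by (rule int_splitsI[of _ 1 _ 1 1]) auto
    ultimately show ?thesis using int_splits_mult_cancel[of "-1" 2 "int p"] by simp
  qed
qed

text \<open>Legendre's theorem with c = 1 splits the algebra already over the rationals.\<close>

lemma int_splits_of_residues:
  assumes p: "p \<in> P" and q: "q \<in> P" and ne: "p \<noteq> q"
    and Leg: "Legendre q p = 1" "Legendre p q = 1"
  shows "int_splits p q"
proof -
  have cop: "coprime (int p) (int q)" using prime_P p q ne by (auto intro!: primes_coprime)
  obtain a where a: "int q dvd int p * a\<^sup>2 - 1" using Legendre_eq_1_imp[OF prime_P[OF q], of "int p" 1] Leg by auto
  obtain b where b: "int p dvd int q * b\<^sup>2 - 1" using Legendre_eq_1_imp[OF prime_P[OF p], of "int q" 1] Leg by auto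
  have "\<exists>x y z. (x \<noteq> 0 \<or> y \<noteq> 0 \<or> z \<noteq> 0) \<and> int p * x\<^sup>2 + int q * y\<^sup>2 = 1 * z\<^sup>2"
  proof (rule legendre_equation[where \<beta> = b and \<alpha> = a and \<gamma> = 0])
    show "s\<^sup>2 \<noteq> int q * 1" for s using prime_mult_not_square[of "int q" 1 s] prime_P[OF q] prime_gt_1_nat[OF prime_P[OF q]] by simp
  qed (use a b cop prime_P[OF p] prime_P[OF q] in \<open>auto simp: prime_gt_0_nat\<close>)
  then show ?thesis using int_splitsI by fastforce
qed

text \<open>A zero of x^2 + p y^2 = q z^2, multiplied by \<open>q\<close>, splits (q, pq). The spare
  factor (q, q) need not split over the rationals, but it does over \<open>K\<close>.\<close>

lemma int_splits_of_residue_minus: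
  assumes p: "p \<in> P" and q: "q \<in> P" and ne: "p \<noteq> q"
    and Leg: "Legendre q p = 1" "Legendre (- int p) q = 1"
  shows "int_splits p q"
proof -
  have cop: "coprime (int p) (int q)" using prime_P p q ne by (auto intro!: primes_coprime)
  obtain a where a: "int p dvd 1 * a\<^sup>2 - int q" using Legendre_eq_1_imp[OF prime_P[OF p], of 1 "int q"] Leg by auto
  obtain c where c: "int q dvd 1 * c\<^sup>2 - (- int p)" using Legendre_eq_1_imp[OF prime_P[OF q], of 1 "- int p"] Leg by auto
  have "\<exists>x y z. (x \<noteq> 0 \<or> y \<noteq> 0 \<or> z \<noteq> 0) \<and> 1 * x\<^sup>2 + int p * y\<^sup>2 = int q * z\<^sup>2"
  proof (rule legendre_equation[where \<beta> = 0 and \<alpha> = a and \<gamma> = c])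
    show "s\<^sup>2 \<noteq> int p * int q" for s
      using prime_mult_not_square[of "int p" "int q" s] prime_P[OF p] prime_P[OF q] ne primes_dvd_imp_eq[of p q] by auto
  qed (use a c cop prime_P[OF p] prime_P[OF q] in \<open>auto simp: prime_gt_0_nat\<close>)
  then obtain x y z where h: "x \<noteq> 0 \<or> y \<noteq> 0 \<or> z \<noteq> 0" "x\<^sup>2 + int p * y\<^sup>2 = int q * z\<^sup>2" by auto
  have "int_splits q (int p * int q)"
  proof (rule int_splitsI)
    have "int q * x\<^sup>2 + int p * int q * y\<^sup>2 = int q * (int q * z\<^sup>2)"
      unfolding h(2)[symmetric] by (simp add: algebra_simps)
    then show "int q * x\<^sup>2 + int p * int q * y\<^sup>2 = (int q * z)\<^sup>2" by (simp add: power2_eq_square mult_ac)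
    show "x \<noteq> 0 \<or> y \<noteq> 0 \<or> int q * z \<noteq> 0" using h(1) prime_P[OF q] by (auto simp: prime_gt_0_nat)
  qed
  moreover have "int_splits q q" using int_splits_self[of q] int_splits_minus_1_P[OF q] prime_P[OF q] by auto
  ultimately have "int_splits q p"
    using int_splits_mult_cancel[of "int q" "int q" "int p"] prime_P[OF q] by (auto simp: mult.commute)
  then show ?thesis using int_splits_commute by blast
qed

text \<open>Here \<open>-l\<close>, a square in \<open>K\<close>, takes the place of the auxiliary prime of the classical proof.\<close>

lemma int_splits_of_nonresidue:
  assumes p: "p \<in> P" "p mod 4 = 1" and q: "q \<in> P" and ne: "p \<noteq> q"
    and Leg: "Legendre q p = -1" "q = 2 \<or> Legendre p q = -1"
  shows "int_splits p q"
proof -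
  note pp = prime_P[OF p(1)] and pq = prime_P[OF q]
  have p2: "2 < p" using odd_P[OF p(1)] p(2) by (cases "p = 2") auto
  have cop: "coprime (int p) (int q)" using pp pq ne by (auto intro!: primes_coprime)
  \<comment> \<open>Two nonresidues make a residue at each modulus: l and q modulo \<open>p\<close>,
    p and q modulo \<open>l\<close>, -l and p modulo an odd \<open>q\<close>.\<close>
  have "Legendre (int l * int q) p = 1"
    using Legendre_mult[OF pp p2, of l q] Legendre_l_1[OF p] Leg by simp
  then obtain a where a: "int p dvd int l * a\<^sup>2 - int q" using Legendre_eq_1_imp[OF pp] by blast
  have "Legendre (int p * int q) l = 1"
    using Legendre_mult[OF prime_l l_gt_2, of p q] Legendre_P_l p q by simp
  then obtain b where b: "int l dvd int p * b\<^sup>2 - int q" using Legendre_eq_1_imp[OF prime_l] by blast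
  have "\<exists>c. int q dvd int l * c\<^sup>2 + int p"
  proof (cases "q = 2")
    case True
    have "odd (int l)" "odd (int p)" using l_gt_2 prime_l p2 pp prime_odd_nat by auto
    then show ?thesis using True by (intro exI[of _ 1]) simp
  next
    case False
    note q' = odd_P[OF q False]
    have "Legendre (int l * (- int p)) q = Legendre l q * (Legendre (-1) q * Legendre p q)"
      using Legendre_mult[OF pq, of l "-int p"] Legendre_mult[OF pq, of "-1" p] q' by simp
    also have "\<dots> = 1"
      using q' Leg False Legendre_l_1[OF q] Legendre_l_3[OF q] Legendre_minus_1_mod_4[OF pq] by auto
    finally obtain c where "int q dvd int l * c\<^sup>2 - (- int p)" using Legendre_eq_1_imp[OF pq] by blast
    then show ?thesis by auto
  qed
  then obtain c where c: "int q dvd int l * c\<^sup>2 + int p" by blast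
  have "\<exists>x y z. (x \<noteq> 0 \<or> y \<noteq> 0 \<or> z \<noteq> 0) \<and> int l * x\<^sup>2 + int p * y\<^sup>2 = int q * z\<^sup>2"
  proof (rule legendre_equation[where \<beta> = b and \<alpha> = a and \<gamma> = c])
    show "s\<^sup>2 \<noteq> int p * int q" for s
      using prime_mult_not_square[of "int p" "int q" s] pp pq ne primes_dvd_imp_eq[of p q] by auto
    show "coprime (int l) (int p)" "coprime (int l) (int q)"
      using coprime_P_l[OF p(1)] coprime_P_l[OF q] by (simp_all only: coprime_commute[of "int l"])
  qed (use a b c cop pp pq l_gt_2 in \<open>auto simp: prime_gt_0_nat\<close>)
  then obtain x y z where "x \<noteq> 0 \<or> y \<noteq> 0 \<or> z \<noteq> 0" "int l * x\<^sup>2 + int p * y\<^sup>2 = int q * z\<^sup>2" by auto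
  then have "int_splits p (- int q)" by (intro int_splits_sqrt1) auto
  then show ?thesis using int_splits_uminus_iff[of "int p" "int q"] int_splits_minus_1_P[OF p(1)] pp by auto
qed

text \<open>Since p = 1 (mod 4), reciprocity with an odd \<open>q\<close> is symmetric: both symbols
  are 1 or both are -1, and each case has its own Legendre equation.\<close>

lemma int_splits_P_1_mod_4:
  assumes p: "p \<in> P" "p mod 4 = 1" and q: "q \<in> P" and ne: "p \<noteq> q"
  shows "int_splits p q"
proof -
  have p2: "2 < p" using odd_P[OF p(1)] p(2) by (cases "p = 2") auto
  have "\<not> int p dvd int q" using primes_dvd_imp_eq[of p q] prime_P p q ne by auto
  then have c: "Legendre q p = 1 \<or> Legendre q p = -1"
    using Legendre_in[of q p] Legendre_eq_0_iff[of q p] by auto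
  have e: "Legendre p q = Legendre q p" if "q \<noteq> 2"
    using Legendre_reciprocity_mod_4(1)[of p q] prime_P p q p2 ne odd_P[OF q that] by auto
  have L2: "Legendre p 2 = 1"
  proof -
    have "odd (int p)" using p2 prime_P p prime_odd_nat by auto
    then show ?thesis by (rule Legendre_modulus_2)
  qed
  show ?thesis
  proof (cases "Legendre q p = 1")
    case True
    then show ?thesis using int_splits_of_residues[OF p(1) q ne] e L2 by (cases "q = 2") auto
  next
    case False
    then show ?thesis using int_splits_of_nonresidue[OF p q ne] c e by auto
  qed
qed

text \<open>Here (-p/q) = -(p/q) = (q/p). So (q/p) = 1 gives both hypotheses of
  \<open>int_splits_of_residue_minus\<close>, and (q/p) = -1 gives them with \<open>p\<close> and
  \<open>q\<close> exchanged.\<close>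

lemma int_splits_P_3_mod_4:
  assumes p: "p \<in> P" "p mod 4 = 3" and q: "q \<in> P" "q mod 4 = 3" and ne: "p \<noteq> q"
  shows "int_splits p q"
proof -
  have p2: "2 < p" and q2: "2 < q" using odd_P[OF p(1)] p(2) odd_P[OF q(1)] q(2) by (cases "p = 2"; cases "q = 2"; auto)+
  have rec: "Legendre p q = - Legendre q p"
    using Legendre_reciprocity_mod_4(2)[of p q] prime_P p q p2 q2 ne by auto
  have neg: "Legendre (- int p) q = - Legendre p q" "Legendre (- int q) p = - Legendre q p"
    using Legendre_mult[of q "-1" p] Legendre_mult[of p "-1" q] prime_P p q p2 q2
      Legendre_minus_1_mod_4(2)[of p] Legendre_minus_1_mod_4(2)[of q] by auto
  have "\<not> int p dvd int q" using primes_dvd_imp_eq[of p q] prime_P p q ne by auto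
  then have "Legendre q p = 1 \<or> Legendre q p = -1"
    using Legendre_in[of q p] Legendre_eq_0_iff[of q p] by auto
  then show ?thesis
  proof
    assume "Legendre q p = 1"
    then show ?thesis using int_splits_of_residue_minus[OF p(1) q(1) ne] rec neg by simp
  next
    assume "Legendre q p = -1"
    then have "int_splits q p" using int_splits_of_residue_minus[OF q(1) p(1)] rec neg ne by simp
    then show ?thesis using int_splits_commute by blast
  qed
qed

text \<open>For p = 3 (mod 4) one of 2 and -2 is a residue modulo \<open>p\<close>, while modulo 2
  both p and -p are.\<close>

lemma int_splits_P_2:
  assumes p: "p \<in> P" "p mod 4 = 3" and two: "2 \<in> P"
  shows "int_splits 2 p"
proof -
  have ne: "2 \<noteq> p" using p by auto
  have p2: "2 < p" using odd_P[OF p(1)] ne by auto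
  have odd: "odd (int p)" using p2 prime_P p prime_odd_nat by auto
  have L2: "Legendre p (int 2) = 1" "Legendre (- int p) (int 2) = 1"
    using odd by (simp_all add: Legendre_modulus_2)
  have L2': "Legendre (-2) p = - Legendre 2 p"
    using Legendre_mult[of p "-1" 2] prime_P p p2 Legendre_minus_1_mod_4(2)[of p] by auto
  have "\<not> int p dvd 2" using p2 by (auto dest!: zdvd_imp_le)
  then have "Legendre 2 p = 1 \<or> Legendre 2 p = -1"
    using Legendre_in[of 2 p] Legendre_eq_0_iff[of 2 p] by auto
  then show ?thesis
  proof
    assume "Legendre 2 p = 1"
    then show ?thesis using int_splits_of_residues[OF two p(1) ne] L2 by simp
  next
    assume "Legendre 2 p = -1"
    then show ?thesis using int_splits_of_residue_minus[OF two p(1) ne] L2 L2' by simp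
  qed
qed

lemma int_splits_P:
  assumes p: "p \<in> P" and q: "q \<in> P"
  shows "int_splits p q"
proof (cases "p = q")
  case True
  then show ?thesis
    using int_splits_self[of p] int_splits_minus_1_P[OF p] prime_gt_0_nat[OF prime_P[OF p]] by auto
next
  case False
  consider "p mod 4 = 1" | "q mod 4 = 1" | "p = 2" "q mod 4 = 3" | "q = 2" "p mod 4 = 3" | "p mod 4 = 3" "q mod 4 = 3"
    using odd_P[OF p] odd_P[OF q] False by blast
  then show ?thesis
  proof cases
    case 2
    then show ?thesis using int_splits_P_1_mod_4[OF q _ p] False int_splits_commute by metis
  next
    case 4
    then show ?thesis using int_splits_P_2[OF p] q int_splits_commute by fastforce
  qed (use int_splits_P_1_mod_4[OF p _ q False] int_splits_P_2[OF q] int_splits_P_3_mod_4[OF p _ q _ False] p in auto)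
qed

text \<open>Signs and multiplicities are ignored, so the class is closed under negation and
  products, in particular under passing to -c0 c1 c2.\<close>

definition P_supported :: "int \<Rightarrow> bool" where
  "P_supported a \<longleftrightarrow> a \<noteq> 0 \<and> (\<forall>p. prime p \<longrightarrow> int p dvd a \<longrightarrow> p \<in> P)"

lemma P_supported_mult: "P_supported a \<Longrightarrow> P_supported b \<Longrightarrow> P_supported (a * b)"
  unfolding P_supported_def by (auto simp: prime_dvd_mult_iff)

lemma P_supported_uminus: "P_supported a \<Longrightarrow> P_supported (- a)"
  unfolding P_supported_def by auto

lemma P_supported_induct:
  assumes a: "P_supported a" and one: "Q 1" and m1: "Q (-1)" and P: "\<And>p. p \<in> P \<Longrightarrow> Q (int p)"
    and mult: "\<And>x y. Q x \<Longrightarrow> Q y \<Longrightarrow> Q (x * y)"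
  shows "Q a"
proof -
  have *: "n > 0 \<Longrightarrow> P_supported (int n) \<Longrightarrow> Q (int n)" for n
  proof (induction n rule: less_induct)
    case (less n)
    show ?case
    proof (cases "n = 1")
      case False
      then obtain p where p: "prime p" "p dvd n" using prime_factor_nat by blast
      then obtain m where m: "n = p * m" by (elim dvdE)
      have "p \<in> P" using p less.prems(2) by (auto simp: P_supported_def)
      moreover have "m > 0" "m < n" using m less.prems(1) prime_gt_1_nat[OF p(1)] by auto
      moreover have "P_supported (int m)" using less.prems(2) m unfolding P_supported_def by auto
      ultimately show ?thesis using less.IH[of m] P mult m by simp
    qed (use one in simp)
  qed
  have nz: "a \<noteq> 0" using a by (simp add: P_supported_def)
  have "Q \<bar>a\<bar>" using *[of "nat \<bar>a\<bar>"] a nz by (simp add: P_supported_def)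
  then show ?thesis using mult[OF m1] by (cases "a \<ge> 0") force+
qed

text \<open>\<open>*\<close> extends splitting from generators to every supported second entry. It
  is applied with first entry -1, then with each \<open>q\<close> in \<open>P\<close>, and by
  symmetry finally with \<open>a\<close>.\<close>

theorem P_supported_splits:
  assumes a: "P_supported a" and b: "P_supported b"
  shows "int_splits a b"
proof -
  have *: "int_splits a b" if "a \<noteq> 0" "int_splits a (-1)" "\<And>q. q \<in> P \<Longrightarrow> int_splits a (int q)" "P_supported b" for a b
    using that(4)
  proof (rule P_supported_induct)
    show "int_splits a 1" using splits_1 by simp
  qed (use that int_splits_mult in auto)
  have nz: "a \<noteq> 0" using a by (simp add: P_supported_def)
  have m1: "int_splits (-1) a"
    using *[of "-1" a] a int_splits_minus_1_minus_1 int_splits_minus_1_P by simp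
  have "int_splits q a" if "q \<in> P" for q
  proof -
    have "int_splits q (-1)" using int_splits_minus_1_P[OF that] int_splits_commute by blast
    then show ?thesis
      using *[of "int q" a] a that prime_gt_0_nat[OF prime_P[OF that]] int_splits_P by auto
  qed
  then show ?thesis using *[OF nz _ _ b] m1 int_splits_commute by blast
qed

end

section \<open>The field Q(sqrt(-l)) and the choice of \<open>l\<close>\<close>

definition imag_quad_field :: "nat \<Rightarrow> complex set" where
  "imag_quad_field l = {of_rat r + of_rat s * (\<i> * of_real (sqrt l)) | r s. True}"

lemma imag_quad_fieldI: "of_rat r + of_rat s * (\<i> * of_real (sqrt l)) \<in> imag_quad_field l"
  unfolding imag_quad_field_def by blast

lemma imag_quad_root_square: "(\<i> * of_real (sqrt l))\<^sup>2 = - of_nat l"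
  by (simp add: power_mult_distrib of_real_power[symmetric] del: of_real_power)

lemma imag_quad_root_mem: "\<i> * of_real (sqrt l) \<in> imag_quad_field l"
  using imag_quad_fieldI[of 0 1 l] by simp

lemma complex_subfield_imag_quad_field:
  assumes l: "l > 0"
  shows "complex_subfield (imag_quad_field l)"
proof
  define w where "w = \<i> * of_real (sqrt l)"
  have w2: "w * w = - of_nat l" using imag_quad_root_square[of l] by (simp add: w_def power2_eq_square)
  have I: "of_rat r + of_rat s * w \<in> imag_quad_field l" for r s
    unfolding w_def by (rule imag_quad_fieldI)
  have E: "\<exists>r s. x = of_rat r + of_rat s * w" if "x \<in> imag_quad_field l" for x
    using that unfolding imag_quad_field_def w_def by blast
  show "1 \<in> imag_quad_field l" using I[of 1 0] by simp
  show "x + y \<in> imag_quad_field l" if xy: "x \<in> imag_quad_field l" "y \<in> imag_quad_field l" for x y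
  proof -
    obtain r s r' s' where "x = of_rat r + of_rat s * w" "y = of_rat r' + of_rat s' * w"
      using E[OF xy(1)] E[OF xy(2)] by blast
    then have "x + y = of_rat (r + r') + of_rat (s + s') * w" by (simp add: of_rat_add algebra_simps)
    then show ?thesis using I by simp
  qed
  show "- x \<in> imag_quad_field l" if x: "x \<in> imag_quad_field l" for x
  proof -
    obtain r s where "x = of_rat r + of_rat s * w" using E[OF x] by blast
    then have "- x = of_rat (- r) + of_rat (- s) * w" by (simp add: of_rat_minus algebra_simps)
    then show ?thesis using I by simp
  qed
  show "x * y \<in> imag_quad_field l" if xy: "x \<in> imag_quad_field l" "y \<in> imag_quad_field l" for x y
  proof -
    obtain r s r' s' where xy': "x = of_rat r + of_rat s * w" "y = of_rat r' + of_rat s' * w"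
      using E[OF xy(1)] E[OF xy(2)] by blast
    have "x * y = of_rat r * of_rat r' + of_rat s * of_rat s' * (w * w) + (of_rat r * of_rat s' + of_rat s * of_rat r') * w"
      unfolding xy' by (simp add: algebra_simps)
    also have "\<dots> = of_rat (r * r' - of_nat l * s * s') + of_rat (r * s' + s * r') * w"
      unfolding w2 by (simp add: of_rat_add of_rat_mult of_rat_diff)
    finally show ?thesis using I by simp
  qed
  show "inverse x \<in> imag_quad_field l" if x': "x \<in> imag_quad_field l" for x
  proof -
    obtain r s where x: "x = of_rat r + of_rat s * w" using E[OF x'] by blast
    \<comment> \<open>The norm of \<open>x\<close>. As l > 0 it vanishes only for x = 0, where the
      total inverse is 0 as well.\<close>
    define N where "N = r\<^sup>2 + of_nat l * s\<^sup>2"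
    show ?thesis
    proof (cases "N = 0")
      case True
      then have "r\<^sup>2 = 0" "of_nat l * s\<^sup>2 = 0"
        using zero_le_power2[of r] mult_nonneg_nonneg[of "of_nat l" "s\<^sup>2"] unfolding N_def by (auto simp: add_nonneg_eq_0_iff)
      then have "r = 0" "s = 0" using l by auto
      then show ?thesis using x I[of 0 0] by simp
    next
      case False
      have "x * (of_rat (r / N) + of_rat (- s / N) * w) = (of_rat r * of_rat r - of_rat s * of_rat s * (w * w)) / of_rat N"
      proof -
        have "of_rat (r / N) + of_rat (- s / N) * w = (of_rat r - of_rat s * w) / of_rat N"
          by (simp add: of_rat_divide of_rat_minus diff_divide_distrib)
        then show ?thesis unfolding x by (simp add: algebra_simps)
      qed
      also have "of_rat r * of_rat r - of_rat s * of_rat s * (w * w) = of_rat N"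
        unfolding w2 N_def by (simp add: of_rat_add of_rat_mult power2_eq_square)
      finally have "x * (of_rat (r / N) + of_rat (- s / N) * w) = 1" using False by simp
      then have "inverse x = of_rat (r / N) + of_rat (- s / N) * w" by (rule inverse_unique)
      then show ?thesis using I by simp
    qed
  qed
qed

lemma imaginary_quadratic_field_imag_quad_field:
  assumes l: "l > 0"
  shows "imaginary_quadratic_field (imag_quad_field l)"
proof -
  let ?K = "imag_quad_field l" and ?R = "class_ring :: complex ring"
  define w where "w = \<i> * of_real (sqrt l)"
  have w: "w \<notin> \<real>" "w \<in> ?K"
    using l imag_quad_root_mem[of l] by (auto simp: w_def complex_is_Real_iff)
  interpret complex_subfield ?K by (rule complex_subfield_imag_quad_field[OF l])
  have ring: "ring ?R" by (rule class_ring.ring_axioms)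
  have "subring ?K ?R"
    by (rule ring.subringI[OF ring]) (auto simp: class_ring_simps intro: mem)
  then have "subcring ?K ?R"
    by (rule ring.subcringI[OF ring]) (simp add: mult.commute)
  moreover have "Units (?R \<lparr> carrier := ?K \<rparr>) = ?K - {\<zero>\<^bsub>?R\<^esub>}"
  proof (intro subset_antisym subsetI)
    fix x assume "x \<in> ?K - {\<zero>\<^bsub>?R\<^esub>}"
    then have x: "x \<in> ?K" "x \<noteq> 0" by auto
    then have "inverse x \<in> ?K" "inverse x * x = 1" "x * inverse x = 1" by (auto intro: inverse_mem)
    then show "x \<in> Units (?R \<lparr> carrier := ?K \<rparr>)" using x unfolding Units_def by (auto intro!: bexI[of _ "inverse x"])
  qed (auto simp: Units_def)
  ultimately have sf: "subfield ?K ?R" by (rule ring.subfieldI[OF ring])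
  note ext = ring.line_extension_mem_iff[OF ring]
  \<comment> \<open>The dimension is counted by line extensions: {0} is extended by 1 to the
    rationals, and these by \<open>w\<close>, which is not rational, to the whole field.\<close>
  define E0 where "E0 = ring.line_extension ?R \<rat> 1 {0}"
  have E0: "E0 = \<rat>"
  proof (rule Set.set_eqI)
    show "u \<in> E0 \<longleftrightarrow> u \<in> \<rat>" for u unfolding E0_def ext by simp
  qed
  have d1: "ring.dimension ?R (Suc 0) \<rat> E0"
    unfolding E0_def using ring.Suc_dim[OF ring, of 1 "{0}" 0 \<rat>] ring.zero_dim[OF ring, of \<rat>] by simp
  have "(of_rat q :: complex) \<in> \<real>" for q
    by (cases q) (simp add: of_rat_rat)
  then have "w \<notin> \<rat>" using w(1) by (auto elim: Rats_cases)
  then have "ring.dimension ?R (Suc (Suc 0)) \<rat> (ring.line_extension ?R \<rat> w E0)"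
    using ring.Suc_dim[OF ring, of w E0 "Suc 0" \<rat>] d1 E0 by simp
  also have "ring.line_extension ?R \<rat> w E0 = ?K"
  proof (rule Set.set_eqI)
    show "u \<in> ring.line_extension ?R \<rat> w E0 \<longleftrightarrow> u \<in> ?K" for u
      unfolding ext E0 imag_quad_field_def w_def[symmetric]
      by (auto simp: Rats_def add.commute)
  qed
  finally have "ring.dimension ?R 2 \<rat> ?K" by (simp add: numeral_2_eq_2)
  moreover have "\<not> ?K \<subseteq> \<real>" using w by blast
  ultimately show ?thesis using sf unfolding imaginary_quadratic_field_def by blast
qed

theorem ex_imaginary_quadratic_field_inert_primes:
  assumes fin: "finite P" and P: "\<And>p. p \<in> P \<Longrightarrow> prime p"
  shows "\<exists>K l w. imaginary_quadratic_field K \<and> inert_primes K P l w"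
proof -
  define T where "T = {4, 8} \<union> (P - {2})"
  \<comment> \<open>At 4 and 8 the value is -1, which leaves l = 3 (mod 8) and also supplies the
    negative value that the existence theorem asks for. At odd \<open>p\<close> it is -(-1/p), so
    that -l becomes a nonresidue.\<close>
  define \<epsilon> :: "nat \<Rightarrow> int" where "\<epsilon> t = (if t mod 4 = 3 then 1 else -1)" for t
  have idx: "symbol_index t" if "t \<in> T" for t
    using that P[of t] prime_ge_2_nat[of t] by (auto simp: T_def symbol_index_def)
  interpret symbol_set T "8 * \<Prod>(T - {4, 8})"
    by unfold_locales (use fin idx in \<open>auto simp: T_def\<close>)
  have "\<exists>l. prime l \<and> coprime l (8 * \<Prod>(T - {4, 8})) \<and> (\<forall>t\<in>T. residue_symbol t l = \<epsilon> t)"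
    by (rule ex_prime_with_residue_symbols) (auto simp: \<epsilon>_def T_def)
  then obtain l where l: "prime l" and sym: "\<And>t. t \<in> T \<Longrightarrow> residue_symbol t l = \<epsilon> t" by blast
  have "l mod 4 = 3" using sym[of 4] by (auto simp: T_def \<epsilon>_def residue_symbol_def split: if_splits)
  moreover have "l mod 8 \<in> {3, 5}" using sym[of 8] by (auto simp: T_def \<epsilon>_def residue_symbol_def split: if_splits)
  moreover have "(l mod 8) mod 4 = l mod 4" by (simp add: mod_mod_cancel)
  ultimately have l8: "l mod 8 = 3" by auto
  have leg: "Legendre l p = \<epsilon> p" if "p \<in> P" "p \<noteq> 2" for p
  proof -
    have "p \<noteq> 4" "p \<noteq> 8" using P[OF that(1)] prime_odd_nat[of p] prime_ge_2_nat[of p] that(2) by force+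
    then show ?thesis using sym[of p] that by (simp add: T_def residue_symbol_def)
  qed
  have "l > 0" using l by (simp add: prime_gt_0_nat)
  interpret complex_subfield "imag_quad_field l" by (rule complex_subfield_imag_quad_field[OF \<open>l > 0\<close>])
  have "inert_primes (imag_quad_field l) P l (\<i> * of_real (sqrt l))"
  proof
    show "Legendre l p = -1" if "p \<in> P" "p mod 4 = 1" for p
      using leg[of p] that by (cases "p = 2") (auto simp: \<epsilon>_def)
    show "Legendre l p = 1" if "p \<in> P" "p mod 4 = 3" for p
      using leg[of p] that by (cases "p = 2") (auto simp: \<epsilon>_def)
  qed (use l l8 P imag_quad_root_mem imag_quad_root_square in auto)
  then show ?thesis using imaginary_quadratic_field_imag_quad_field[OF \<open>l > 0\<close>] by blast
qed

section \<open>Totally isotropic subspaces\<close>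

context inert_primes
begin

text \<open>Multiplied by c2, the equation reads (c2 z)^2 = -c0 c2 x^2 - c1 c2 y^2, a splitting of
  (-c0 c2, -c1 c2).\<close>

lemma diagonal_ternary_isotropic:
  assumes c: "P_supported c0" "P_supported c1" "P_supported c2"
  shows "\<exists>x\<in>K. \<exists>y\<in>K. \<exists>z\<in>K. (x \<noteq> 0 \<or> y \<noteq> 0 \<or> z \<noteq> 0)
    \<and> of_int c0 * x\<^sup>2 + of_int c1 * y\<^sup>2 + of_int c2 * z\<^sup>2 = 0"
proof -
  have "int_splits (- (c0 * c2)) (- (c1 * c2))"
    using c by (intro P_supported_splits P_supported_uminus P_supported_mult)
  then obtain x y z where h: "x \<in> K" "y \<in> K" "z \<in> K" "x \<noteq> 0 \<or> y \<noteq> 0 \<or> z \<noteq> 0"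
    "of_int (- (c0 * c2)) * x\<^sup>2 + of_int (- (c1 * c2)) * y\<^sup>2 = z\<^sup>2"
    unfolding splits_def by blast
  have c2: "c2 \<noteq> 0" using c(3) by (simp add: P_supported_def)
  define z' where "z' = z / of_int c2"
  have z: "z = of_int c2 * z'" using c2 by (simp add: z'_def)
  have "of_int c2 * (of_int c0 * x\<^sup>2 + of_int c1 * y\<^sup>2 + of_int c2 * z'\<^sup>2)
      = z\<^sup>2 - (of_int (- (c0 * c2)) * x\<^sup>2 + of_int (- (c1 * c2)) * y\<^sup>2)"
    unfolding z by (simp add: algebra_simps power2_eq_square)
  then have "of_int c2 * (of_int c0 * x\<^sup>2 + of_int c1 * y\<^sup>2 + of_int c2 * z'\<^sup>2) = 0"
    unfolding h(5) by simp
  then have "of_int c0 * x\<^sup>2 + of_int c1 * y\<^sup>2 + of_int c2 * z'\<^sup>2 = 0" using c2 by simp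
  moreover have "z' \<in> K" unfolding z'_def using h(3) by (intro mem)
  moreover have "x \<noteq> 0 \<or> y \<noteq> 0 \<or> z' \<noteq> 0" using h(4) z by auto
  ultimately show ?thesis using h by blast
qed

text \<open>In the nondegenerate case \<open>t\<close> spans the orthogonal complement of \<open>u\<close> modulo \<open>u\<close>; by
  comparing determinants its norm is \<open>- c0 c1 c2\<close> up to squares.\<close>

lemma diagonal_ternary_split:
  assumes c: "c0 = 0 \<or> P_supported c0" "c1 = 0 \<or> P_supported c1" "c2 = 0 \<or> P_supported c2"
  shows "\<exists>u0\<in>K. \<exists>u1\<in>K. \<exists>u2\<in>K. \<exists>t0\<in>K. \<exists>t1\<in>K. \<exists>t2\<in>K. \<exists>q. (q = 0 \<or> P_supported q)
    \<and> of_int c0 * u0\<^sup>2 + of_int c1 * u1\<^sup>2 + of_int c2 * u2\<^sup>2 = 0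
    \<and> of_int c0 * (u0 * t0) + of_int c1 * (u1 * t1) + of_int c2 * (u2 * t2) = 0
    \<and> of_int c0 * t0\<^sup>2 + of_int c1 * t1\<^sup>2 + of_int c2 * t2\<^sup>2 = of_int q
    \<and> (\<forall>\<alpha> \<beta>. \<alpha> * u0 + \<beta> * t0 = 0 \<longrightarrow> \<alpha> * u1 + \<beta> * t1 = 0 \<longrightarrow> \<alpha> * u2 + \<beta> * t2 = 0 \<longrightarrow> \<alpha> = 0 \<and> \<beta> = 0)"
    (is "\<exists>u0\<in>K. \<exists>u1\<in>K. \<exists>u2\<in>K. \<exists>t0\<in>K. \<exists>t1\<in>K. \<exists>t2\<in>K. \<exists>q. ?P u0 u1 u2 t0 t1 t2 q")
proof -
  have *: ?thesis if "?P u0 u1 u2 t0 t1 t2 q" "u0 \<in> K" "u1 \<in> K" "u2 \<in> K" "t0 \<in> K" "t1 \<in> K" "t2 \<in> K"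
    for u0 u1 u2 t0 t1 t2 q using that by blast
  consider "c0 = 0" | "c1 = 0" | "c2 = 0" | "P_supported c0" "P_supported c1" "P_supported c2"
    using c by blast
  then show ?thesis
  proof cases
    \<comment> \<open>With a zero coefficient its unit vector serves as \<open>u\<close>, and
      another unit vector as \<open>t\<close>.\<close>
    case 1
    then show ?thesis using c by (intro *[of c1 1 0 0 0 1 0]) (auto intro: mem)
  next
    case 2
    then show ?thesis using c by (intro *[of c0 0 1 0 1 0 0]) (auto intro: mem)
  next
    case 3
    then show ?thesis using c by (intro *[of c0 0 0 1 1 0 0]) (auto intro: mem)
  next
    case 4
    then obtain x y z where h: "x \<in> K" "y \<in> K" "z \<in> K" "x \<noteq> 0 \<or> y \<noteq> 0 \<or> z \<noteq> 0"
      "of_int c0 * x\<^sup>2 + of_int c1 * y\<^sup>2 + of_int c2 * z\<^sup>2 = 0"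
      using diagonal_ternary_isotropic by blast
    have nz: "c0 \<noteq> 0" "c1 \<noteq> 0" "c2 \<noteq> 0" using 4 by (auto simp: P_supported_def)
    show ?thesis
    proof (cases "z = 0")
      case True
      then show ?thesis using h 4 by (intro *[of c2 x y 0 0 0 1]) (auto intro: mem)
    next
      case False
      define q where "q = - (c0 * c1 * c2)"
      \<comment> \<open>The vector orthogonal to \<open>u\<close> with last coordinate 0. As that
        coordinate of \<open>u\<close> is \<open>z\<close>, which is nonzero, independence reduces
        to \<open>t\<close> being nonzero.\<close>
      define t0 t1 where "t0 = - of_int c1 * y / z" and "t1 = of_int c0 * x / z"
      have q: "q \<noteq> 0" "P_supported q" using nz 4 by (auto simp: q_def intro!: P_supported_mult P_supported_uminus)
      have "of_int c0 * t0\<^sup>2 + of_int c1 * t1\<^sup>2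
          = of_int c0 * of_int c1 * (of_int c0 * x\<^sup>2 + of_int c1 * y\<^sup>2) / z\<^sup>2"
        using False by (simp add: t0_def t1_def field_simps power2_eq_square)
      also have "of_int c0 * x\<^sup>2 + of_int c1 * y\<^sup>2 = - of_int c2 * z\<^sup>2" using h(5) by (simp add: eq_neg_iff_add_eq_0)
      also have "of_int c0 * of_int c1 * (- of_int c2 * z\<^sup>2) / z\<^sup>2 = of_int q" using False by (simp add: q_def)
      finally have norm: "of_int c0 * t0\<^sup>2 + of_int c1 * t1\<^sup>2 = of_int q" .
      have orth: "of_int c0 * (x * t0) + of_int c1 * (y * t1) = 0"
        using False by (simp add: t0_def t1_def field_simps)
      have "t0 \<noteq> 0 \<or> t1 \<noteq> 0" using norm q(1) by auto
      moreover have "t0 \<in> K" "t1 \<in> K" unfolding t0_def t1_def using h by (auto intro!: mem)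
      ultimately show ?thesis
        using h q norm orth False zero_mem by (intro *[of q x y z t0 t1 0]) auto
    qed
  qed
qed

text \<open>Each step trades three coefficients for the single \<open>q\<close>, so two variables
  buy one vector; \<open>q\<close> is again zero or supported on \<open>P\<close>, which keeps
  \<open>K\<close> fixed. Coefficients may vanish, and independence is over the complex
  numbers.\<close>

theorem diagonal_form_isotropic_subspace:
  assumes "finite I" "card I \<ge> 2 * k + 1" "\<And>i. i \<in> I \<Longrightarrow> a i = 0 \<or> P_supported (a i)"
  shows "\<exists>X :: nat \<Rightarrow> nat \<Rightarrow> complex. (\<forall>j<k. \<forall>i\<in>I. X j i \<in> K)
    \<and> (\<forall>j<k. \<forall>j'<k. (\<Sum>i\<in>I. of_int (a i) * (X j i * X j' i)) = 0)
    \<and> (\<forall>c. (\<forall>i\<in>I. (\<Sum>j<k. c j * X j i) = 0) \<longrightarrow> (\<forall>j<k. c j = 0))"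
  using assms
proof (induction k arbitrary: I a)
  case (Suc k)
  have "3 \<le> card I" using Suc.prems(2) by simp
  then obtain i0 i1 i2 where i: "i0 \<in> I" "i1 \<in> I" "i2 \<in> I" "i0 \<noteq> i1" "i0 \<noteq> i2" "i1 \<noteq> i2"
  proof -
    obtain T where "T \<subseteq> I" "card T = 3" using \<open>3 \<le> card I\<close> obtain_subset_with_card_n by metis
    then show ?thesis using that unfolding card_3_iff by blast
  qed
  obtain u0 u1 u2 t0 t1 t2 q where ut: "u0 \<in> K" "u1 \<in> K" "u2 \<in> K" "t0 \<in> K" "t1 \<in> K" "t2 \<in> K"
    and q: "q = 0 \<or> P_supported q"
    and uu: "of_int (a i0) * u0\<^sup>2 + of_int (a i1) * u1\<^sup>2 + of_int (a i2) * u2\<^sup>2 = 0"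
    and utort: "of_int (a i0) * (u0 * t0) + of_int (a i1) * (u1 * t1) + of_int (a i2) * (u2 * t2) = 0"
    and tt: "of_int (a i0) * t0\<^sup>2 + of_int (a i1) * t1\<^sup>2 + of_int (a i2) * t2\<^sup>2 = of_int q"
    and indep: "\<forall>\<alpha> \<beta>. \<alpha> * u0 + \<beta> * t0 = 0 \<longrightarrow> \<alpha> * u1 + \<beta> * t1 = 0 \<longrightarrow> \<alpha> * u2 + \<beta> * t2 = 0 \<longrightarrow> \<alpha> = 0 \<and> \<beta> = 0"
    using diagonal_ternary_split[OF Suc.prems(3) Suc.prems(3) Suc.prems(3), OF i(1) i(2) i(3)]
    by (elim exE bexE conjE)
  define J where "J = I - {i0, i1, i2}"
  define a' where "a' = a(i0 := q)"
  have J: "finite J" "i0 \<notin> J" "i1 \<notin> J" "i2 \<notin> J" "I = insert i0 (insert i1 (insert i2 J))"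
    using Suc.prems(1) i by (auto simp: J_def)
  have "card I = card J + 3" using J i by simp
  then have card: "2 * k + 1 \<le> card (insert i0 J)" using Suc.prems(2) J by simp
  have supp: "a' i = 0 \<or> P_supported (a' i)" if "i \<in> insert i0 J" for i
    using that q Suc.prems(3) J by (auto simp: a'_def)
  have "finite (insert i0 J)" using J(1) by simp
  then have "\<exists>Y. (\<forall>j<k. \<forall>i\<in>insert i0 J. Y j i \<in> K)
    \<and> (\<forall>j<k. \<forall>j'<k. (\<Sum>i\<in>insert i0 J. of_int (a' i) * (Y j i * Y j' i)) = 0)
    \<and> (\<forall>c. (\<forall>i\<in>insert i0 J. (\<Sum>j<k. c j * Y j i) = 0) \<longrightarrow> (\<forall>j<k. c j = 0))"
    using card supp by (rule Suc.IH)
  then obtain Y where Y: "\<forall>j<k. \<forall>i\<in>insert i0 J. Y j i \<in> K"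
    "\<forall>j<k. \<forall>j'<k. (\<Sum>i\<in>insert i0 J. of_int (a' i) * (Y j i * Y j' i)) = 0"
    "\<forall>c. (\<forall>i\<in>insert i0 J. (\<Sum>j<k. c j * Y j i) = 0) \<longrightarrow> (\<forall>j<k. c j = 0)"
    by (elim exE conjE)
  have Y_mem: "Y j i \<in> K" if "j < k" "i \<in> insert i0 J" for j i
    using Y(1) that by blast
  have Y_gram: "(\<Sum>i\<in>insert i0 J. of_int (a' i) * (Y j i * Y j' i)) = 0" if "j < k" "j' < k" for j j'
    using Y(2) that by blast
  have Y_indep: "\<forall>j<k. c j = 0" if "\<And>i. i \<in> insert i0 J \<Longrightarrow> (\<Sum>j<k. c j * Y j i) = 0" for c
    using Y(3) that by blast
  \<comment> \<open>Vector \<open>k\<close> is \<open>u\<close>. The others are the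
    \<open>Y j\<close> under the isometry that sends the basis vector i0 of the smaller form to
    \<open>t\<close> and fixes those in \<open>J\<close>.\<close>
  define X where "X j i = (if j = k then (if i = i0 then u0 else if i = i1 then u1 else if i = i2 then u2 else 0)
      else if i = i0 then Y j i0 * t0 else if i = i1 then Y j i0 * t1 else if i = i2 then Y j i0 * t2 else Y j i)" for j i
  have Xk: "X k i0 = u0" "X k i1 = u1" "X k i2 = u2" "\<And>i. i \<in> J \<Longrightarrow> X k i = 0"
    using i J by (auto simp: X_def)
  have Xj: "X j i0 = Y j i0 * t0" "X j i1 = Y j i0 * t1" "X j i2 = Y j i0 * t2" "\<And>i. i \<in> J \<Longrightarrow> X j i = Y j i"
    if "j < k" for j
    using i J that by (auto simp: X_def)
  have sum_I: "(\<Sum>i\<in>I. f i) = f i0 + f i1 + f i2 + (\<Sum>i\<in>J. f i)" for f :: "nat \<Rightarrow> complex"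
    using i J by (simp add: add.assoc)
  have gram1: "(\<Sum>i\<in>I. of_int (a i) * (X j i * X j' i)) = 0" if "j < k" "j' < k" for j j'
  proof -
    have "(\<Sum>i\<in>J. of_int (a i) * (X j i * X j' i)) = (\<Sum>i\<in>J. of_int (a' i) * (Y j i * Y j' i))"
      using J that by (intro sum.cong) (auto simp: Xj a'_def)
    moreover have "of_int (a i0) * (Y j i0 * t0 * (Y j' i0 * t0)) + of_int (a i1) * (Y j i0 * t1 * (Y j' i0 * t1))
        + of_int (a i2) * (Y j i0 * t2 * (Y j' i0 * t2)) = of_int (a' i0) * (Y j i0 * Y j' i0)"
      unfolding a'_def fun_upd_same tt[symmetric] by (simp add: algebra_simps power2_eq_square)
    ultimately show ?thesis using Y_gram[OF that] J(1,2) by (simp add: sum_I Xj that)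
  qed
  have gram2: "(\<Sum>i\<in>I. of_int (a i) * (X k i * X j i)) = 0" if "j < k" for j
  proof -
    have "of_int (a i0) * (u0 * (Y j i0 * t0)) + of_int (a i1) * (u1 * (Y j i0 * t1)) + of_int (a i2) * (u2 * (Y j i0 * t2))
        = Y j i0 * (of_int (a i0) * (u0 * t0) + of_int (a i1) * (u1 * t1) + of_int (a i2) * (u2 * t2))"
      by (simp add: algebra_simps)
    then show ?thesis unfolding utort by (simp add: sum_I Xk Xj that)
  qed
  have gram3: "(\<Sum>i\<in>I. of_int (a i) * (X k i * X k i)) = 0"
    using uu by (simp add: sum_I Xk power2_eq_square)
  show ?case
  proof (intro exI[of _ X] conjI allI impI ballI)
    show "X j i \<in> K" if "j < Suc k" "i \<in> I" for j i
      using that ut J i Y_mem[of j] by (auto simp: X_def less_Suc_eq intro!: mem)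
    show "(\<Sum>i\<in>I. of_int (a i) * (X j i * X j' i)) = 0" if jj: "j < Suc k" "j' < Suc k" for j j'
    proof -
      have gram2': "(\<Sum>i\<in>I. of_int (a i) * (X j i * X k i)) = 0" if "j < k" for j
        using gram2[OF that] by (simp only: mult.commute)
      consider "j < k" "j' < k" | "j = k" "j' < k" | "j < k" "j' = k" | "j = k" "j' = k"
        using jj by linarith
      then show ?thesis using gram1 gram2 gram2' gram3 by cases blast+
    qed
    show "c j = 0" if c: "\<forall>i\<in>I. (\<Sum>j<Suc k. c j * X j i) = 0" and j: "j < Suc k" for c j
    proof -
      \<comment> \<open>In the coordinates i0, i1, i2 the combination is c k u + s t, so
        \<open>indep\<close> gives c k = 0 and s = 0. The latter is the coordinate i0 of the
        relation among the \<open>Y j\<close>.\<close>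
      define s where "s = (\<Sum>j<k. c j * Y j i0)"
      have *: "c k * X k i + (\<Sum>j<k. c j * X j i) = 0" if "i \<in> I" for i
        using c that by (simp add: add.commute)
      have "(\<Sum>j<k. c j * X j i0) = s * t0" "(\<Sum>j<k. c j * X j i1) = s * t1" "(\<Sum>j<k. c j * X j i2) = s * t2"
        unfolding s_def sum_distrib_right by (auto intro!: sum.cong simp: Xj)
      then have "c k = 0 \<and> s = 0"
        using *[OF i(1)] *[OF i(2)] *[OF i(3)] by (intro indep[rule_format]) (simp_all add: Xk)
      moreover have "(\<Sum>j<k. c j * Y j i) = 0" if "i \<in> J" for i
      proof -
        have "(\<Sum>j<k. c j * Y j i) = (\<Sum>j<k. c j * X j i)" using that by (intro sum.cong) (auto simp: Xj)
        then show ?thesis using *[of i] that J by (simp add: Xk)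
      qed
      ultimately have "\<forall>j<k. c j = 0" using Y_indep[of c] unfolding s_def by blast
      then show ?thesis using \<open>c k = 0 \<and> s = 0\<close> j by (auto simp: less_Suc_eq)
    qed
  qed
qed simp

end

section \<open>Diagonalisation over the rationals\<close>

definition bilinear_sum :: "nat set \<Rightarrow> (nat \<Rightarrow> nat \<Rightarrow> 'a::comm_ring_1) \<Rightarrow> (nat \<Rightarrow> 'a) \<Rightarrow> (nat \<Rightarrow> 'a) \<Rightarrow> 'a" where
  "bilinear_sum I A x y = (\<Sum>i\<in>I. \<Sum>j\<in>I. A i j * (x i * y j))"

lemma bilinear_sum_commute:
  assumes "\<And>i j. A i j = A j i"
  shows "bilinear_sum I A x y = bilinear_sum I A y x"
  unfolding bilinear_sum_def by (subst sum.swap) (simp add: assms mult.commute)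

lemma bilinear_sum_sum_left:
  "bilinear_sum I A (\<lambda>i. \<Sum>s\<in>S. d s * f s i) y = (\<Sum>s\<in>S. d s * bilinear_sum I A (f s) y)"
proof -
  have "bilinear_sum I A (\<lambda>i. \<Sum>s\<in>S. d s * f s i) y = (\<Sum>i\<in>I. \<Sum>j\<in>I. \<Sum>s\<in>S. d s * (A i j * (f s i * y j)))"
    unfolding bilinear_sum_def by (simp add: sum_distrib_left sum_distrib_right mult_ac)
  also have "\<dots> = (\<Sum>i\<in>I. \<Sum>s\<in>S. \<Sum>j\<in>I. d s * (A i j * (f s i * y j)))"
    by (intro sum.cong refl sum.swap)
  also have "\<dots> = (\<Sum>s\<in>S. \<Sum>i\<in>I. \<Sum>j\<in>I. d s * (A i j * (f s i * y j)))"
    by (rule sum.swap)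
  finally show ?thesis by (simp add: bilinear_sum_def sum_distrib_left)
qed

lemma bilinear_sum_sum_right:
  assumes "\<And>i j. A i j = A j i"
  shows "bilinear_sum I A x (\<lambda>i. \<Sum>s\<in>S. d s * f s i) = (\<Sum>s\<in>S. d s * bilinear_sum I A x (f s))"
  unfolding bilinear_sum_commute[of A I x, OF assms] by (rule bilinear_sum_sum_left)

lemma bilinear_sum_add_left:
  "bilinear_sum I A (\<lambda>i. x i + x' i) y = bilinear_sum I A x y + bilinear_sum I A x' y"
  unfolding bilinear_sum_def by (simp add: algebra_simps sum.distrib)

lemma bilinear_sum_diff_left:
  "bilinear_sum I A (\<lambda>i. x i - d * x' i) y = bilinear_sum I A x y - d * bilinear_sum I A x' y"
  unfolding bilinear_sum_def by (simp add: algebra_simps sum_subtractf sum_distrib_left)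

lemma bilinear_sum_unit:
  assumes "finite I" "a \<in> I" "b \<in> I"
  shows "bilinear_sum I A (\<lambda>i. of_bool (i = a)) (\<lambda>j. of_bool (j = b)) = A a b"
proof -
  have "bilinear_sum I A (\<lambda>i. of_bool (i = a)) (\<lambda>j. of_bool (j = b))
      = (\<Sum>i\<in>I. if i = a then (\<Sum>j\<in>I. if j = b then A i j else 0) else 0)"
    unfolding bilinear_sum_def by (auto intro!: sum.cong)
  then show ?thesis using assms by (simp add: sum.delta)
qed

lemma of_rat_bilinear_sum:
  "(of_rat (bilinear_sum I A x y) :: 'a::field_char_0)
    = bilinear_sum I (\<lambda>i j. of_rat (A i j)) (\<lambda>i. of_rat (x i)) (\<lambda>j. of_rat (y j))"
  unfolding bilinear_sum_def by (simp add: of_rat_sum of_rat_mult)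

text \<open>Gram-Schmidt: an anisotropic \<open>v\<close> is split off, and the projections
  \<open>f s\<close> of the remaining unit vectors carry the form \<open>A'\<close>. The index set
  is arbitrary because any index \<open>p\<close> may be deleted. Complex coefficients in the
  independence make it survive the passage to \<open>K\<close>.\<close>

theorem ex_orthogonal_basis:
  fixes A :: "nat \<Rightarrow> nat \<Rightarrow> rat"
  assumes "finite I" "\<And>i j. A i j = A j i"
  shows "\<exists>M. (\<forall>r\<in>I. \<forall>s\<in>I. r \<noteq> s \<longrightarrow> bilinear_sum I A (M r) (M s) = 0)
    \<and> (\<forall>c :: nat \<Rightarrow> complex. (\<forall>i\<in>I. (\<Sum>r\<in>I. c r * of_rat (M r i)) = 0) \<longrightarrow> (\<forall>r\<in>I. c r = 0))"
  using assms
proof (induction "card I" arbitrary: I A rule: less_induct)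
  case less
  note fin = less.prems(1) and sym = less.prems(2)
  define e :: "nat \<Rightarrow> nat \<Rightarrow> rat" where "e a = (\<lambda>i. of_bool (i = a))" for a
  have e: "bilinear_sum I A (e a) (e b) = A a b" if "a \<in> I" "b \<in> I" for a b
    unfolding e_def by (rule bilinear_sum_unit[OF fin that])
  have sum_e: "(\<Sum>s\<in>S. d s * of_rat (e s i)) = (if i \<in> S then d i else 0)" if "finite S" 
    for S i and d :: "nat \<Rightarrow> complex"
  proof -
    have "(\<Sum>s\<in>S. d s * of_rat (e s i)) = (\<Sum>s\<in>S. if s = i then d s else 0)"
      unfolding e_def by (auto intro!: sum.cong)
    then show ?thesis using that by (simp add: sum.delta)
  qed
  show ?case
  proof (cases "\<exists>i\<in>I. \<exists>j\<in>I. i \<noteq> j \<and> A i j \<noteq> 0")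
    case False
    then show ?thesis using e fin by (intro exI[of _ e]) (auto simp: sum_e)
  next
    case True
    then obtain i j where ij: "i \<in> I" "j \<in> I" "i \<noteq> j" "A i j \<noteq> 0" by blast
    \<comment> \<open>If both diagonal entries vanish, e i + e j has the value 2 A i j; otherwise a
      unit vector works. The condition v p = 1 lets \<open>v\<close> replace e p in the
      basis.\<close>
    have "\<exists>p\<in>I. \<exists>v. v p = 1 \<and> bilinear_sum I A v v \<noteq> 0"
    proof (cases "A i i = 0 \<and> A j j = 0")
      case True
      have "bilinear_sum I A (\<lambda>x. e i x + e j x) (\<lambda>x. e i x + e j x) = 2 * A i j"
        using ij True sym[of j i] 
        by (simp add: bilinear_sum_add_left 
            bilinear_sum_commute[OF sym, where I = I and x = "e a" and y = "\<lambda>x. e i x + e j x" for a] e)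
      then show ?thesis using ij by (intro bexI[of _ i] exI[of _ "\<lambda>x. e i x + e j x"]) (auto simp: e_def)
    next
      case False
      then show ?thesis using e ij by (metis (mono_tags, lifting) e_def of_bool_eq(2))
    qed
    then obtain p v where p: "p \<in> I" "v p = 1" and N: "bilinear_sum I A v v \<noteq> 0" by blast
    define g where "g s = bilinear_sum I A (e s) v / bilinear_sum I A v v" for s
    define f where "f s = (\<lambda>i. e s i - g s * v i)" for s
    have f_orth: "bilinear_sum I A (f s) v = 0" for s
      unfolding f_def bilinear_sum_diff_left using N by (simp add: g_def)
    define I' where "I' = I - {p}"
    define A' where "A' s t = bilinear_sum I A (f s) (f t)" for s t
    have I': "finite I'" "card I' < card I" "I = insert p I'" "p \<notin> I'"
      using fin p card_Diff1_less[OF fin p(1)] by (auto simp: I'_def simp del: card_Diff_insert card_Diff_singleton)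
    have sym': "A' s t = A' t s" for s t unfolding A'_def by (rule bilinear_sum_commute[OF sym])
    obtain M' where M'_orth: "\<And>r s. r \<in> I' \<Longrightarrow> s \<in> I' \<Longrightarrow> r \<noteq> s \<Longrightarrow> bilinear_sum I' A' (M' r) (M' s) = 0"
      and M'_indep: "\<forall>c :: nat \<Rightarrow> complex. (\<forall>i\<in>I'. (\<Sum>r\<in>I'. c r * of_rat (M' r i)) = 0) \<longrightarrow> (\<forall>r\<in>I'. c r = 0)"
      using less.hyps[OF I'(2,1), of A', OF sym'] by blast
    define M where "M r = (if r = p then v else (\<lambda>i. \<Sum>s\<in>I'. M' r s * f s i))" for r
    have Mp: "M p = v" by (simp add: M_def)
    have Mr: "M r = (\<lambda>i. \<Sum>s\<in>I'. M' r s * f s i)" if "r \<in> I'" for r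
      using that I'(4) by (auto simp: M_def)
    have orth1: "bilinear_sum I A (M r) v = 0" if "r \<in> I'" for r
      unfolding Mr[OF that] bilinear_sum_sum_left f_orth by simp
    have orth2: "bilinear_sum I A (M r) (M s) = 0" if "r \<in> I'" "s \<in> I'" "r \<noteq> s" for r s
    proof -
      have "bilinear_sum I A (M r) (M s) = (\<Sum>i\<in>I'. \<Sum>j\<in>I'. A' i j * (M' r i * M' s j))"
        unfolding Mr[OF that(1)] Mr[OF that(2)] bilinear_sum_sum_left bilinear_sum_sum_right[OF sym] A'_def
        by (simp add: sum_distrib_left mult_ac)
      then show ?thesis using M'_orth[OF that] by (simp add: bilinear_sum_def)
    qed
    have "c r = 0" if c: "\<forall>i\<in>I. (\<Sum>r\<in>I. c r * of_rat (M r i)) = 0" and r: "r \<in> I" for c :: "nat \<Rightarrow> complex" and r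
    proof -
      define d where "d s = (\<Sum>r\<in>I'. c r * of_rat (M' r s))" for s
      \<comment> \<open>Collecting terms, the combination is h v plus the sum of d s e s over
        \<open>I'\<close>. Its coordinate at \<open>p\<close> is h, since v p = 1 and
        \<open>p\<close> is not in \<open>I'\<close>.\<close>
      define h where "h = c p - (\<Sum>s\<in>I'. d s * of_rat (g s))"
      have *: "h * of_rat (v i) + (if i \<in> I' then d i else 0) = 0" if "i \<in> I" for i
      proof -
        have "(\<Sum>r\<in>I'. c r * of_rat (M r i)) = (\<Sum>r\<in>I'. \<Sum>s\<in>I'. c r * of_rat (M' r s) * of_rat (f s i))"
          by (intro sum.cong refl) (simp add: Mr of_rat_sum of_rat_mult sum_distrib_left mult.assoc)
        also have "\<dots> = (\<Sum>s\<in>I'. d s * of_rat (f s i))"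
          unfolding d_def sum_distrib_right by (rule sum.swap)
        also have "\<dots> = (\<Sum>s\<in>I'. d s * of_rat (e s i)) - (\<Sum>s\<in>I'. d s * of_rat (g s)) * of_rat (v i)"
          unfolding f_def sum_distrib_right by (simp add: of_rat_diff of_rat_mult sum_subtractf[symmetric] algebra_simps)
        finally have "(\<Sum>r\<in>I'. c r * of_rat (M r i))
            = (if i \<in> I' then d i else 0) - (\<Sum>s\<in>I'. d s * of_rat (g s)) * of_rat (v i)"
          using sum_e[OF I'(1)] by simp
        moreover have "c p * of_rat (v i) + (\<Sum>r\<in>I'. c r * of_rat (M r i)) = 0"
          using c[rule_format, OF that] I' by (simp add: Mp)
        moreover have "(u - E) * x + D = u * x + (D - E * x)" for D E u x :: complex
          by (simp add: algebra_simps)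
        ultimately show ?thesis unfolding h_def by metis
      qed
      have "h = 0" using *[OF p(1)] p(2) I'(4) by simp
      then have d: "d i = 0" if "i \<in> I'" for i using *[of i] that I'(3) by simp
      then have "\<forall>r\<in>I'. c r = 0" using M'_indep unfolding d_def by blast
      moreover have "c p = 0" using \<open>h = 0\<close> d by (simp add: h_def)
      ultimately show ?thesis using r I'(3) by auto
    qed
    moreover have "bilinear_sum I A (M r) (M s) = 0" if rs: "r \<in> I" "s \<in> I" "r \<noteq> s" for r s
    proof -
      have "bilinear_sum I A v (M s) = 0" if "s \<in> I'"
        unfolding bilinear_sum_commute[OF sym, where I = I and x = v] by (rule orth1[OF that])
      moreover have "r = p \<and> s \<in> I' \<or> r \<in> I' \<and> s = p \<or> r \<in> I' \<and> s \<in> I'"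
        using rs I'(3) by blast
      ultimately show ?thesis using orth1 orth2[OF _ _ rs(3)] by (auto simp: Mp)
    qed
    ultimately show ?thesis by blast
  qed
qed

section \<open>From polynomials to symmetric matrices\<close>

lemma quadratic_monomial:
  fixes m :: "nat \<Rightarrow>\<^sub>0 nat" and n :: nat
  assumes n: "Poly_Mapping.keys m \<subseteq> {..<n}"
    and deg: "(\<Sum>i\<in>Poly_Mapping.keys m. Poly_Mapping.lookup m i) = 2"
  shows "\<exists>i j. i < n \<and> j < n \<and>
    (\<forall>x :: nat \<Rightarrow> 'a::comm_semiring_1. (\<Prod>k\<in>Poly_Mapping.keys m. x k ^ Poly_Mapping.lookup m k) = x i * x j)"
proof -
  let ?S = "Poly_Mapping.keys m" and ?f = "Poly_Mapping.lookup m"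
  have fin: "finite ?S" by simp
  have pos: "?f k \<ge> 1" if "k \<in> ?S" for k using that by (simp add: in_keys_iff Suc_le_eq)
  have "?S \<noteq> {}" using deg by auto
  then obtain i where i: "i \<in> ?S" by blast
  have sum: "?f i + sum ?f (?S - {i}) = 2" using deg sum.remove[OF fin i, of ?f] by simp
  have prod: "(\<Prod>k\<in>?S. x k ^ ?f k) = x i ^ ?f i * (\<Prod>k\<in>?S - {i}. x k ^ ?f k)" for x :: "nat \<Rightarrow> 'a"
    by (rule prod.remove[OF fin i])
  have empty: "T = {}" if "T \<subseteq> ?S" "sum ?f T = 0" for T
  proof -
    have "finite T" using that(1) fin finite_subset by blast
    then have "\<forall>k\<in>T. ?f k = 0" using that(2) by simp
    then show ?thesis using pos that(1) by fastforce
  qed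
  consider "?f i = 2" "sum ?f (?S - {i}) = 0" | "?f i = 1" "sum ?f (?S - {i}) = 1"
    using sum pos[OF i] by linarith
  then show ?thesis
  proof cases
    case 1
    then have none: "?S - {i} = {}" using empty[of "?S - {i}"] by blast
    have "(\<Prod>k\<in>?S. x k ^ ?f k) = x i * x i" for x :: "nat \<Rightarrow> 'a"
      unfolding prod none by (simp add: 1 power2_eq_square)
    then show ?thesis using i n by blast
  next
    case 2
    then have "?S - {i} \<noteq> {}" by (metis sum.empty zero_neq_one)
    then obtain j where j: "j \<in> ?S - {i}" by blast
    have fin': "finite (?S - {i})" by simp
    have "?f j \<ge> 1" using pos j by blast
    moreover have "?f j + sum ?f (?S - {i} - {j}) = 1" using 2(2) sum.remove[OF fin' j, of ?f] by linarith
    ultimately have fj: "?f j = 1" "sum ?f (?S - {i} - {j}) = 0" by linarith+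
    then have none: "?S - {i} - {j} = {}" using empty[of "?S - {i} - {j}"] by blast
    have "(\<Prod>k\<in>?S. x k ^ ?f k) = x i * x j" for x :: "nat \<Rightarrow> 'a"
      unfolding prod prod.remove[OF fin' j] none using 2 fj by simp
    then show ?thesis using i j n by blast
  qed
qed

lemma eval_poly_quadratic_form:
  assumes "quadratic_form n Q"
  shows "\<exists>A. (\<forall>i j. A i j = A j i) \<and> (\<forall>x :: complex vec.
    eval_poly Q x = bilinear_sum {..<n} (\<lambda>i j. of_rat (A i j)) (\<lambda>i. x $ i) (\<lambda>i. x $ i))"
proof -
  let ?S = "Poly_Mapping.keys Q" and ?q = "Poly_Mapping.lookup Q"
  have "\<forall>m\<in>?S. \<exists>i j. i < n \<and> j < n \<and>
    (\<forall>x :: nat \<Rightarrow> complex. (\<Prod>k\<in>Poly_Mapping.keys m. x k ^ Poly_Mapping.lookup m k) = x i * x j)"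
    using assms quadratic_monomial unfolding quadratic_form_def by blast
  then obtain I J where IJ: "\<And>m. m \<in> ?S \<Longrightarrow> I m < n \<and> J m < n \<and>
    (\<forall>x :: nat \<Rightarrow> complex. (\<Prod>k\<in>Poly_Mapping.keys m. x k ^ Poly_Mapping.lookup m k) = x (I m) * x (J m))"
    by metis
  \<comment> \<open>Half of each coefficient goes to either order of the two variables; for a square
    both halves land on the same diagonal entry.\<close>
  define A where "A i j = (\<Sum>m\<in>?S. ?q m / 2 * (of_bool (i = I m) * of_bool (j = J m) + of_bool (i = J m) * of_bool (j = I m)))" for i j
  have "A i j = A j i" for i j unfolding A_def by (simp add: add.commute mult.commute)
  moreover have "eval_poly Q x = bilinear_sum {..<n} (\<lambda>i j. of_rat (A i j)) (\<lambda>i. x $ i) (\<lambda>i. x $ i)" for x :: "complex vec"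
  proof -
    have unit: "(\<Sum>i<n. \<Sum>j<n. of_bool (i = a) * of_bool (j = b) * (x $ i * x $ j)) = x $ a * x $ b"
      if "a < n" "b < n" for a b
    proof -
      have "{..<n} \<inter> {i. i = a} = {a}" "{..<n} \<inter> {j. j = b} = {b}" using that by auto
      then show ?thesis by (simp add: mult.assoc sum_distrib_left[symmetric] sum_of_bool_mult_eq)
    qed
    have bool: "of_rat (of_bool b) = (of_bool b :: complex)" for b by (cases b) auto
    have "bilinear_sum {..<n} (\<lambda>i j. of_rat (A i j)) (\<lambda>i. x $ i) (\<lambda>i. x $ i)
      = (\<Sum>i<n. \<Sum>j<n. \<Sum>m\<in>?S. of_rat (?q m) / 2 * ((of_bool (i = I m) * of_bool (j = J m)
          + of_bool (i = J m) * of_bool (j = I m)) * (x $ i * x $ j)))"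
      unfolding bilinear_sum_def A_def
      by (simp add: of_rat_sum of_rat_mult of_rat_divide of_rat_add bool sum_distrib_right mult.assoc)
    also have "\<dots> = (\<Sum>m\<in>?S. \<Sum>i<n. \<Sum>j<n. of_rat (?q m) / 2 * ((of_bool (i = I m) * of_bool (j = J m)
          + of_bool (i = J m) * of_bool (j = I m)) * (x $ i * x $ j)))"
      by (subst sum.swap[of _ ?S], intro sum.cong refl sum.swap)
    also have "\<dots> = (\<Sum>m\<in>?S. of_rat (?q m) * (x $ I m * x $ J m))"
    proof (intro sum.cong refl)
      fix m assume m: "m \<in> ?S"
      have "(\<Sum>i<n. \<Sum>j<n. (of_bool (i = I m) * of_bool (j = J m)
          + of_bool (i = J m) * of_bool (j = I m)) * (x $ i * x $ j)) = x $ I m * x $ J m + x $ J m * x $ I m"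
        using unit[of "I m" "J m"] unit[of "J m" "I m"] IJ[OF m] by (simp add: distrib_right sum.distrib)
      then show "(\<Sum>i<n. \<Sum>j<n. of_rat (?q m) / 2 * ((of_bool (i = I m) * of_bool (j = J m)
          + of_bool (i = J m) * of_bool (j = I m)) * (x $ i * x $ j))) = of_rat (?q m) * (x $ I m * x $ J m)"
        unfolding sum_distrib_left[symmetric] by simp
    qed
    also have "\<dots> = eval_poly Q x" unfolding eval_poly_def using IJ by (intro sum.cong) auto
    finally show ?thesis ..
  qed
  ultimately show ?thesis by blast
qed

text \<open>Clearing a denominator by a square amounts to rescaling a basis vector, so the diagonal
  entries may be taken integral.\<close>

lemma ex_integer_square_multiple: "\<exists>(a::int) (b::int). b \<noteq> 0 \<and> of_int a = (of_int b)\<^sup>2 * (q::rat)"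
proof -
  obtain x y where "q = Rat.Fract x y" "y > 0" by (cases q) auto
  then have "of_int (x * y) = (of_int y)\<^sup>2 * q"
    by (simp add: Fract_of_int_quotient power2_eq_square)
  then show ?thesis using \<open>y > 0\<close> by (intro exI[of _ "x * y"] exI[of _ y]) simp
qed

lemma finite_prime_divisors_of_values:
  assumes "finite I"
  shows "finite {p::nat. prime p \<and> (\<exists>r\<in>I. a r \<noteq> (0::int) \<and> int p dvd a r)}"
proof (rule finite_subset)
  show "{p::nat. prime p \<and> (\<exists>r\<in>I. a r \<noteq> 0 \<and> int p dvd a r)} \<subseteq> (\<Union>r\<in>I. {..nat \<bar>a r\<bar>})"
  proof
    fix p assume "p \<in> {p::nat. prime p \<and> (\<exists>r\<in>I. a r \<noteq> 0 \<and> int p dvd a r)}"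
    then obtain r where r: "r \<in> I" "a r \<noteq> 0" "int p dvd a r" by blast
    have "p \<le> nat \<bar>a r\<bar>" using dvd_imp_le_int[OF r(2,3)] by linarith
    then show "p \<in> (\<Union>r\<in>I. {..nat \<bar>a r\<bar>})" using r(1) by blast
  qed
qed (use assms in auto)

section \<open>Isotropic families and subspaces over \<open>K\<close>\<close>

theorem ex_isotropic_family:
  fixes A :: "nat \<Rightarrow> nat \<Rightarrow> rat"
  assumes sym: "\<And>i j. A i j = A j i" and kn: "n \<ge> 2 * k + 1"
  shows "\<exists>K. imaginary_quadratic_field K \<and> (\<exists>Z :: nat \<Rightarrow> nat \<Rightarrow> complex.
    (\<forall>j<k. \<forall>i<n. Z j i \<in> K)
    \<and> (\<forall>s<k. \<forall>t<k. bilinear_sum {..<n} (\<lambda>i j. of_rat (A i j)) (Z s) (Z t) = 0)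
    \<and> (\<forall>c. (\<forall>i<n. (\<Sum>j<k. c j * Z j i) = 0) \<longrightarrow> (\<forall>j<k. c j = 0)))"
proof -
  obtain M where M_orth: "\<And>r s. r < n \<Longrightarrow> s < n \<Longrightarrow> r \<noteq> s \<Longrightarrow> bilinear_sum {..<n} A (M r) (M s) = 0"
    and M_indep: "\<And>c :: nat \<Rightarrow> complex. (\<And>i. i < n \<Longrightarrow> (\<Sum>r<n. c r * of_rat (M r i)) = 0) \<Longrightarrow> (\<forall>r<n. c r = 0)"
    using ex_orthogonal_basis[of "{..<n}" A, OF finite_lessThan sym] by (auto simp: Ball_def)
  obtain a b :: "nat \<Rightarrow> int" where ab: "\<And>r. b r \<noteq> 0" 
    "\<And>r. of_int (a r) = (of_int (b r))\<^sup>2 * bilinear_sum {..<n} A (M r) (M r)"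
  proof -
    have "\<forall>r. \<exists>a b. b \<noteq> 0 \<and> of_int a = (of_int b)\<^sup>2 * bilinear_sum {..<n} A (M r) (M r)"
      by (intro allI ex_integer_square_multiple)
    then show ?thesis using that unfolding choice_iff by blast
  qed
  define P where "P = {p::nat. prime p \<and> (\<exists>r\<in>{..<n}. a r \<noteq> 0 \<and> int p dvd a r)}"
  have "finite P" unfolding P_def by (rule finite_prime_divisors_of_values) simp
  moreover have "prime p" if "p \<in> P" for p using that by (simp add: P_def)
  ultimately obtain K l w where K: "imaginary_quadratic_field K" "inert_primes K P l w"
    using ex_imaginary_quadratic_field_inert_primes by blast
  interpret inert_primes K P l w by (rule K(2))
  have "\<exists>X :: nat \<Rightarrow> nat \<Rightarrow> complex. (\<forall>j<k. \<forall>i\<in>{..<n}. X j i \<in> K)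
    \<and> (\<forall>j<k. \<forall>j'<k. (\<Sum>i\<in>{..<n}. of_int (a i) * (X j i * X j' i)) = 0)
    \<and> (\<forall>c. (\<forall>i\<in>{..<n}. (\<Sum>j<k. c j * X j i) = 0) \<longrightarrow> (\<forall>j<k. c j = 0))"
  proof (rule diagonal_form_isotropic_subspace)
    show "a r = 0 \<or> P_supported (a r)" if "r \<in> {..<n}" for r
      using that unfolding P_supported_def by (auto simp: P_def)
  qed (use kn in simp_all)
  then obtain X where X: "\<forall>j<k. \<forall>i\<in>{..<n}. X j i \<in> K"
    "\<forall>j<k. \<forall>j'<k. (\<Sum>i\<in>{..<n}. of_int (a i) * (X j i * X j' i)) = 0"
    "\<forall>c. (\<forall>i\<in>{..<n}. (\<Sum>j<k. c j * X j i) = 0) \<longrightarrow> (\<forall>j<k. c j = 0)"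
    by (elim exE conjE)
  let ?B = "bilinear_sum {..<n} (\<lambda>i j. of_rat (A i j) :: complex)"
  \<comment> \<open>Scaling \<open>M r\<close> by \<open>b r\<close> makes its value under the form
    the integer \<open>a r\<close>; the \<open>Z j\<close> are then the \<open>X j\<close>
    transported from the diagonal form.\<close>
  define W where "W r i = (of_rat (of_int (b r) * M r i) :: complex)" for r i
  define Z where "Z j i = (\<Sum>r<n. X j r * W r i)" for j i
  have symC: "of_rat (A i j) = (of_rat (A j i) :: complex)" for i j using sym by simp
  have BW: "?B (W r) (W s) = (if r = s then of_int (a r) else 0)" if "r < n" "s < n" for r s
  proof -
    have "?B (W r) (W s) = of_rat (bilinear_sum {..<n} A (\<lambda>i. of_int (b r) * M r i) (\<lambda>i. of_int (b s) * M s i))"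
      unfolding of_rat_bilinear_sum W_def ..
    also have "bilinear_sum {..<n} A (\<lambda>i. of_int (b r) * M r i) (\<lambda>i. of_int (b s) * M s i)
        = of_int (b r) * of_int (b s) * bilinear_sum {..<n} A (M r) (M s)"
      unfolding bilinear_sum_def by (simp add: sum_distrib_left mult_ac)
    also have "\<dots> = (if r = s then of_int (a r) else 0)"
      using M_orth[OF that] ab(2)[of r] by (auto simp: power2_eq_square)
    finally show ?thesis by simp
  qed
  have gram: "?B (Z s) (Z t) = 0" if "s < k" "t < k" for s t
  proof -
    have "?B (Z s) (Z t) = (\<Sum>r<n. X s r * (\<Sum>q<n. X t q * ?B (W r) (W q)))"
      unfolding Z_def bilinear_sum_sum_left bilinear_sum_sum_right[OF symC] ..
    also have "\<dots> = (\<Sum>r<n. X s r * (\<Sum>q<n. if q = r then X t q * of_int (a r) else 0))"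
      by (intro sum.cong refl arg_cong[where f = "\<lambda>y. _ * y"]) (auto simp: BW)
    also have "\<dots> = (\<Sum>r<n. of_int (a r) * (X s r * X t r))"
      by (intro sum.cong refl) (simp add: sum.delta mult_ac)
    also have "\<dots> = 0" using X(2) that by blast
    finally show ?thesis .
  qed
  have indep: "\<forall>j<k. c j = 0" if c: "\<forall>i<n. (\<Sum>j<k. c j * Z j i) = 0" for c
  proof -
    define d where "d r = (\<Sum>j<k. c j * X j r)" for r
    have "(\<Sum>r<n. d r * of_int (b r) * of_rat (M r i)) = 0" if "i < n" for i
    proof -
      have "(\<Sum>j<k. c j * Z j i) = (\<Sum>j<k. \<Sum>r<n. c j * X j r * W r i)"
        unfolding Z_def by (simp add: sum_distrib_left mult.assoc)
      also have "\<dots> = (\<Sum>r<n. d r * W r i)"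
        unfolding d_def sum_distrib_right by (rule sum.swap)
      finally show ?thesis using c that by (simp add: W_def of_rat_mult mult.assoc)
    qed
    then have "\<forall>r<n. d r * of_int (b r) = 0" by (rule M_indep)
    then have "\<forall>i\<in>{..<n}. (\<Sum>j<k. c j * X j i) = 0" using ab(1) by (simp add: d_def)
    with X(3) show ?thesis by blast
  qed
  have mem_K: "Z j i \<in> K" if "j < k" for j i
    unfolding Z_def W_def using X(1) that by (intro sum_mem mult_mem of_rat_mem) blast
  show ?thesis
  proof (intro exI[of _ K] exI[of _ Z] conjI)
    show "\<forall>s<k. \<forall>t<k. ?B (Z s) (Z t) = 0" using gram by blast
    show "\<forall>c. (\<forall>i<n. (\<Sum>j<k. c j * Z j i) = 0) \<longrightarrow> (\<forall>j<k. c j = 0)" using indep by blast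
  qed (use K(1) mem_K in blast)+
qed

text \<open>Independence over the whole field restricts to \<open>K\<close>, so the
  \<open>K\<close>-span of the family has dimension \<open>k\<close>. The last clause keeps the
  coordinate description of its vectors, for evaluating the form.\<close>

lemma ex_subspace_of_independent_family:
  fixes Z :: "nat \<Rightarrow> nat \<Rightarrow> 'a::field"
  assumes K: "subfield K (class_ring :: 'a ring)"
    and Z: "\<And>j i. j < k \<Longrightarrow> i < n \<Longrightarrow> Z j i \<in> K"
    and indep: "\<And>c. (\<And>i. i < n \<Longrightarrow> (\<Sum>j<k. c j * Z j i) = 0) \<Longrightarrow> (\<forall>j<k. c j = 0)"
  shows "\<exists>W. VectorSpace.subspace (field_of K) W (vec_space_over K n)
    \<and> vectorspace.dim (field_of K) ((vec_space_over K n)\<lparr>carrier := W\<rparr>) = k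
    \<and> (\<forall>x\<in>W. \<exists>c. \<forall>i<n. x $ i = (\<Sum>j<k. c j * Z j i))"
proof -
  let ?K = "field_of K" and ?V = "vec_space_over K n"
  interpret V: vectorspace ?K ?V by (rule vec_space_over_vectorspace[OF K])
  have sel: "carrier ?K = K" "zero ?K = 0"
    "carrier ?V = {v \<in> carrier_vec n. \<forall>i<n. v $ i \<in> K}" "add ?V = (+)" "zero ?V = 0\<^sub>v n"
    "smult ?V = (\<cdot>\<^sub>v)"
    by (simp_all add: field_of_def vec_space_over_def module_vec_def)
  define z where "z j = vec n (Z j)" for j
  define B where "B = z ` {..<k}"
  have z: "z j \<in> carrier ?V" if "j < k" for j
    using Z that by (simp add: z_def sel)
  have B: "B \<subseteq> carrier ?V" "finite B" using z by (auto simp: B_def)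
  have inj: "inj_on z {..<k}"
  proof (rule inj_onI)
    fix s t assume st: "s \<in> {..<k}" "t \<in> {..<k}" "z s = z t"
    have "Z s i = Z t i" if "i < n" for i
      using arg_cong[OF st(3), of "\<lambda>v. v $ i"] that by (simp add: z_def)
    \<comment> \<open>Independence of a set does not see repeated vectors. A repetition would be the
      relation Z s - Z t = 0, which \<open>indep\<close> excludes.\<close>
    then have "(\<Sum>j<k. (of_bool (j = s) - of_bool (j = t)) * Z j i) = 0" if "i < n" for i
    proof -
      have "{..<k} \<inter> {j. j = s} = {s}" "{..<k} \<inter> {j. j = t} = {t}" using st by auto
      then show ?thesis using \<open>\<And>i. i < n \<Longrightarrow> Z s i = Z t i\<close> that
        by (simp add: left_diff_distrib sum_subtractf sum_of_bool_mult_eq)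
    qed
    then have "\<forall>j<k. of_bool (j = s) - of_bool (j = t) = (0::'a)" by (rule indep)
    then have "of_bool (s = s) - of_bool (s = t) = (0::'a)" using st(1) by blast
    then show "s = t" by (cases "s = t") simp_all
  qed
  have lincomb: "V.lincomb a S \<in> carrier_vec n \<and> (\<forall>i<n. V.lincomb a S $ i = (\<Sum>v\<in>S. a v * v $ i))"
    if "finite S" "S \<subseteq> B" "a \<in> S \<rightarrow> K" for a S
    using that
  proof (induction S rule: finite_induct)
    case empty
    then show ?case by (simp add: V.lincomb_def sel)
  next
    case (insert v S)
    have "a v \<odot>\<^bsub>?V\<^esub> v \<in> carrier ?V"
      using insert.prems B by (intro V.smult_closed) (auto simp: sel(1))
    moreover have "(\<lambda>v. a v \<odot>\<^bsub>?V\<^esub> v) \<in> S \<rightarrow> carrier ?V"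
      using insert.prems B by (intro Pi_I V.smult_closed) (auto simp: sel(1))
    ultimately have eq: "V.lincomb a (insert v S) = a v \<cdot>\<^sub>v v + V.lincomb a S"
      using insert.hyps unfolding V.lincomb_def by (subst V.finsum_insert) (auto simp: sel(4,6))
    have v: "v \<in> carrier_vec n" using insert.prems B by (auto simp: sel)
    have IH: "V.lincomb a S \<in> carrier_vec n" "\<forall>i<n. V.lincomb a S $ i = (\<Sum>v\<in>S. a v * v $ i)"
      using insert.IH insert.prems by blast+
    show ?case unfolding eq using v IH insert.hyps by simp
  qed
  \<comment> \<open>Linear dependence speaks of subsets of \<open>B\<close>; extending the
    coefficients by 0 gives a relation over all indices, to which \<open>indep\<close>
    applies.\<close>
  have sum_J: "(\<Sum>v\<in>S. a v * v $ i) = (\<Sum>j<k. (if z j \<in> S then a (z j) else 0) * Z j i)"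
    if "S \<subseteq> B" "i < n" for a S i
  proof -
    define J where "J = {j\<in>{..<k}. z j \<in> S}"
    have S: "S = z ` J" using that(1) by (auto simp: J_def B_def)
    have "inj_on z J" using inj by (rule inj_on_subset) (auto simp: J_def)
    then have "(\<Sum>v\<in>z ` J. a v * v $ i) = (\<Sum>j\<in>J. a (z j) * z j $ i)" by (simp add: sum.reindex)
    also have "\<dots> = (\<Sum>j\<in>J. a (z j) * Z j i)" using that(2) by (simp add: z_def)
    finally have "(\<Sum>v\<in>S. a v * v $ i) = (\<Sum>j\<in>J. a (z j) * Z j i)" using S by simp
    also have "\<dots> = (\<Sum>j<k. (if z j \<in> S then a (z j) else 0) * Z j i)"
      by (intro sum.mono_neutral_cong_left) (auto simp: J_def)
    finally show ?thesis .
  qed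
  have li: "V.lin_indpt B"
  proof
    assume "V.lin_dep B"
    then obtain S a v where h: "finite S" "S \<subseteq> B" "a \<in> S \<rightarrow> carrier ?K" "V.lincomb a S = \<zero>\<^bsub>?V\<^esub>" "v \<in> S" "a v \<noteq> \<zero>\<^bsub>?K\<^esub>"
      unfolding V.lin_dep_def by blast
    have "(\<Sum>j<k. (if z j \<in> S then a (z j) else 0) * Z j i) = 0" if "i < n" for i
    proof -
      have "a \<in> S \<rightarrow> K" "V.lincomb a S = 0\<^sub>v n" using h(3,4) by (simp_all only: sel)
      then have "(\<Sum>v\<in>S. a v * v $ i) = 0\<^sub>v n $ i" using lincomb[OF h(1,2)] that by metis
      then show ?thesis using sum_J[OF h(2) that, of a] that by simp
    qed
    then have "\<forall>j<k. (if z j \<in> S then a (z j) else 0) = 0" by (rule indep)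
    moreover obtain j where "j < k" "v = z j" using h(2,5) by (auto simp: B_def)
    ultimately show False using h(5,6) by (auto simp: sel)
  qed
  have sub: "VectorSpace.subspace ?K (V.span B) ?V" by (rule V.span_is_subspace[OF B(1)])
  interpret W: vectorspace ?K "?V\<lparr>carrier := V.span B\<rparr>" by (rule V.subspace_is_vs[OF sub])
  have subm: "submodule ?K (V.span B) ?V" by (rule V.span_is_submodule[OF B(1)])
  have B_span: "B \<subseteq> V.span B" by (rule V.in_own_span[OF B(1)])
  have "W.basis B"
    unfolding W.basis_def using V.span_li_not_depend[OF B_span subm] li B_span by auto
  then have "W.dim = card B" using B(2) by (intro W.dim_basis)
  also have "card B = k" unfolding B_def using inj by (simp add: card_image)
  finally have dim: "W.dim = k" .
  have "\<exists>c. \<forall>i<n. x $ i = (\<Sum>j<k. c j * Z j i)" if x: "x \<in> V.span B" for x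
  proof -
    obtain a S where "x = V.lincomb a S" "finite S" "S \<subseteq> B" "a \<in> S \<rightarrow> K"
      using x unfolding V.span_def by (auto simp: sel(1))
    then show ?thesis using lincomb[of S a] sum_J[of S _ a] by auto
  qed
  then show ?thesis using sub dim by blast
qed

theorem theorem1p3:
  fixes k n :: nat and Q :: "(nat \<Rightarrow>\<^sub>0 nat) \<Rightarrow>\<^sub>0 rat"
  assumes "quadratic_form n Q"
    and "n \<ge> 2 * k + 1"
  shows "\<exists>K. imaginary_quadratic_field K \<and>
    (\<exists>W. VectorSpace.subspace (field_of K) W (vec_space_over K n) \<and>
         vectorspace.dim (field_of K) ((vec_space_over K n)\<lparr>carrier := W\<rparr>) \<ge> k \<and>
         (\<forall>x\<in>W. eval_poly Q x = 0))"
proof -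
  obtain A where sym: "\<And>i j. A i j = A j i" and eval: "\<And>x :: complex vec.
    eval_poly Q x = bilinear_sum {..<n} (\<lambda>i j. of_rat (A i j)) (\<lambda>i. x $ i) (\<lambda>i. x $ i)"
    using eval_poly_quadratic_form[OF assms(1)] by blast
  let ?B = "bilinear_sum {..<n} (\<lambda>i j. of_rat (A i j) :: complex)"
  obtain K Z where K: "imaginary_quadratic_field K" 
    and Z: "\<forall>j<k. \<forall>i<n. Z j i \<in> K" "\<forall>s<k. \<forall>t<k. ?B (Z s) (Z t) = 0"
      "\<forall>c. (\<forall>i<n. (\<Sum>j<k. c j * Z j i) = 0) \<longrightarrow> (\<forall>j<k. c j = 0)"
    using ex_isotropic_family[where A = A, OF sym assms(2)] by (elim exE conjE)
  have "subfield K (class_ring :: complex ring)" using K by (simp add: imaginary_quadratic_field_def)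
  then obtain W where W: "VectorSpace.subspace (field_of K) W (vec_space_over K n)"
    "vectorspace.dim (field_of K) ((vec_space_over K n)\<lparr>carrier := W\<rparr>) = k"
    and span: "\<forall>x\<in>W. \<exists>c. \<forall>i<n. x $ i = (\<Sum>j<k. c j * Z j i)"
    using ex_subspace_of_independent_family[of K k n Z] Z(1,3) by blast
  have symC: "of_rat (A i j) = (of_rat (A j i) :: complex)" for i j using sym by simp
  have "eval_poly Q x = 0" if x: "x \<in> W" for x
  proof -
    obtain c where c: "\<forall>i<n. x $ i = (\<Sum>j<k. c j * Z j i)" using span x by blast
    have "eval_poly Q x = ?B (\<lambda>i. \<Sum>j<k. c j * Z j i) (\<lambda>i. \<Sum>j<k. c j * Z j i)"
      unfolding eval bilinear_sum_def using c by (intro sum.cong refl) auto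
    \<comment> \<open>All mixed terms vanish too, because the family is pairwise orthogonal and not
      merely isotropic vector by vector.\<close>
    also have "\<dots> = 0"
      unfolding bilinear_sum_sum_left bilinear_sum_sum_right[OF symC] using Z(2) by simp
    finally show ?thesis .
  qed
  then show ?thesis using K W by auto
qed

end
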